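(* Let $\mathcal M\subset B(H)$ be a von Neumann algebra with closed unit ball $\mathcal M_1$. Then the only $C^*$-extreme points of $\mathcal M_1$ are isometries and coisometries (that is, every $C^*$-extreme point of $\mathcal M_1$ is an isometry or a coisometry in $\mathcal M$) if and only if $\mathcal M$ is one of the following: (i) a finite von Neumann algebra, (ii) a properly infinite factor, or (iii) a direct sum of a finite von Neumann algebra and a properly infinite factor.
   Context: For a unital $C^*$-algebra $\mathcal A$ with identity $\mathbf 1$ and closed unit ball $\mathcal A_1$, an element $x\in\mathcal A_1$ is a $C^*$-extreme point of $\mathcal A_1$ if, whenever $x=\sum_{i=1}^k t_i^*x_it_i$ with $x_1,\dots,x_k\in\mathcal A_1$ and $t_1,\dots,t_k\in\mathcal A$ invertible with $\sum_{i=1}^k t_i^*t_i=\mathbf 1$, there exist unitaries $u_1,\dots,u_k\in\mathcal A$ such that $x_i=u_i^*xu_i$ for all $i$. An isometry is an element $v$ with $v^*v=\mathbf 1$; a coisometry is an element $v$ with $vv^*=\mathbf 1$. Direct sums are $\ell_\infty$-sums. *)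

theory Defs
  imports "HOL-Analysis.Analysis"
begin

section \<open>Complex Hilbert spaces and bounded operators\<close>

text \<open>
  A complex Hilbert space is a real Hilbert space with a complex scalar multiplication and a
  sesquilinear inner product (linear in the first argument) whose real part is the real inner
  product. Norm, topology and completeness are those of the real structure, and
  positive definiteness follows from that of the real inner product.
\<close>

class complex_hilbert_space = real_inner + complete_space +
  fixes scaleC :: "complex \<Rightarrow> 'a \<Rightarrow> 'a"
    and cinner :: "'a \<Rightarrow> 'a \<Rightarrow> complex"
  assumes scaleC_add_right: "scaleC c (x + y) = scaleC c x + scaleC c y"
    and scaleC_add_left: "scaleC (c + d) x = scaleC c x + scaleC d x"
    and scaleC_scaleC: "scaleC c (scaleC d x) = scaleC (c * d) x"
    and scaleC_of_real: "scaleC (complex_of_real r) x = scaleR r x"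
    and cinner_commute: "cinner x y = cnj (cinner y x)"
    and cinner_add_left: "cinner (x + y) z = cinner x z + cinner y z"
    and cinner_scaleC_left: "cinner (scaleC c x) y = c * cinner x y"
    and Re_cinner: "Re (cinner x y) = inner x y"

text \<open>\<open>'h \<Rightarrow>\<^sub>L 'h\<close> consists of the real-linear bounded maps; \<open>bounded_ops\<close> is $B(H)$.\<close>

definition bounded_ops :: "('h::complex_hilbert_space \<Rightarrow>\<^sub>L 'h) set" where
  "bounded_ops = {T. \<forall>c x. blinfun_apply T (scaleC c x) = scaleC c (blinfun_apply T x)}"

text \<open>By the Riesz representation theorem every element of \<open>bounded_ops\<close> has a unique adjoint.\<close>

definition adj :: "('h::complex_hilbert_space \<Rightarrow>\<^sub>L 'h) \<Rightarrow> ('h \<Rightarrow>\<^sub>L 'h)" where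
  "adj T = (THE S. \<forall>x y. cinner (blinfun_apply T x) y = cinner x (blinfun_apply S y))"

definition projection :: "('h::complex_hilbert_space \<Rightarrow>\<^sub>L 'h) \<Rightarrow> bool" where
  "projection p \<longleftrightarrow> p \<in> bounded_ops \<and> p o\<^sub>L p = p \<and> adj p = p"


section \<open>Von Neumann algebras\<close>

text \<open>
  In order to speak about von Neumann algebras on closed subspaces of $H$ (the summands of a direct
  sum), algebras are given together with their identity \<open>e\<close>, a projection. The algebra
  $B(eH)$ is identified with the operators $T$ on $H$ with $eTe = T$; this respects products, adjoints
  and norms. An algebra on the whole space is the case \<open>e = id_blinfun\<close>.
\<close>

definition ops_on :: "('h::complex_hilbert_space \<Rightarrow>\<^sub>L 'h) \<Rightarrow> ('h \<Rightarrow>\<^sub>L 'h) set" where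
  "ops_on e = {T \<in> bounded_ops. (e o\<^sub>L T) o\<^sub>L e = T}"

definition commutant ::
  "('h::complex_hilbert_space \<Rightarrow>\<^sub>L 'h) \<Rightarrow> ('h \<Rightarrow>\<^sub>L 'h) set \<Rightarrow> ('h \<Rightarrow>\<^sub>L 'h) set" where
  "commutant e S = {T \<in> ops_on e. \<forall>s\<in>S. T o\<^sub>L s = s o\<^sub>L T}"

text \<open>
  The last condition makes \<open>M\<close> a subalgebra of \<open>ops_on e\<close> with identity \<open>e\<close>.
\<close>

definition von_neumann_algebra ::
  "('h::complex_hilbert_space \<Rightarrow>\<^sub>L 'h) \<Rightarrow> ('h \<Rightarrow>\<^sub>L 'h) set \<Rightarrow> bool" where
  "von_neumann_algebra e M \<longleftrightarrow>
     projection e \<and> M \<subseteq> ops_on e \<and> (\<forall>T\<in>M. adj T \<in> M) \<and> commutant e (commutant e M) = M"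

definition center ::
  "('h::complex_hilbert_space \<Rightarrow>\<^sub>L 'h) \<Rightarrow> ('h \<Rightarrow>\<^sub>L 'h) set \<Rightarrow> ('h \<Rightarrow>\<^sub>L 'h) set" where
  "center e M = M \<inter> commutant e M"

definition factor :: "('h::complex_hilbert_space \<Rightarrow>\<^sub>L 'h) \<Rightarrow> ('h \<Rightarrow>\<^sub>L 'h) set \<Rightarrow> bool" where
  "factor e M \<longleftrightarrow> von_neumann_algebra e M \<and>
     center e M = {T. \<exists>c. \<forall>x. blinfun_apply T x = scaleC c (blinfun_apply e x)}"

text \<open>Murray--von Neumann equivalence of projections relative to \<open>M\<close>.\<close>

definition mvn_equiv ::
  "('h::complex_hilbert_space \<Rightarrow>\<^sub>L 'h) set \<Rightarrow> ('h \<Rightarrow>\<^sub>L 'h) \<Rightarrow> ('h \<Rightarrow>\<^sub>L 'h) \<Rightarrow> bool" where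
  "mvn_equiv M p q \<longleftrightarrow> (\<exists>v\<in>M. adj v o\<^sub>L v = p \<and> v o\<^sub>L adj v = q)"

text \<open>The condition \<open>p o\<^sub>L q = q\<close> expresses $q \le p$.\<close>

definition finite_projection ::
  "('h::complex_hilbert_space \<Rightarrow>\<^sub>L 'h) set \<Rightarrow> ('h \<Rightarrow>\<^sub>L 'h) \<Rightarrow> bool" where
  "finite_projection M p \<longleftrightarrow> projection p \<and> p \<in> M \<and>
     (\<forall>q\<in>M. projection q \<and> p o\<^sub>L q = q \<and> mvn_equiv M p q \<longrightarrow> q = p)"

definition finite_vna :: "('h::complex_hilbert_space \<Rightarrow>\<^sub>L 'h) \<Rightarrow> ('h \<Rightarrow>\<^sub>L 'h) set \<Rightarrow> bool" where
  "finite_vna e M \<longleftrightarrow> von_neumann_algebra e M \<and> finite_projection M e"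

text \<open>The identity is infinite and so is every nonzero central projection; the first requirement
  only excludes the zero algebra.\<close>

definition properly_infinite_vna ::
  "('h::complex_hilbert_space \<Rightarrow>\<^sub>L 'h) \<Rightarrow> ('h \<Rightarrow>\<^sub>L 'h) set \<Rightarrow> bool" where
  "properly_infinite_vna e M \<longleftrightarrow> von_neumann_algebra e M \<and> \<not> finite_projection M e \<and>
     (\<forall>z\<in>center e M. projection z \<and> z \<noteq> 0 \<longrightarrow> \<not> finite_projection M z)"

text \<open>
  \<open>M\<close> (on $eH$) is the direct sum of \<open>N\<close> (on $fH$) and \<open>L\<close> (on $gH$), where $eH$ is the orthogonal sum
  of $fH$ and $gH$. As the summands act on orthogonal subspaces, the operator norm of
  \<open>a + b\<close> is the maximum of the norms of \<open>a\<close> and \<open>b\<close>.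
\<close>

definition is_direct_sum ::
  "('h::complex_hilbert_space \<Rightarrow>\<^sub>L 'h) \<Rightarrow> ('h \<Rightarrow>\<^sub>L 'h) set \<Rightarrow> ('h \<Rightarrow>\<^sub>L 'h) \<Rightarrow> ('h \<Rightarrow>\<^sub>L 'h) set
    \<Rightarrow> ('h \<Rightarrow>\<^sub>L 'h) \<Rightarrow> ('h \<Rightarrow>\<^sub>L 'h) set \<Rightarrow> bool" where
  "is_direct_sum e M f N g L \<longleftrightarrow>
     f o\<^sub>L g = 0 \<and> e = f + g \<and> M = {a + b | a b. a \<in> N \<and> b \<in> L}"


section \<open>$C^*$-extreme points\<close>

text \<open>In the following \<open>A\<close> is a $C^*$-algebra of operators with identity \<open>e\<close>.\<close>

definition closed_unit_ball :: "('h::complex_hilbert_space \<Rightarrow>\<^sub>L 'h) set \<Rightarrow> ('h \<Rightarrow>\<^sub>L 'h) set" where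
  "closed_unit_ball A = {x \<in> A. norm x \<le> 1}"

definition invertible_in ::
  "('h::complex_hilbert_space \<Rightarrow>\<^sub>L 'h) \<Rightarrow> ('h \<Rightarrow>\<^sub>L 'h) set \<Rightarrow> ('h \<Rightarrow>\<^sub>L 'h) \<Rightarrow> bool" where
  "invertible_in e A t \<longleftrightarrow> t \<in> A \<and> (\<exists>s\<in>A. s o\<^sub>L t = e \<and> t o\<^sub>L s = e)"

definition isometry_in ::
  "('h::complex_hilbert_space \<Rightarrow>\<^sub>L 'h) \<Rightarrow> ('h \<Rightarrow>\<^sub>L 'h) set \<Rightarrow> ('h \<Rightarrow>\<^sub>L 'h) \<Rightarrow> bool" where
  "isometry_in e A v \<longleftrightarrow> v \<in> A \<and> adj v o\<^sub>L v = e"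

definition coisometry_in ::
  "('h::complex_hilbert_space \<Rightarrow>\<^sub>L 'h) \<Rightarrow> ('h \<Rightarrow>\<^sub>L 'h) set \<Rightarrow> ('h \<Rightarrow>\<^sub>L 'h) \<Rightarrow> bool" where
  "coisometry_in e A v \<longleftrightarrow> v \<in> A \<and> v o\<^sub>L adj v = e"

definition unitary_in ::
  "('h::complex_hilbert_space \<Rightarrow>\<^sub>L 'h) \<Rightarrow> ('h \<Rightarrow>\<^sub>L 'h) set \<Rightarrow> ('h \<Rightarrow>\<^sub>L 'h) \<Rightarrow> bool" where
  "unitary_in e A u \<longleftrightarrow> u \<in> A \<and> adj u o\<^sub>L u = e \<and> u o\<^sub>L adj u = e"

definition cstar_extreme_point ::
  "('h::complex_hilbert_space \<Rightarrow>\<^sub>L 'h) \<Rightarrow> ('h \<Rightarrow>\<^sub>L 'h) set \<Rightarrow> ('h \<Rightarrow>\<^sub>L 'h) \<Rightarrow> bool" where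
  "cstar_extreme_point e A x \<longleftrightarrow> x \<in> closed_unit_ball A \<and>
     (\<forall>(k::nat) y t.
        (\<forall>i\<in>{1..k}. y i \<in> closed_unit_ball A \<and> invertible_in e A (t i)) \<and>
        (\<Sum>i=1..k. (adj (t i) o\<^sub>L t i)) = e \<and>
        x = (\<Sum>i=1..k. ((adj (t i) o\<^sub>L y i) o\<^sub>L t i)) \<longrightarrow>
        (\<exists>u. \<forall>i\<in>{1..k}. unitary_in e A (u i) \<and> y i = (adj (u i) o\<^sub>L x) o\<^sub>L u i))"

end

theory Submission
  imports Defs
begin

text \<open>
  A $C^*$-extreme point \<open>x\<close> is a partial isometry, because its polar decomposition writes it as the
  midpoint of two partial isometries; moreover \<open>(\<one> - x x\<^sup>\<star>) M (\<one> - x\<^sup>\<star> x) = 0\<close>. So the two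
  defect projections have disjoint central supports: one of them vanishes in a factor, and both do
  in a finite algebra.

  Conversely, if \<open>x\<close> is an isometry on one central summand and a coisometry on the complementary one,
  then it is $C^*$-extreme: a $C^*$-convex combination equal to an isometry \<open>x\<close> forces
  \<open>y\<^sub>i t\<^sub>i = t\<^sub>i x\<close> with isometries \<open>y\<^sub>i\<close>, and similar isometries are unitarily equivalent inside \<open>M\<close> by
  their Wold decompositions. If the properly infinite part of \<open>M\<close> is not a factor, it splits into two
  central summands; a proper isometry on one and a proper coisometry on the other give an \<open>x\<close>
  that is neither.

  Most of the operator theory only uses the underlying real Hilbert space, where the adjoint \<open>T\<^sup>\<star>\<close> is
  defined for every bounded operator; it agrees with \<open>adj\<close> on complex-linear operators.
\<close>

section \<open>Operators on real Hilbert spaces\<close>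

text \<open>Square roots, polar parts and projections have to be shown to lie in \<open>M\<close>.
  Since \<open>M\<close> is by definition its own bicommutant, each of them is built so that
  whatever commutes with the data commutes with it: as a strong limit of polynomial expressions in
  the data, or as the projection onto a closed subspace invariant under the commutant.

  Similarity of isometries provides only an invertible intertwiner \<open>t\<close>, which need not
  respect the orthogonal Wold decomposition. It does map unitary part onto unitary part, but the
  wandering subspaces are matched by its inverse adjoint, so the two parts of the unitary have
  different origins. Coisometries are reduced to isometries by taking adjoints, and a central
  summand is treated on the whole space by padding with the identity. In the forward direction,
  alternative (ii) arises as the direct sum whose finite summand is zero.\<close>

interpretation blinfun_compose: bounded_bilinear "(o\<^sub>L)"
  by (rule bounded_bilinear_blinfun_compose)

notation blinfun_compose (infixl "\<cdot>" 70)

abbreviation one_op :: "'a::real_normed_vector \<Rightarrow>\<^sub>L 'a" ("\<one>") where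
  "\<one> \<equiv> id_blinfun"

lemma comp_assoc_op: "(a \<cdot> b) \<cdot> c = a \<cdot> (b \<cdot> c)"
  by (rule blinfun_eqI) simp

lemma id_comp_op [simp]: "\<one> \<cdot> a = a" "a \<cdot> \<one> = a"
  by (rule blinfun_eqI, simp)+

lemmas op_distribs =
  blinfun_compose.add_left blinfun_compose.add_right
  blinfun_compose.diff_left blinfun_compose.diff_right
  blinfun_compose.minus_left blinfun_compose.minus_right
  blinfun_compose.scaleR_left blinfun_compose.scaleR_right

lemmas op_simps = op_distribs comp_assoc_op

lemmas apply_simps =
  blinfun.add_left blinfun.add_right blinfun.diff_left blinfun.diff_right
  blinfun.minus_left blinfun.minus_right blinfun.scaleR_left blinfun.scaleR_right

lemma comp_left_op: "a \<cdot> b = c \<Longrightarrow> a \<cdot> (b \<cdot> w) = c \<cdot> w"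
  by (simp add: comp_assoc_op[symmetric])

lemma comp_contraction:
  "norm a \<le> 1 \<Longrightarrow> norm b \<le> 1 \<Longrightarrow> norm (a \<cdot> b) \<le> 1"
  by (rule order_trans[OF norm_blinfun_compose]) (simp add: mult_le_one)

subsection \<open>Orthogonal projections and adjoints\<close>

text \<open>The nearest point of \<open>S\<close> to \<open>x\<close> works: a minimizing sequence
  is Cauchy by the parallelogram law, because midpoints stay in \<open>S\<close>, and minimality of
  its limit forces orthogonality.\<close>

lemma orthogonal_decomposition:
  fixes S :: "'h::{real_inner,complete_space} set"
  assumes S: "subspace S" and cl: "closed S"
  obtains y where "y \<in> S" "\<And>z. z \<in> S \<Longrightarrow> inner (x - y) z = 0"
proof -
  define D where "D = (INF z\<in>S. (norm (x - z))\<^sup>2)"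
  have bdd: "bdd_below ((\<lambda>z. (norm (x - z))\<^sup>2) ` S)"
    by (rule bdd_belowI[of _ 0]) auto
  have ne: "S \<noteq> {}" using subspace_0[OF S] by auto
  have D_le: "D \<le> (norm (x - z))\<^sup>2" if "z \<in> S" for z
    unfolding D_def by (rule cINF_lower[OF bdd that])
  have "\<exists>z\<in>S. (norm (x - z))\<^sup>2 < D + inverse (real (Suc n))" for n
  proof (rule ccontr)
    assume "\<not> ?thesis"
    then have "D + inverse (real (Suc n)) \<le> D"
      unfolding D_def by (intro cINF_greatest[OF ne]) (auto simp: not_less D_def)
    then show False by (simp add: not_le)
  qed
  then obtain Y where YS: "\<And>n. Y n \<in> S"
    and Y: "\<And>n. (norm (x - Y n))\<^sup>2 < D + inverse (real (Suc n))" by metis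
  have gap: "(norm (Y m - Y n))\<^sup>2 \<le> 2 * inverse (real (Suc m)) + 2 * inverse (real (Suc n))" for m n
  proof -
    have mid: "(1/2) *\<^sub>R (Y m + Y n) \<in> S"
      using S YS by (intro subspace_scale subspace_add) auto
    have "(norm (Y m - Y n))\<^sup>2 = 2 * (norm (x - Y m))\<^sup>2 + 2 * (norm (x - Y n))\<^sup>2
        - 4 * (norm (x - (1/2) *\<^sub>R (Y m + Y n)))\<^sup>2"
      unfolding power2_norm_eq_inner by (simp add: inner_add inner_diff inner_commute field_simps)
    then show ?thesis using D_le[OF mid] Y[of m] Y[of n] by linarith
  qed
  have "Cauchy Y"
  proof (rule metric_CauchyI)
    fix e :: real assume e: "0 < e"
    obtain N where N: "inverse (real (Suc N)) < e\<^sup>2 / 4"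
      using reals_Archimedean[of "e\<^sup>2 / 4"] e by auto
    show "\<exists>N. \<forall>m\<ge>N. \<forall>n\<ge>N. dist (Y m) (Y n) < e"
    proof (intro exI[of _ N] allI impI)
      fix m n assume mn: "N \<le> m" "N \<le> n"
      have "inverse (real (Suc m)) \<le> inverse (real (Suc N))"
        "inverse (real (Suc n)) \<le> inverse (real (Suc N))"
        using mn by (auto intro!: le_imp_inverse_le)
      then have "(norm (Y m - Y n))\<^sup>2 < e\<^sup>2" using gap[of m n] N by linarith
      then show "dist (Y m) (Y n) < e"
        using e by (simp add: dist_norm power2_less_imp_less)
    qed
  qed
  then obtain y where y: "Y \<longlonglongrightarrow> y" using Cauchy_convergent_iff convergent_def by blast
  have yS: "y \<in> S" using closed_sequentially[OF cl] YS y by blast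
  have "(\<lambda>n. (norm (x - Y n))\<^sup>2) \<longlonglongrightarrow> (norm (x - y))\<^sup>2"
    by (intro tendsto_intros y)
  moreover have "(\<lambda>n. D + inverse (real (Suc n))) \<longlonglongrightarrow> D + 0"
    by (intro tendsto_intros LIMSEQ_inverse_real_of_nat)
  ultimately have yD: "(norm (x - y))\<^sup>2 \<le> D"
    using LIMSEQ_le[of "\<lambda>n. (norm (x - Y n))\<^sup>2" _ "\<lambda>n. D + inverse (real (Suc n))" "D + 0"] Y
    by (auto intro: less_imp_le)
  have "inner (x - y) z = 0" if z: "z \<in> S" for z
  proof (cases "z = 0")
    case False
    define c where "c = inner (x - y) z"
    \<comment> \<open>The minimizer in \<open>t\<close> of the squared norm of
      \<open>x - y - t z\<close>; a nonzero \<open>c\<close> would bring the distance below its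
      minimum.\<close>
    define t where "t = c / inner z z"
    have "y + t *\<^sub>R z \<in> S" using S yS z by (intro subspace_add subspace_scale)
    then have "(norm (x - y))\<^sup>2 \<le> (norm ((x - y) - t *\<^sub>R z))\<^sup>2"
      using D_le yD by (metis diff_diff_add order_trans)
    also have "\<dots> = (norm (x - y))\<^sup>2 - 2 * t * c + t\<^sup>2 * inner z z"
    proof -
      have "(norm (w - t *\<^sub>R z))\<^sup>2 = (norm w)\<^sup>2 - 2 * t * inner w z + t\<^sup>2 * inner z z" for w
        unfolding power2_norm_eq_inner
        by (simp add: inner_diff inner_commute[of z w] power2_eq_square algebra_simps)
      then show ?thesis unfolding c_def .
    qed
    finally have "0 \<le> t\<^sup>2 * inner z z - 2 * t * c" by simp
    also have "\<dots> = - (c\<^sup>2 / inner z z)"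
      using False by (simp add: t_def power2_eq_square field_simps)
    finally have "c\<^sup>2 / inner z z \<le> 0" by simp
    then have "c = 0" using False by (simp add: divide_le_0_iff) (metis inner_gt_zero_iff not_le)
    then show ?thesis by (simp add: c_def)
  qed simp
  with yS that show ?thesis by blast
qed

text \<open>The kernel of a nonzero functional has codimension one, so a vector \<open>w\<close>
  orthogonal to it represents the functional up to a factor.\<close>

lemma riesz_representation:
  fixes f :: "'h::{real_inner,complete_space} \<Rightarrow> real"
  assumes f: "bounded_linear f"
  obtains y where "\<And>x. f x = inner x y"
proof (cases "\<forall>x. f x = 0")
  case True
  then show ?thesis using that[of 0] by simp
next
  case False
  then obtain x0 where x0: "f x0 \<noteq> 0" by blast
  interpret f: bounded_linear f by (rule f)
  define K where "K = {x. f x = 0}"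
  have "subspace K" by (auto simp: subspace_def K_def f.zero f.add f.scaleR)
  moreover have "closed K"
    unfolding K_def by (intro closed_Collect_eq continuous_intros linear_continuous_on f)
  ultimately obtain y0 where y0: "y0 \<in> K" "\<And>z. z \<in> K \<Longrightarrow> inner (x0 - y0) z = 0"
    using orthogonal_decomposition by blast
  define w where "w = x0 - y0"
  have fw: "f w \<noteq> 0" using x0 y0(1) by (simp add: w_def f.diff K_def)
  then have ww: "inner w w \<noteq> 0" using f.zero by auto
  have "f x = inner x ((f w / inner w w) *\<^sub>R w)" for x
  proof -
    have "x - (f x / f w) *\<^sub>R w \<in> K" using fw by (simp add: K_def f.diff f.scaleR)
    then have "inner w (x - (f x / f w) *\<^sub>R w) = 0" using y0(2) w_def by blast
    then have "inner w x = f x / f w * inner w w" by (simp add: inner_diff_right)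
    then show ?thesis using fw ww by (simp add: inner_commute[of x w])
  qed
  then show ?thesis using that by blast
qed

lemma ex_radj:
  fixes T :: "'h::{real_inner,complete_space} \<Rightarrow>\<^sub>L 'h"
  shows "\<exists>S :: 'h \<Rightarrow>\<^sub>L 'h. \<forall>x y. inner (T x) y = inner x (S y)"
proof -
  have "\<exists>z. \<forall>x. inner (T x) y = inner x z" for y
  proof -
    have "bounded_linear (\<lambda>x. inner (T x) y)" by (intro bounded_linear_intros)
    from riesz_representation[OF this] show ?thesis by metis
  qed
  then obtain S where S: "\<And>x y. inner (T x) y = inner x (S y)" by metis
  have "bounded_linear S"
  proof (rule bounded_linear_intro[of _ "norm T"])
    fix x y :: 'h and r :: real
    have "inner z (S (x + y)) = inner z (S x + S y)" for z
      by (simp add: S[symmetric] inner_add_right)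
    then show "S (x + y) = S x + S y" by (metis vector_eq_ldot)
    have "inner z (S (r *\<^sub>R x)) = inner z (r *\<^sub>R S x)" for z
      by (simp add: S[symmetric])
    then show "S (r *\<^sub>R x) = r *\<^sub>R S x" by (metis vector_eq_ldot)
    have "norm (S x) * norm (S x) = inner (T (S x)) x"
      unfolding S by (simp add: power2_norm_eq_inner[symmetric] power2_eq_square)
    also have "\<dots> \<le> norm (T (S x)) * norm x" by (rule norm_cauchy_schwarz)
    also have "\<dots> \<le> norm T * norm (S x) * norm x" by (intro mult_right_mono norm_blinfun) simp
    finally have "norm (S x) * norm (S x) \<le> norm (S x) * (norm x * norm T)"
      by (simp add: ac_simps)
    then show "norm (S x) \<le> norm x * norm T"
      by (cases "S x = 0") (simp_all add: mult_le_cancel_left)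
  qed
  then show ?thesis
    by (intro exI[of _ "Blinfun S"]) (simp add: bounded_linear_Blinfun_apply S)
qed

text \<open>The adjoint for the real inner product is available before an operator is known to be
  complex linear, as for projections onto closed real subspaces.\<close>

definition radj :: "('h::{real_inner,complete_space} \<Rightarrow>\<^sub>L 'h) \<Rightarrow> ('h \<Rightarrow>\<^sub>L 'h)"
    ("_\<^sup>\<star>" [1000] 1000) where
  "T\<^sup>\<star> = (SOME S :: 'h \<Rightarrow>\<^sub>L 'h. \<forall>x y. inner (T x) y = inner x (S y))"

lemma inner_radj: "inner ((T::_ \<Rightarrow>\<^sub>L _) x) y = inner x (T\<^sup>\<star> y)"
  using someI_ex[OF ex_radj[of T]] unfolding radj_def by blast

lemma inner_radj': "inner x ((T::_ \<Rightarrow>\<^sub>L _) y) = inner (T\<^sup>\<star> x) y"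
  by (metis inner_radj inner_commute)

lemma radj_eqI: "(\<And>x y. inner ((T::_ \<Rightarrow>\<^sub>L _) x) y = inner x ((S::_ \<Rightarrow>\<^sub>L _) y)) \<Longrightarrow> T\<^sup>\<star> = S"
  by (rule blinfun_eqI) (rule iffD1[OF vector_eq_ldot], simp flip: inner_radj)

lemma radj_radj [simp]: "(T\<^sup>\<star>)\<^sup>\<star> = T"
  by (rule radj_eqI) (rule inner_radj'[symmetric])

lemma radj_id [simp]: "\<one>\<^sup>\<star> = \<one>"
  by (rule radj_eqI) simp

lemma radj_zero [simp]: "0\<^sup>\<star> = 0"
  by (rule radj_eqI) simp

lemma radj_comp [simp]: "(a \<cdot> b)\<^sup>\<star> = b\<^sup>\<star> \<cdot> a\<^sup>\<star>"
  by (rule radj_eqI) (simp add: inner_radj)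

lemma radj_add [simp]: "(a + b)\<^sup>\<star> = a\<^sup>\<star> + b\<^sup>\<star>"
  by (rule radj_eqI) (simp add: apply_simps inner_add inner_radj)

lemma radj_diff [simp]: "(a - b)\<^sup>\<star> = a\<^sup>\<star> - b\<^sup>\<star>"
  by (rule radj_eqI) (simp add: apply_simps inner_diff inner_radj)

lemma radj_minus [simp]: "(- b)\<^sup>\<star> = - b\<^sup>\<star>"
  by (rule radj_eqI) (simp add: apply_simps inner_radj)

lemma radj_scaleR [simp]: "(r *\<^sub>R a)\<^sup>\<star> = r *\<^sub>R a\<^sup>\<star>"
  by (rule radj_eqI) (simp add: apply_simps inner_radj)

lemma norm_radj [simp]: "norm (T\<^sup>\<star>) = norm T"
proof -
  have le: "norm (S\<^sup>\<star>) \<le> norm S" for S :: "'a \<Rightarrow>\<^sub>L 'a"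
  proof (rule norm_blinfun_bound)
    fix x
    have "norm (S\<^sup>\<star> x) * norm (S\<^sup>\<star> x) = inner (S (S\<^sup>\<star> x)) x"
      by (simp add: inner_radj power2_norm_eq_inner[symmetric] power2_eq_square)
    also have "\<dots> \<le> norm (S (S\<^sup>\<star> x)) * norm x" by (rule norm_cauchy_schwarz)
    also have "\<dots> \<le> norm S * norm (S\<^sup>\<star> x) * norm x" by (intro mult_right_mono norm_blinfun) simp
    finally have "norm (S\<^sup>\<star> x) * norm (S\<^sup>\<star> x) \<le> norm (S\<^sup>\<star> x) * (norm S * norm x)"
      by (simp add: ac_simps)
    then show "norm (S\<^sup>\<star> x) \<le> norm S * norm x"
      by (cases "S\<^sup>\<star> x = 0") (simp_all add: mult_le_cancel_left)
  qed simp
  show ?thesis using le[of T] le[of "T\<^sup>\<star>"] by simp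
qed

lemma norm_apply_sq: "(norm ((a::_ \<Rightarrow>\<^sub>L _) x))\<^sup>2 = inner ((a\<^sup>\<star> \<cdot> a) x) x"
  by (simp add: power2_norm_eq_inner inner_radj)

lemma radj_comp_self_eq_0_iff: "a\<^sup>\<star> \<cdot> a = 0 \<longleftrightarrow> a = 0"
proof
  assume "a\<^sup>\<star> \<cdot> a = 0"
  then have "(norm (a x))\<^sup>2 = 0" for x by (simp add: norm_apply_sq)
  then show "a = 0" by (intro blinfun_eqI) simp
qed simp

definition is_proj :: "('h::{real_inner,complete_space} \<Rightarrow>\<^sub>L 'h) \<Rightarrow> bool" where
  "is_proj p \<longleftrightarrow> p \<cdot> p = p \<and> p\<^sup>\<star> = p"

lemma is_projD: "is_proj p \<Longrightarrow> p \<cdot> p = p" "is_proj p \<Longrightarrow> p\<^sup>\<star> = p"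
  "is_proj p \<Longrightarrow> blinfun_apply p (p x) = p x"
  unfolding is_proj_def by (simp_all flip: blinfun_apply_blinfun_compose)

lemma is_proj_simps:
  assumes "is_proj p" shows "p\<^sup>\<star> = p" "p \<cdot> p = p" "p \<cdot> (p \<cdot> a) = p \<cdot> a"
  using is_projD(1,2)[OF assms] by (simp_all add: comp_left_op)

lemma is_proj_simple [simp]: "is_proj 0" "is_proj \<one>"
  by (simp_all add: is_proj_def)

lemma is_proj_compl: "is_proj p \<Longrightarrow> is_proj (\<one> - p)"
  by (simp add: is_proj_def op_simps)

lemma is_proj_norm: assumes "is_proj p" shows "norm p \<le> 1"
proof (rule norm_blinfun_bound)
  fix x
  have "norm (p x) * norm (p x) = inner (p x) x"
    using norm_apply_sq[of p x] assms by (simp add: is_projD power2_eq_square)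
  also have "\<dots> \<le> norm (p x) * norm x" by (rule norm_cauchy_schwarz)
  finally show "norm (p x) \<le> 1 * norm x"
    by (cases "p x = 0") (simp_all add: mult_le_cancel_left)
qed simp

text \<open>Since \<open>\<one> - q\<close> maps into the kernel of \<open>q\<close>, which is that
  of \<open>p\<close>, one gets \<open>p = p q\<close> and likewise \<open>q = q p\<close>; adjoints
  finish. Initial and final projections of polar parts are identified in this way, by kernels
  alone.\<close>

lemma is_proj_kernel_unique:
  assumes p: "is_proj p" and q: "is_proj q" and ker: "\<And>x. blinfun_apply p x = 0 \<longleftrightarrow> q x = 0"
  shows "p = q"
proof -
  have "p \<cdot> (\<one> - q) = 0"
  proof (rule blinfun_eqI)
    fix x
    have "q (x - q x) = 0" by (simp add: apply_simps is_projD(3)[OF q])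
    then have "p (x - q x) = 0" using ker by blast
    then show "(p \<cdot> (\<one> - q)) x = blinfun_apply 0 x" by (simp add: apply_simps)
  qed
  then have 1: "p = p \<cdot> q" by (simp add: op_simps)
  have "q \<cdot> (\<one> - p) = 0"
  proof (rule blinfun_eqI)
    fix x
    have "p (x - p x) = 0" by (simp add: apply_simps is_projD(3)[OF p])
    then have "q (x - p x) = 0" using ker by blast
    then show "(q \<cdot> (\<one> - p)) x = blinfun_apply 0 x" by (simp add: apply_simps)
  qed
  then have "q = q \<cdot> p" by (simp add: op_simps)
  then have "q\<^sup>\<star> = (q \<cdot> p)\<^sup>\<star>" by simp
  then have "q = p \<cdot> q" using p q by (simp add: is_projD)
  with 1 show ?thesis by simp
qed

text \<open>Linearity and idempotence come from the uniqueness of the decomposition, symmetry from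
  its orthogonality.\<close>

lemma ex_projection_onto:
  fixes S :: "'h::{real_inner,complete_space} set"
  assumes S: "subspace S" and cl: "closed S"
  obtains p :: "'h \<Rightarrow>\<^sub>L 'h" where "is_proj p" "\<And>x. p x \<in> S" "\<And>x. x \<in> S \<Longrightarrow> p x = x"
    "\<And>x. p x = 0 \<longleftrightarrow> (\<forall>z\<in>S. inner x z = 0)"
proof -
  have "\<exists>y. y \<in> S \<and> (\<forall>z\<in>S. inner (x - y) z = 0)" for x
    using orthogonal_decomposition[OF S cl] by metis
  then obtain P where PS: "\<And>x. P x \<in> S" and P: "\<And>x z. z \<in> S \<Longrightarrow> inner (x - P x) z = 0"
    by metis
  have uniq: "P x = y" if "y \<in> S" "\<And>z. z \<in> S \<Longrightarrow> inner (x - y) z = 0" for x y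
  proof -
    have d: "P x - y \<in> S" using S PS that(1) by (simp add: subspace_diff)
    have "inner (P x - y) (P x - y) = inner (x - y) (P x - y) - inner (x - P x) (P x - y)"
      by (simp add: inner_diff_left)
    also have "\<dots> = 0" using that(2)[OF d] P[OF d] by simp
    finally show ?thesis by simp
  qed
  have "bounded_linear P"
  proof (rule bounded_linear_intro[of _ 1])
    fix x y :: 'h and r :: real
    show "P (x + y) = P x + P y"
    proof (rule uniq)
      fix z assume z: "z \<in> S"
      have "x + y - (P x + P y) = (x - P x) + (y - P y)" by simp
      then show "inner (x + y - (P x + P y)) z = 0" using P[OF z] by (simp only: inner_add_left)
    qed (use PS S in \<open>simp add: subspace_add\<close>)
    show "P (r *\<^sub>R x) = r *\<^sub>R P x"
    proof (rule uniq)
      fix z assume z: "z \<in> S"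
      have "r *\<^sub>R x - r *\<^sub>R P x = r *\<^sub>R (x - P x)" by (simp add: scaleR_diff_right)
      then show "inner (r *\<^sub>R x - r *\<^sub>R P x) z = 0" using P[OF z] by simp
    qed (use PS S in \<open>simp add: subspace_scale\<close>)
    have "norm (P x) * norm (P x) = inner x (P x)"
      using P[OF PS[of x], of x] by (simp add: inner_diff_left power2_norm_eq_inner[symmetric] power2_eq_square)
    also have "\<dots> \<le> norm x * norm (P x)" by (rule norm_cauchy_schwarz)
    finally show "norm (P x) \<le> norm x * 1"
      by (cases "P x = 0") (simp_all add: mult_le_cancel_right)
  qed
  then have ap: "Blinfun P x = P x" for x by (simp add: bounded_linear_Blinfun_apply)
  have P_id: "P x = x" if "x \<in> S" for x by (rule uniq[OF that]) simp
  have "is_proj (Blinfun P)"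
    unfolding is_proj_def
  proof
    show "Blinfun P \<cdot> Blinfun P = Blinfun P"
      by (rule blinfun_eqI) (simp add: ap P_id PS)
    show "(Blinfun P)\<^sup>\<star> = Blinfun P"
    proof (rule radj_eqI)
      fix x y
      have "inner (P x) y = inner (P x) (P y)"
        using P[OF PS[of x], of y] by (simp add: inner_diff inner_commute)
      also have "\<dots> = inner x (P y)"
        using P[OF PS[of y], of x] by (simp add: inner_diff_left)
      finally show "inner (Blinfun P x) y = inner x (Blinfun P y)" by (simp add: ap)
    qed
  qed
  moreover have "P x = 0 \<longleftrightarrow> (\<forall>z\<in>S. inner x z = 0)" for x
  proof
    assume "P x = 0"
    then show "\<forall>z\<in>S. inner x z = 0" using P[of _ x] by simp
  next
    assume "\<forall>z\<in>S. inner x z = 0"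
    then show "P x = 0" using uniq[of 0 x] subspace_0[OF S] by simp
  qed
  ultimately show ?thesis using that[of "Blinfun P"] ap PS P_id by simp
qed

text \<open>The hypotheses say that the range of \<open>p\<close> is invariant under
  \<open>a\<close> and its adjoint, that is, reducing for \<open>a\<close>.\<close>

lemma projection_onto_commutes:
  assumes p: "is_proj p" and a: "p \<cdot> a \<cdot> p = a \<cdot> p" and a': "p \<cdot> a\<^sup>\<star> \<cdot> p = a\<^sup>\<star> \<cdot> p"
  shows "p \<cdot> a = a \<cdot> p"
proof -
  have "(p \<cdot> a\<^sup>\<star> \<cdot> p)\<^sup>\<star> = (a\<^sup>\<star> \<cdot> p)\<^sup>\<star>" using a' by simp
  then have "p \<cdot> a \<cdot> p = p \<cdot> a" by (simp add: is_projD[OF p] comp_assoc_op)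
  with a show ?thesis by simp
qed

subsection \<open>Strong limits\<close>

definition strong_lim :: "(nat \<Rightarrow> 'a::real_normed_vector \<Rightarrow>\<^sub>L 'b::real_normed_vector) \<Rightarrow> ('a \<Rightarrow>\<^sub>L 'b) \<Rightarrow> bool" where
  "strong_lim X T \<longleftrightarrow> (\<forall>x. (\<lambda>n. X n x) \<longlonglongrightarrow> blinfun_apply T x)"

lemma strong_limI:
  fixes X :: "nat \<Rightarrow> 'a::real_normed_vector \<Rightarrow>\<^sub>L 'b::real_normed_vector"
  assumes conv: "\<And>x. convergent (\<lambda>n. X n x)" and bd: "\<And>n. norm (X n) \<le> 1"
  obtains T where "strong_lim X T" "norm T \<le> 1"
proof -
  obtain L where L: "\<And>x. (\<lambda>n. X n x) \<longlonglongrightarrow> L x"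
    using conv unfolding convergent_def by metis
  have nL: "norm (L x) \<le> norm x" for x
  proof (rule LIMSEQ_le_const2[OF tendsto_norm[OF L[of x]]], intro exI allI impI)
    fix n show "norm (X n x) \<le> norm x"
      using norm_blinfun[of "X n" x] bd[of n] mult_right_mono[of "norm (X n)" 1 "norm x"] by simp
  qed
  have "bounded_linear L"
  proof (rule bounded_linear_intro[of _ 1])
    fix x y r
    have "(\<lambda>n. X n (x + y)) \<longlonglongrightarrow> L x + L y"
      unfolding blinfun.add_right by (intro tendsto_add L)
    then show "L (x + y) = L x + L y" using L LIMSEQ_unique by blast
    have "(\<lambda>n. X n (r *\<^sub>R x)) \<longlonglongrightarrow> r *\<^sub>R L x"
      unfolding blinfun.scaleR_right by (intro tendsto_scaleR tendsto_const L)
    then show "L (r *\<^sub>R x) = r *\<^sub>R L x" using L LIMSEQ_unique by blast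
  qed (use nL in simp)
  then have "Blinfun L x = L x" for x by (simp add: bounded_linear_Blinfun_apply)
  then have "strong_lim X (Blinfun L)" "norm (Blinfun L) \<le> 1"
    using L nL by (auto simp: strong_lim_def intro!: norm_blinfun_bound)
  then show ?thesis using that by blast
qed

lemma strong_lim_unique: "strong_lim X S \<Longrightarrow> strong_lim X T \<Longrightarrow> S = T"
  unfolding strong_lim_def by (intro blinfun_eqI) (metis LIMSEQ_unique)

lemma strong_lim_const: "strong_lim (\<lambda>n. T) T"
  by (simp add: strong_lim_def)

lemma strong_lim_Suc: "strong_lim X T \<Longrightarrow> strong_lim (\<lambda>n. X (Suc n)) T"
  unfolding strong_lim_def using LIMSEQ_Suc[of "\<lambda>n. X n _"] by auto

lemma strong_lim_add: "strong_lim X S \<Longrightarrow> strong_lim Y T \<Longrightarrow> strong_lim (\<lambda>n. X n + Y n) (S + T)"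
  unfolding strong_lim_def by (simp add: apply_simps tendsto_add)

lemma strong_lim_diff: "strong_lim X S \<Longrightarrow> strong_lim Y T \<Longrightarrow> strong_lim (\<lambda>n. X n - Y n) (S - T)"
  unfolding strong_lim_def by (simp add: apply_simps tendsto_diff)

lemma strong_lim_scaleR: "strong_lim X S \<Longrightarrow> strong_lim (\<lambda>n. r *\<^sub>R X n) (r *\<^sub>R S)"
  unfolding strong_lim_def by (simp add: apply_simps tendsto_scaleR)

lemma strong_lim_comp_left: "strong_lim X S \<Longrightarrow> strong_lim (\<lambda>n. a \<cdot> X n) (a \<cdot> S)"
  unfolding strong_lim_def by (auto intro!: blinfun.tendsto[OF tendsto_const])

lemma strong_lim_comp_right: "strong_lim X S \<Longrightarrow> strong_lim (\<lambda>n. X n \<cdot> a) (S \<cdot> a)"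
  unfolding strong_lim_def by auto

text \<open>Split \<open>X n (Y n x)\<close> into \<open>X n (Y n x - T x)\<close> and
  \<open>X n (T x)\<close>; the bound on the left factors controls the first term.\<close>

lemma strong_lim_comp:
  assumes X: "strong_lim X S" and Y: "strong_lim Y T" and bd: "\<And>n. norm (X n) \<le> 1"
  shows "strong_lim (\<lambda>n. X n \<cdot> Y n) (S \<cdot> T)"
  unfolding strong_lim_def
proof
  fix x
  have "(\<lambda>n. X n (Y n x - T x)) \<longlonglongrightarrow> 0"
  proof (rule Lim_null_comparison)
    show "\<forall>\<^sub>F n in sequentially. norm (X n (Y n x - T x)) \<le> norm (Y n x - T x)"
    proof (rule always_eventually, rule allI)
      fix n show "norm (X n (Y n x - T x)) \<le> norm (Y n x - T x)"
        using norm_blinfun[of "X n" "Y n x - T x"] bd[of n]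
          mult_right_mono[of "norm (X n)" 1 "norm (Y n x - T x)"] by simp
    qed
    show "(\<lambda>n. norm (Y n x - T x)) \<longlonglongrightarrow> 0"
      using Y unfolding strong_lim_def by (metis LIM_zero tendsto_norm_zero)
  qed
  moreover have "(\<lambda>n. X n (T x)) \<longlonglongrightarrow> S (T x)" using X by (simp add: strong_lim_def)
  ultimately have "(\<lambda>n. X n (Y n x - T x) + X n (T x)) \<longlonglongrightarrow> 0 + S (T x)"
    by (rule tendsto_add)
  then show "(\<lambda>n. (X n \<cdot> Y n) x) \<longlonglongrightarrow> (S \<cdot> T) x"
    by (simp add: blinfun.diff_right)
qed

text \<open>Taking adjoints is not strongly continuous, so convergence of the adjoints enters as a
  separate assumption.\<close>

lemma strong_lim_radj:
  assumes X: "strong_lim X S" and Y: "strong_lim (\<lambda>n. (X n)\<^sup>\<star>) T"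
  shows "S\<^sup>\<star> = T"
proof (rule radj_eqI)
  fix x y
  have "(\<lambda>n. inner (X n x) y) \<longlonglongrightarrow> inner (S x) y"
    using X by (intro tendsto_inner tendsto_const) (simp add: strong_lim_def)
  moreover have "(\<lambda>n. inner x ((X n)\<^sup>\<star> y)) \<longlonglongrightarrow> inner x (T y)"
    using Y by (intro tendsto_inner tendsto_const) (simp add: strong_lim_def)
  ultimately show "inner (S x) y = inner x (T y)"
    unfolding inner_radj by (rule LIMSEQ_unique)
qed

lemma strong_lim_self_adjoint:
  assumes "strong_lim X S" and "\<And>n. (X n)\<^sup>\<star> = X n" shows "S\<^sup>\<star> = S"
  using strong_lim_radj[of X S S] assms by simp

lemma strong_lim_intertwine:
  assumes X: "strong_lim X S" and "\<And>n. b \<cdot> X n = X n \<cdot> c"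
  shows "b \<cdot> S = S \<cdot> c"
  using strong_lim_unique[OF strong_lim_comp_left[OF X, of b]] strong_lim_comp_right[OF X, of c] assms(2)
  by simp

lemma strong_lim_is_proj:
  assumes X: "strong_lim X S" and p: "\<And>n. is_proj (X n)"
  shows "is_proj S"
proof -
  have "strong_lim (\<lambda>n. X n \<cdot> X n) (S \<cdot> S)"
    by (rule strong_lim_comp[OF X X]) (rule is_proj_norm[OF p])
  then have "strong_lim X (S \<cdot> S)" by (simp add: is_projD(1)[OF p])
  then have "S \<cdot> S = S" by (rule strong_lim_unique[OF _ X])
  moreover have "S\<^sup>\<star> = S" by (rule strong_lim_self_adjoint[OF X]) (simp add: is_projD p)
  ultimately show ?thesis by (simp add: is_proj_def)
qed

text \<open>A form of monotone convergence for operators: in the uses, \<open>f n\<close> is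
  \<open>inner (X n x) x\<close> or the square of \<open>norm (X n x)\<close>, and its increments
  dominate the squared distances.\<close>

lemma increment_Cauchy:
  fixes u :: "nat \<Rightarrow> 'a::complete_space" and f :: "nat \<Rightarrow> real"
  assumes mono: "\<And>m n. m \<le> n \<Longrightarrow> (dist (u n) (u m))\<^sup>2 \<le> f n - f m"
    and bd: "\<And>n. f n \<le> B"
  shows "convergent u"
proof -
  have inc: "f m \<le> f n" if "m \<le> n" for m n
    using mono[OF that] zero_le_power2[of "dist (u n) (u m)"] by linarith
  have "incseq f" using inc by (auto simp: incseq_def)
  moreover have "bdd_above (range f)" using bd by (auto intro!: bdd_aboveI[of _ B])
  ultimately have "Cauchy f"
    using incseq_convergent[of f B] bd LIMSEQ_imp_Cauchy by metis
  have "Cauchy u"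
  proof (rule metric_CauchyI)
    fix e :: real assume e: "0 < e"
    then obtain N where N: "\<And>m n. m \<ge> N \<Longrightarrow> n \<ge> N \<Longrightarrow> dist (f m) (f n) < e\<^sup>2"
      using metric_CauchyD[OF \<open>Cauchy f\<close>, of "e\<^sup>2"] by auto
    have *: "dist (u n) (u m) < e" if "N \<le> m" "m \<le> n" for m n
    proof -
      have "(dist (u n) (u m))\<^sup>2 < e\<^sup>2"
        using mono[OF that(2)] N[of n m] that by (simp add: dist_real_def)
      then show ?thesis using e by (simp add: power2_less_imp_less)
    qed
    show "\<exists>N. \<forall>m\<ge>N. \<forall>n\<ge>N. dist (u m) (u n) < e"
      by (intro exI[of _ N] allI impI) (metis * dist_commute nle_le)
  qed
  then show ?thesis by (simp add: Cauchy_convergent_iff)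
qed

subsection \<open>Positive operators\<close>

lemma op_eqI:
  "(\<And>x y. inner (blinfun_apply a x) y = inner (blinfun_apply b x) y) \<Longrightarrow> a = b"
  by (rule blinfun_eqI) (metis vector_eq_rdot)

lemma op_commute_apply: "a \<cdot> b = c \<cdot> d \<Longrightarrow> blinfun_apply a (b x) = c (d x)"
  by (metis blinfun_apply_blinfun_compose)

text \<open>On a real Hilbert space a nonnegative quadratic form does not force self-adjointness,
  hence the explicit first conjunct.\<close>

definition pos_op :: "('h::{real_inner,complete_space} \<Rightarrow>\<^sub>L 'h) \<Rightarrow> bool" where
  "pos_op a \<longleftrightarrow> a\<^sup>\<star> = a \<and> (\<forall>x. 0 \<le> inner (a x) x)"

lemma pos_opD: "pos_op a \<Longrightarrow> a\<^sup>\<star> = a" "pos_op a \<Longrightarrow> 0 \<le> inner (blinfun_apply a x) x"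
  by (auto simp: pos_op_def)

lemma pos_op_one: "pos_op \<one>" by (simp add: pos_op_def)

lemma pos_op_add: "pos_op a \<Longrightarrow> pos_op b \<Longrightarrow> pos_op (a + b)"
  by (simp add: pos_op_def apply_simps inner_add)

lemma pos_op_scaleR: "0 \<le> r \<Longrightarrow> pos_op a \<Longrightarrow> pos_op (r *\<^sub>R a)"
  by (simp add: pos_op_def apply_simps)

lemma pos_op_radj_comp: "pos_op (a\<^sup>\<star> \<cdot> a)"
  by (simp add: pos_op_def flip: inner_radj')

lemma pos_op_conj: "pos_op a \<Longrightarrow> pos_op (b\<^sup>\<star> \<cdot> a \<cdot> b)"
  by (simp add: pos_op_def comp_assoc_op flip: inner_radj')

text \<open>This is \<open>a\<^sup>2 \<le> a\<close> for \<open>0 \<le> a \<le> \<one>\<close>, read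
  off from \<open>a - a\<^sup>2 = a (\<one> - a) a + (\<one> - a) a (\<one> - a)\<close>.\<close>

lemma pos_op_contraction_sq:
  assumes "pos_op a" "pos_op (\<one> - a)"
  shows "(norm (a x))\<^sup>2 \<le> inner (a x) x"
proof -
  have sa: "a\<^sup>\<star> = a" using assms by (simp add: pos_opD)
  have "pos_op (a\<^sup>\<star> \<cdot> (\<one> - a) \<cdot> a + (\<one> - a)\<^sup>\<star> \<cdot> a \<cdot> (\<one> - a))"
    by (intro pos_op_add pos_op_conj assms)
  moreover have "a\<^sup>\<star> \<cdot> (\<one> - a) \<cdot> a + (\<one> - a)\<^sup>\<star> \<cdot> a \<cdot> (\<one> - a) = a - a \<cdot> a"
    by (simp add: op_simps sa)
  ultimately have "0 \<le> inner ((a - a \<cdot> a) x) x" by (metis pos_opD(2))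
  then show ?thesis
    unfolding norm_apply_sq sa by (simp add: apply_simps inner_diff)
qed

lemma pos_op_contraction_norm:
  assumes "pos_op a" "pos_op (\<one> - a)"
  shows "norm a \<le> 1"
proof (rule norm_blinfun_bound)
  fix x
  have "(norm (a x))\<^sup>2 \<le> inner (a x) x" by (rule pos_op_contraction_sq[OF assms])
  also have "\<dots> \<le> inner x x"
    using pos_opD(2)[OF assms(2), of x] by (simp add: apply_simps inner_diff)
  finally show "norm (a x) \<le> 1 * norm x" by (simp add: power2_norm_eq_inner norm_le)
qed simp

lemma pos_op_one_minus_radj_comp:
  assumes "norm a \<le> 1"
  shows "pos_op (\<one> - a\<^sup>\<star> \<cdot> a)"
proof -
  have "inner ((a\<^sup>\<star> \<cdot> a) x) x \<le> inner x x" for x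
  proof -
    have "norm (a x) \<le> norm x"
      using norm_blinfun[of a x] mult_right_mono[OF assms norm_ge_zero[of x]] by simp
    then have "(norm (a x))\<^sup>2 \<le> (norm x)\<^sup>2" by simp
    then show ?thesis unfolding norm_apply_sq by (simp only: power2_norm_eq_inner)
  qed
  then show ?thesis
    by (simp add: pos_op_def blinfun.diff_left inner_diff_left)
qed

lemma norm_le_one_if_radj_comp_proj:
  assumes "is_proj (a\<^sup>\<star> \<cdot> a)" shows "norm a \<le> 1"
proof (rule norm_blinfun_bound)
  fix x
  have "(norm (a x))\<^sup>2 \<le> norm ((a\<^sup>\<star> \<cdot> a) x) * norm x"
    unfolding norm_apply_sq by (rule norm_cauchy_schwarz)
  also have "\<dots> \<le> (norm (a\<^sup>\<star> \<cdot> a) * norm x) * norm x"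
    by (intro mult_right_mono norm_blinfun) simp
  also have "\<dots> \<le> (1 * norm x) * norm x"
    by (intro mult_right_mono is_proj_norm assms) auto
  finally have "(norm (a x))\<^sup>2 \<le> (norm x)\<^sup>2" by (simp only: mult_1 power2_eq_square)
  then show "norm (a x) \<le> 1 * norm x" by simp
qed simp

text \<open>The polynomials in \<open>h\<close> with nonnegative coefficients in the products \<open>h\<^sup>j (\<one> - h)\<^sup>k\<close>. For
  \<open>0 \<le> h \<le> \<one>\<close> they are positive operators, which replaces the functional calculus.\<close>

inductive bern :: "('h::{real_inner,complete_space} \<Rightarrow>\<^sub>L 'h) \<Rightarrow> ('h \<Rightarrow>\<^sub>L 'h) \<Rightarrow> bool" for h where
  bern_one: "bern h \<one>"
| bern_mult: "bern h a \<Longrightarrow> bern h (h \<cdot> a)"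
| bern_mult_compl: "bern h a \<Longrightarrow> bern h ((\<one> - h) \<cdot> a)"
| bern_add: "bern h a \<Longrightarrow> bern h b \<Longrightarrow> bern h (a + b)"
| bern_scaleR: "0 \<le> r \<Longrightarrow> bern h a \<Longrightarrow> bern h (r *\<^sub>R a)"

lemma bern_zero: "bern h 0"
  using bern_scaleR[OF order_refl bern_one, of h] by simp

lemma bern_self: "bern h h" "bern h (\<one> - h)"
  using bern_mult[OF bern_one] bern_mult_compl[OF bern_one] by simp_all

lemma bern_comp: "bern h a \<Longrightarrow> bern h b \<Longrightarrow> bern h (a \<cdot> b)"
proof (induction rule: bern.induct)
  case (bern_mult a)
  then show ?case by (simp add: comp_assoc_op bern.bern_mult)
next
  case (bern_mult_compl a)
  then show ?case by (simp add: comp_assoc_op bern.bern_mult_compl)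
next
  case (bern_add a b)
  then show ?case by (simp add: op_distribs bern.bern_add)
next
  case (bern_scaleR r a)
  then show ?case by (simp add: op_distribs bern.bern_scaleR)
qed simp

lemma bern_commute:
  assumes "bern h a" and bh: "b \<cdot> h = h \<cdot> b"
  shows "b \<cdot> a = a \<cdot> b"
  using assms(1)
proof (induction rule: bern.induct)
  case (bern_mult a)
  have "b \<cdot> (h \<cdot> a) = h \<cdot> (b \<cdot> a)" by (simp add: comp_left_op[OF bh] comp_assoc_op)
  then show ?case by (simp add: bern_mult comp_assoc_op)
next
  case (bern_mult_compl a)
  have "b \<cdot> (\<one> - h) = (\<one> - h) \<cdot> b" by (simp add: op_simps bh)
  then have "b \<cdot> ((\<one> - h) \<cdot> a) = (\<one> - h) \<cdot> (b \<cdot> a)"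
    by (metis comp_assoc_op)
  then show ?case by (simp add: bern_mult_compl comp_assoc_op)
qed (simp_all add: op_distribs)

lemma bern_commute2:
  assumes "bern h a" "bern h b" shows "a \<cdot> b = b \<cdot> a"
  using bern_commute[OF assms(2)] bern_commute[OF assms(1), of h] by simp

text \<open>A product of commuting positive operators is not visibly positive, but
  \<open>h (h a) = h a h\<close> is a conjugate. With the products by \<open>h\<close>,
  \<open>\<one> - h\<close> and \<open>h (\<one> - h)\<close> carried through the induction, each
  new product is either already covered or a conjugate of a covered one.\<close>

lemma bern_pos_aux:
  assumes h: "pos_op h" and h': "pos_op (\<one> - h)" and "bern h a"
  shows "pos_op a \<and> pos_op (h \<cdot> a) \<and> pos_op ((\<one> - h) \<cdot> a) \<and> pos_op (h \<cdot> ((\<one> - h) \<cdot> a))"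
  using assms(3)
proof (induction rule: bern.induct)
  case bern_one
  have sa: "h\<^sup>\<star> = h" using h by (simp add: pos_opD)
  have "pos_op (h\<^sup>\<star> \<cdot> (\<one> - h) \<cdot> h + (\<one> - h)\<^sup>\<star> \<cdot> h \<cdot> (\<one> - h))"
    by (intro pos_op_add pos_op_conj h h')
  moreover have "h\<^sup>\<star> \<cdot> (\<one> - h) \<cdot> h + (\<one> - h)\<^sup>\<star> \<cdot> h \<cdot> (\<one> - h) = h \<cdot> (\<one> - h)"
    by (simp add: op_simps sa)
  ultimately have "pos_op (h \<cdot> (\<one> - h))" by simp
  with h h' show ?case by (simp add: pos_op_one)
next
  case (bern_mult a)
  have sa: "h\<^sup>\<star> = h" using h by (simp add: pos_opD)
  have c: "a \<cdot> h = h \<cdot> a" using bern_commute[OF bern_mult.hyps, of h] by simp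
  have "pos_op (h\<^sup>\<star> \<cdot> a \<cdot> h)" "pos_op (h\<^sup>\<star> \<cdot> ((\<one> - h) \<cdot> a) \<cdot> h)"
    using bern_mult.IH by (auto intro: pos_op_conj)
  with bern_mult.IH show ?case by (simp add: op_simps sa c)
next
  case (bern_mult_compl a)
  define k where "k = \<one> - h"
  have hk: "h = \<one> - k" by (simp add: k_def)
  have sa: "k\<^sup>\<star> = k" unfolding k_def by (rule pos_opD(1)[OF h'])
  have "a \<cdot> h = h \<cdot> a" using bern_commute[OF bern_mult_compl.hyps, of h] by simp
  then have c: "a \<cdot> k = k \<cdot> a" by (simp add: k_def op_distribs)
  have "pos_op (k\<^sup>\<star> \<cdot> a \<cdot> k)" "pos_op (k\<^sup>\<star> \<cdot> (h \<cdot> a) \<cdot> k)"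
    using bern_mult_compl.IH by (auto intro: pos_op_conj)
  with bern_mult_compl.IH show ?case
    unfolding k_def[symmetric] by (simp add: op_simps sa c hk)
next
  case (bern_add a b)
  then show ?case by (simp add: op_distribs pos_op_add)
next
  case (bern_scaleR r a)
  then show ?case by (simp add: op_distribs pos_op_scaleR)
qed

lemma bern_pos: "pos_op h \<Longrightarrow> pos_op (\<one> - h) \<Longrightarrow> bern h a \<Longrightarrow> pos_op a"
  using bern_pos_aux by blast

lemma bern_telescope:
  assumes "\<And>n. bern h (X (Suc n) - X n)" and "m \<le> n"
  shows "bern h (X n - X m)"
  using assms(2)
proof (induction rule: dec_induct)
  case base
  then show ?case by (simp add: bern_zero)
next
  case (step n)
  have "X (Suc n) - X m = (X (Suc n) - X n) + (X n - X m)" by simp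
  then show ?case using bern_add[OF assms(1)[of n] step.IH] by simp
qed

text \<open>Fixed points \<open>W\<close> satisfy
  \<open>(\<one> - W) (\<one> - W) = \<one> - h\<close>. Started at \<open>0\<close>, the iterates
  are polynomials in \<open>h\<close> with nonnegative coefficients and increase to such a
  \<open>W\<close>, which gives the square root \<open>\<one> - W\<close> of
  \<open>\<one> - h\<close>.\<close>

primrec sqrt_iter :: "('h::real_normed_vector \<Rightarrow>\<^sub>L 'h) \<Rightarrow> nat \<Rightarrow> ('h \<Rightarrow>\<^sub>L 'h)" where
  "sqrt_iter h 0 = 0"
| "sqrt_iter h (Suc n) = (1/2) *\<^sub>R (h + sqrt_iter h n \<cdot> sqrt_iter h n)"

lemma bern_sqrt_iter: "bern h (sqrt_iter h n)"
  by (induction n) (auto intro!: bern_zero bern_scaleR bern_add bern_comp bern_self)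

lemma bern_sqrt_iter_compl: "bern h (\<one> - sqrt_iter h n)"
proof (induction n)
  case (Suc n)
  let ?W = "sqrt_iter h n"
  have "\<one> - sqrt_iter h (Suc n) = (1/2) *\<^sub>R ((\<one> - h) + (\<one> - ?W) \<cdot> (\<one> + ?W))"
    by (rule op_eqI) (simp add: op_simps apply_simps inner_add inner_diff field_simps)
  then show ?case
    by (simp only:) (intro bern_scaleR bern_add bern_self bern_comp Suc bern_one bern_sqrt_iter, simp)
qed (simp add: bern_one)

text \<open>The difference of squares of commuting iterates factors, so each increment is the
  previous one times a \<open>bern\<close> factor.\<close>

lemma bern_sqrt_iter_step: "bern h (sqrt_iter h (Suc n) - sqrt_iter h n)"
proof (induction n)
  case 0
  then show ?case by (simp add: bern_scaleR bern_self)
next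
  case (Suc n)
  let ?W = "sqrt_iter h n" and ?V = "sqrt_iter h (Suc n)"
  have "?W \<cdot> ?V = ?V \<cdot> ?W" by (rule bern_commute2[OF bern_sqrt_iter bern_sqrt_iter])
  then have "(?V - ?W) \<cdot> (?V + ?W) = ?V \<cdot> ?V - ?W \<cdot> ?W"
    by (simp only: op_distribs) simp
  moreover have "sqrt_iter h (Suc (Suc n)) - ?V = (1/2) *\<^sub>R (?V \<cdot> ?V - ?W \<cdot> ?W)"
    unfolding sqrt_iter.simps(2)[of h "Suc n"]
    by (subst (4) sqrt_iter.simps(2)) (simp add: scaleR_diff_right scaleR_add_right)
  ultimately have "sqrt_iter h (Suc (Suc n)) - ?V = (1/2) *\<^sub>R ((?V - ?W) \<cdot> (?V + ?W))"
    by simp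
  then show ?case
    by (simp only:) (intro bern_scaleR bern_comp Suc bern_add bern_sqrt_iter, simp)
qed

lemma ex_sqrt_compl:
  fixes h :: "'h::{real_inner,complete_space} \<Rightarrow>\<^sub>L 'h"
  assumes h: "pos_op h" "pos_op (\<one> - h)"
  obtains s where "pos_op s" "s \<cdot> s = \<one> - h" "\<And>b. b \<cdot> h = h \<cdot> b \<Longrightarrow> b \<cdot> s = s \<cdot> b"
proof -
  let ?W = "sqrt_iter h"
  have pos: "pos_op (?W n)" "pos_op (\<one> - ?W n)" for n
    by (intro bern_pos[OF h] bern_sqrt_iter bern_sqrt_iter_compl)+
  have nW: "norm (?W n) \<le> 1" for n by (rule pos_op_contraction_norm[OF pos])
  have "convergent (\<lambda>n. ?W n x)" for x
  proof (rule increment_Cauchy)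
    fix m n :: nat assume "m \<le> n"
    \<comment> \<open>The increment lies between \<open>0\<close> and \<open>\<one>\<close>, so the
      square of its norm at \<open>x\<close> is bounded by its quadratic form at
      \<open>x\<close>.\<close>
    have A: "bern h (?W n - ?W m)"
      by (rule bern_telescope[of h ?W, OF bern_sqrt_iter_step \<open>m \<le> n\<close>])
    have "bern h ((\<one> - ?W n) + ?W m)" by (intro bern_add bern_sqrt_iter bern_sqrt_iter_compl)
    moreover have "(\<one> - ?W n) + ?W m = \<one> - (?W n - ?W m)" by simp
    ultimately have A': "bern h (\<one> - (?W n - ?W m))" by simp
    from pos_op_contraction_sq[OF bern_pos[OF h A] bern_pos[OF h A'], of x]
    show "(dist (?W n x) (?W m x))\<^sup>2 \<le> inner (?W n x) x - inner (?W m x) x"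
      by (simp add: dist_norm apply_simps inner_diff)
  next
    fix n show "inner (?W n x) x \<le> inner x x"
      using pos_opD(2)[OF pos(2), of n x] by (simp add: apply_simps inner_diff)
  qed
  from strong_limI[OF this nW] obtain T where T: "strong_lim ?W T" by blast
  have "strong_lim (\<lambda>n. (1/2) *\<^sub>R (h + ?W n \<cdot> ?W n)) ((1/2) *\<^sub>R (h + T \<cdot> T))"
    by (intro strong_lim_scaleR strong_lim_add strong_lim_const strong_lim_comp T nW)
  moreover have "strong_lim (\<lambda>n. (1/2) *\<^sub>R (h + ?W n \<cdot> ?W n)) T"
    using strong_lim_Suc[OF T] by simp
  ultimately have "T = (1/2) *\<^sub>R (h + T \<cdot> T)" using strong_lim_unique by blast
  then have "2 *\<^sub>R T = 2 *\<^sub>R ((1/2) *\<^sub>R (h + T \<cdot> T))" by (rule arg_cong)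
  then have "T + T = h + T \<cdot> T" by (simp add: scaleR_2)
  then have sq: "(\<one> - T) \<cdot> (\<one> - T) = \<one> - h" by (simp add: op_simps algebra_simps)
  have lim: "strong_lim (\<lambda>n. \<one> - ?W n) (\<one> - T)"
    by (intro strong_lim_diff strong_lim_const T)
  have "pos_op (\<one> - T)"
    unfolding pos_op_def
  proof (intro conjI allI)
    show "(\<one> - T)\<^sup>\<star> = \<one> - T"
      by (rule strong_lim_self_adjoint[OF lim]) (rule pos_opD(1)[OF pos(2)])
    fix x
    have "(\<lambda>n. inner ((\<one> - ?W n) x) x) \<longlonglongrightarrow> inner ((\<one> - T) x) x"
      using lim by (intro tendsto_inner tendsto_const) (simp add: strong_lim_def)
    then show "0 \<le> inner ((\<one> - T) x) x"
      by (rule LIMSEQ_le_const) (use pos_opD(2)[OF pos(2)] in blast)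
  qed
  moreover have "b \<cdot> (\<one> - T) = (\<one> - T) \<cdot> b" if "b \<cdot> h = h \<cdot> b" for b
    by (rule strong_lim_intertwine[OF lim]) (rule bern_commute[OF bern_sqrt_iter_compl that])
  ultimately show ?thesis using that sq by blast
qed

subsection \<open>Polar decomposition\<close>

text \<open>The Newton--Schulz iteration, which converges strongly to the partial isometry in the polar
  decomposition of a contraction.\<close>

primrec newton_schulz :: "('h::{real_inner,complete_space} \<Rightarrow>\<^sub>L 'h) \<Rightarrow> nat \<Rightarrow> ('h \<Rightarrow>\<^sub>L 'h)" where
  "newton_schulz a 0 = a"
| "newton_schulz a (Suc n) = newton_schulz a n \<cdot> ((1/2) *\<^sub>R
     (3 *\<^sub>R \<one> - (newton_schulz a n)\<^sup>\<star> \<cdot> newton_schulz a n))"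

text \<open>With \<open>h = a\<^sup>\<star> a\<close> the iterates are \<open>a P\<close>, where the
  polynomial \<open>P\<close> in \<open>h\<close> approximates the inverse square root of
  \<open>h\<close>. On a singular value \<open>\<sigma>\<close> in the unit interval one step is
  \<open>\<sigma> \<mapsto> \<sigma> (3 - \<sigma>\<^sup>2)/2\<close>, with fixed points
  \<open>0\<close> and \<open>1\<close>.\<close>

primrec newton_schulz_factor :: "('h::real_normed_vector \<Rightarrow>\<^sub>L 'h) \<Rightarrow> nat \<Rightarrow> ('h \<Rightarrow>\<^sub>L 'h)" where
  "newton_schulz_factor h 0 = \<one>"
| "newton_schulz_factor h (Suc n) = newton_schulz_factor h n \<cdot> ((1/2) *\<^sub>R
     (3 *\<^sub>R \<one> - newton_schulz_factor h n \<cdot> h \<cdot> newton_schulz_factor h n))"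

lemma newton_schulz_radj: "(newton_schulz a n)\<^sup>\<star> = newton_schulz (a\<^sup>\<star>) n"
proof (induction n)
  case (Suc n)
  then have "newton_schulz a n = (newton_schulz (a\<^sup>\<star>) n)\<^sup>\<star>" by (metis radj_radj)
  then show ?case by (simp add: op_simps)
qed simp

text \<open>These are positivity of the factor, the bound
  \<open>N\<^sup>\<star> N \<le> \<one>\<close> for the iterate, and monotonicity. With
  \<open>k = \<one> - P h P\<close>, the next complement is \<open>k\<^sup>2 (3 + k)/4\<close>,
  again with nonnegative coefficients.\<close>

lemma bern_newton_schulz_factor:
  "bern h (newton_schulz_factor h n) \<and>
   bern h (\<one> - newton_schulz_factor h n \<cdot> h \<cdot> newton_schulz_factor h n) \<and>
   bern h (newton_schulz_factor h (Suc n) - newton_schulz_factor h n)"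
proof (induction n)
  case 0
  have "newton_schulz_factor h (Suc 0) - newton_schulz_factor h 0 = (1/2) *\<^sub>R (\<one> - h)"
    by (rule op_eqI) (simp add: op_simps apply_simps inner_add inner_diff field_simps)
  then show ?case by (simp add: bern_one bern_self bern_scaleR del: newton_schulz_factor.simps(2))
next
  case (Suc n)
  define P where "P = newton_schulz_factor h n"
  define k where "k = \<one> - P \<cdot> h \<cdot> P"
  have P: "bern h P" and k: "bern h k" using Suc by (auto simp: P_def k_def)
  have PS: "newton_schulz_factor h (Suc n) = (1/2) *\<^sub>R (P \<cdot> (2 *\<^sub>R \<one> + k))"
    by (rule op_eqI) (simp add: k_def P_def[symmetric] op_simps apply_simps inner_add inner_diff field_simps)
  then have Q: "bern h (newton_schulz_factor h (Suc n))"
    by (simp only:) (intro bern_scaleR bern_comp bern_add P k bern_one; simp)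
  let ?Q = "newton_schulz_factor h (Suc n)"
  define k' where "k' = \<one> - ?Q \<cdot> h \<cdot> ?Q"
  have comm: "k \<cdot> P = P \<cdot> k" "k \<cdot> h = h \<cdot> k" "P \<cdot> h = h \<cdot> P"
    using bern_commute2[OF k P] bern_commute2[OF k bern_self(1)] bern_commute2[OF P bern_self(1)] by simp_all
  have hPP: "h \<cdot> P \<cdot> P = \<one> - k" using comm(3) by (simp add: k_def comp_assoc_op[symmetric])
  have "?Q \<cdot> h \<cdot> ?Q = (1/4) *\<^sub>R ((2 *\<^sub>R \<one> + k) \<cdot> (2 *\<^sub>R \<one> + k) \<cdot> (h \<cdot> P \<cdot> P))"
    unfolding PS
    by (rule op_eqI) (simp add: op_simps apply_simps inner_add inner_diff field_simps
        op_commute_apply[OF comm(1)] op_commute_apply[OF comm(2)] op_commute_apply[OF comm(3)])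
  then have "k' = (1/4) *\<^sub>R (k \<cdot> k \<cdot> (3 *\<^sub>R \<one> + k))"
    unfolding k'_def hPP
    by (simp only:) (rule op_eqI, simp add: op_simps apply_simps inner_add inner_diff field_simps)
  then have k': "bern h k'"
    by (simp only:) (intro bern_scaleR bern_comp bern_add k bern_one; simp)
  have "newton_schulz_factor h (Suc (Suc n)) - ?Q = (1/2) *\<^sub>R (?Q \<cdot> k')"
    unfolding newton_schulz_factor.simps(2)[of h "Suc n"] k'_def
    by (rule op_eqI) (simp del: newton_schulz_factor.simps add: op_simps apply_simps inner_add inner_diff field_simps)
  then have "bern h (newton_schulz_factor h (Suc (Suc n)) - ?Q)"
    by (simp only:) (intro bern_scaleR bern_comp Q k'; simp)
  with Q k' show ?case unfolding k'_def by blast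
qed

lemma newton_schulz_eq: "newton_schulz a n = a \<cdot> newton_schulz_factor (a\<^sup>\<star> \<cdot> a) n"
  if a: "norm a \<le> 1"
proof (induction n)
  case (Suc n)
  have "pos_op (newton_schulz_factor (a\<^sup>\<star> \<cdot> a) n)"
    using bern_newton_schulz_factor
    by (blast intro: bern_pos pos_op_radj_comp pos_op_one_minus_radj_comp[OF a])
  then have "(newton_schulz_factor (a\<^sup>\<star> \<cdot> a) n)\<^sup>\<star> = newton_schulz_factor (a\<^sup>\<star> \<cdot> a) n"
    by (rule pos_opD)
  then show ?case by (simp add: Suc op_simps)
qed simp

lemma newton_schulz_norm:
  assumes a: "norm a \<le> 1" shows "norm (newton_schulz a n) \<le> 1"
proof -
  let ?h = "a\<^sup>\<star> \<cdot> a" let ?P = "newton_schulz_factor ?h"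
  note h = pos_op_radj_comp[of a] pos_op_one_minus_radj_comp[OF a]
  have P: "pos_op (?P n)" "pos_op (\<one> - ?P n \<cdot> ?h \<cdot> ?P n)"
    using bern_newton_schulz_factor by (blast intro: bern_pos[OF h])+
  have eq: "(newton_schulz a n)\<^sup>\<star> \<cdot> newton_schulz a n = ?P n \<cdot> ?h \<cdot> ?P n"
    by (simp add: newton_schulz_eq[OF a] pos_opD(1)[OF P(1)] comp_assoc_op)
  show ?thesis
  proof (rule norm_blinfun_bound)
    fix x
    have "(norm (newton_schulz a n x))\<^sup>2 \<le> inner x x"
      unfolding norm_apply_sq eq
      using pos_opD(2)[OF P(2), of x] by (simp add: blinfun.diff_left inner_diff_left)
    then show "norm (newton_schulz a n x) \<le> 1 * norm x" by (simp add: power2_norm_eq_inner norm_le)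
  qed simp
qed

text \<open>Positivity of \<open>P m h (P n - P m)\<close> makes the inner product of the increment
  with the earlier iterate at \<open>x\<close> nonnegative; this is Pythagoras up to a nonnegative
  term.\<close>

lemma newton_schulz_increasing:
  assumes a: "norm a \<le> 1" and mn: "m \<le> n"
  shows "(dist (newton_schulz a n x) (newton_schulz a m x))\<^sup>2
    \<le> (norm (newton_schulz a n x))\<^sup>2 - (norm (newton_schulz a m x))\<^sup>2"
proof -
  let ?h = "a\<^sup>\<star> \<cdot> a" let ?P = "newton_schulz_factor ?h" let ?N = "newton_schulz a"
  note h = pos_op_radj_comp[of a] pos_op_one_minus_radj_comp[OF a]
  have "bern ?h (?P m)" using bern_newton_schulz_factor by blast
  moreover have "bern ?h (?P n - ?P m)"
    by (rule bern_telescope[OF _ mn]) (use bern_newton_schulz_factor in blast)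
  ultimately have "bern ?h (?P m \<cdot> (?h \<cdot> (?P n - ?P m)))"
    by (intro bern_comp bern_self)
  then have "pos_op (?P m \<cdot> (?h \<cdot> (?P n - ?P m)))" by (rule bern_pos[OF h])
  moreover have "(?P m)\<^sup>\<star> = ?P m" using \<open>bern ?h (?P m)\<close> bern_pos[OF h] pos_opD(1) by blast
  then have "?P m \<cdot> (?h \<cdot> (?P n - ?P m)) = (?N m)\<^sup>\<star> \<cdot> (?N n - ?N m)"
    by (simp add: newton_schulz_eq[OF a] op_simps)
  ultimately have "0 \<le> inner (((?N m)\<^sup>\<star> \<cdot> (?N n - ?N m)) x) x" by (metis pos_opD(2))
  then have "0 \<le> inner (?N n x - ?N m x) (?N m x)"
    by (simp flip: inner_radj' add: blinfun.diff_left)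
  then show ?thesis
    by (simp add: dist_norm power2_norm_eq_inner inner_diff inner_commute[of "?N m x" "?N n x"])
qed

lemma newton_schulz_limit:
  assumes a: "norm a \<le> 1"
  obtains v where "strong_lim (newton_schulz a) v" "norm v \<le> 1"
proof -
  have "convergent (\<lambda>n. newton_schulz a n x)" for x
  proof (rule increment_Cauchy[OF newton_schulz_increasing[OF a]])
    fix n
    have "norm (newton_schulz a n x) \<le> norm x"
      using norm_blinfun[of "newton_schulz a n" x]
        mult_right_mono[OF newton_schulz_norm[OF a, of n] norm_ge_zero[of x]] by simp
    then show "(norm (newton_schulz a n x))\<^sup>2 \<le> (norm x)\<^sup>2" by simp
  qed
  from strong_limI[OF this newton_schulz_norm[OF a]] that show ?thesis by blast
qed

section \<open>Partial isometries and polar parts\<close>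

lemma partial_isometry_cancel:
  assumes "is_proj (v\<^sup>\<star> \<cdot> v)"
  shows "v \<cdot> (v\<^sup>\<star> \<cdot> v) = v" "is_proj (v \<cdot> v\<^sup>\<star>)" "(v\<^sup>\<star> \<cdot> v) \<cdot> v\<^sup>\<star> = v\<^sup>\<star>"
proof -
  let ?E = "v\<^sup>\<star> \<cdot> v"
  have EE: "?E \<cdot> ?E = ?E" and Es: "?E\<^sup>\<star> = ?E" using assms by (auto simp: is_proj_def)
  have "(v - v \<cdot> ?E)\<^sup>\<star> \<cdot> (v - v \<cdot> ?E) = ?E - ?E \<cdot> ?E - ?E \<cdot> ?E + ?E \<cdot> ?E \<cdot> ?E"
    by (simp add: op_simps)
  also have "\<dots> = 0" using EE by simp
  finally have "v - v \<cdot> ?E = 0" by (simp only: radj_comp_self_eq_0_iff)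
  then show 1: "v \<cdot> ?E = v" by simp
  then have "v \<cdot> v\<^sup>\<star> \<cdot> (v \<cdot> v\<^sup>\<star>) = v \<cdot> v\<^sup>\<star>" by (metis comp_assoc_op)
  then show "is_proj (v \<cdot> v\<^sup>\<star>)" by (simp add: is_proj_def)
  have "(v \<cdot> ?E)\<^sup>\<star> = v\<^sup>\<star>" using 1 by simp
  then show "?E \<cdot> v\<^sup>\<star> = v\<^sup>\<star>" by (simp add: comp_assoc_op)
qed

lemma partial_isometry_kernel:
  "blinfun_apply (v\<^sup>\<star> \<cdot> v) x = 0 \<longleftrightarrow> v x = 0"
proof
  assume "blinfun_apply (v\<^sup>\<star> \<cdot> v) x = 0"
  then have "(norm (v x))\<^sup>2 = 0" unfolding norm_apply_sq by simp
  then show "v x = 0" by simp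
qed simp

text \<open>Here \<open>a\<^sup>\<star> v\<close> is the modulus of \<open>a\<close>. The last two
  conclusions transfer commutation and intertwining relations from \<open>a\<close> to the modulus
  and to \<open>v\<close>; they are what puts \<open>v\<close> into a von Neumann algebra containing
  \<open>a\<close>.\<close>

lemma polar_decomposition_contraction:
  fixes a :: "'h::{real_inner,complete_space} \<Rightarrow>\<^sub>L 'h"
  assumes a: "norm a \<le> 1"
  obtains v where "is_proj (v\<^sup>\<star> \<cdot> v)" "\<And>x. v x = 0 \<longleftrightarrow> a x = 0" "\<And>x. v\<^sup>\<star> x = 0 \<longleftrightarrow> a\<^sup>\<star> x = 0"
    "a\<^sup>\<star> \<cdot> v = v\<^sup>\<star> \<cdot> a"
    "\<And>b. b \<cdot> (a\<^sup>\<star> \<cdot> a) = (a\<^sup>\<star> \<cdot> a) \<cdot> b \<Longrightarrow> b \<cdot> (a\<^sup>\<star> \<cdot> v) = (a\<^sup>\<star> \<cdot> v) \<cdot> b"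
    "\<And>b c. c \<cdot> a = a \<cdot> b \<Longrightarrow> (a\<^sup>\<star> \<cdot> a) \<cdot> b = b \<cdot> (a\<^sup>\<star> \<cdot> a) \<Longrightarrow> c \<cdot> v = v \<cdot> b"
proof -
  have ker: "v x = 0 \<longleftrightarrow> a x = 0" if "norm a \<le> 1" "strong_lim (newton_schulz a) v" for a v :: "'h \<Rightarrow>\<^sub>L 'h" and x
  proof
    assume "v x = 0"
    have "(\<lambda>n. norm (newton_schulz a n x)) \<longlonglongrightarrow> norm (v x)"
      using that(2) by (intro tendsto_norm) (simp add: strong_lim_def)
    \<comment> \<open>The iteration starts at \<open>a\<close>, and the norms of the iterates at a
      fixed vector increase.\<close>
    moreover have "norm (a x) \<le> norm (newton_schulz a n x)" for n
    proof -
      have "0 \<le> (norm (newton_schulz a n x))\<^sup>2 - (norm (newton_schulz a 0 x))\<^sup>2"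
        by (rule order_trans[OF zero_le_power2 newton_schulz_increasing[OF that(1)]]) simp
      then show ?thesis by simp
    qed
    ultimately have "norm (a x) \<le> norm (v x)" by (intro LIMSEQ_le_const) auto
    then show "a x = 0" using \<open>v x = 0\<close> by simp
  next
    assume ax: "a x = 0"
    have z: "newton_schulz a n x = 0" for n
    proof (induction n)
      case (Suc n)
      then show ?case by (simp add: apply_simps)
    qed (simp add: ax)
    have "(\<lambda>n. newton_schulz a n x) \<longlonglongrightarrow> v x" using that(2) by (simp add: strong_lim_def)
    then show "v x = 0" unfolding z by (rule LIMSEQ_unique) (rule tendsto_const)
  qed
  obtain v where v: "strong_lim (newton_schulz a) v" and nv: "norm v \<le> 1"
    using newton_schulz_limit[OF a] by blast
  \<comment> \<open>The adjoint iteration gets its own limit, which is then identified as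
    \<open>v\<^sup>\<star>\<close>; only so do the products \<open>H n\<close> converge strongly to
    \<open>v\<^sup>\<star> v\<close>.\<close>
  have a': "norm (a\<^sup>\<star>) \<le> 1" using a by simp
  obtain v' where v': "strong_lim (newton_schulz (a\<^sup>\<star>)) v'"
    using newton_schulz_limit[OF a'] by blast
  have "v\<^sup>\<star> = v'" by (rule strong_lim_radj[OF v]) (simp add: newton_schulz_radj v')
  then have vs: "strong_lim (newton_schulz (a\<^sup>\<star>)) (v\<^sup>\<star>)" using v' by simp
  let ?N = "newton_schulz a"
  define H where "H n = newton_schulz (a\<^sup>\<star>) n \<cdot> ?N n" for n
  define E where "E = v\<^sup>\<star> \<cdot> v"
  have HE: "strong_lim H E"
    unfolding H_def E_def by (intro strong_lim_comp vs v newton_schulz_norm a')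
  have Hn: "norm (H n) \<le> 1" for n
    unfolding H_def by (intro comp_contraction newton_schulz_norm a a')
  have HS: "4 *\<^sub>R H (Suc n) = (3 *\<^sub>R \<one> - H n) \<cdot> (H n \<cdot> (3 *\<^sub>R \<one> - H n))" for n
  proof -
    have 1: "(?N n)\<^sup>\<star> \<cdot> ?N n = H n" by (simp add: H_def newton_schulz_radj)
    have 2: "(H n)\<^sup>\<star> = H n" unfolding 1[symmetric] by simp
    have "H (Suc n) = (?N (Suc n))\<^sup>\<star> \<cdot> ?N (Suc n)" by (simp only: H_def newton_schulz_radj)
    also have "\<dots> = ((1/2) *\<^sub>R (3 *\<^sub>R \<one> - H n)) \<cdot> ((?N n)\<^sup>\<star> \<cdot> ?N n) \<cdot> ((1/2) *\<^sub>R (3 *\<^sub>R \<one> - H n))"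
      by (simp add: 1 2 comp_assoc_op comp_left_op[OF 1])
    finally have "H (Suc n) = (1/4) *\<^sub>R ((3 *\<^sub>R \<one> - H n) \<cdot> (H n \<cdot> (3 *\<^sub>R \<one> - H n)))"
      unfolding 1 blinfun_compose.scaleR_left blinfun_compose.scaleR_right comp_assoc_op by simp
    then show ?thesis by simp
  qed
  have "strong_lim (\<lambda>n. (3 *\<^sub>R \<one> - H n) \<cdot> (H n \<cdot> (3 *\<^sub>R \<one> - H n)))
     ((3 *\<^sub>R \<one> - E) \<cdot> (E \<cdot> (3 *\<^sub>R \<one> - E)))"
  proof -
    have "strong_lim (\<lambda>n. H n \<cdot> H n) (E \<cdot> E)" by (intro strong_lim_comp HE Hn)
    then have "strong_lim (\<lambda>n. H n \<cdot> (H n \<cdot> H n)) (E \<cdot> (E \<cdot> E))"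
      by (intro strong_lim_comp HE Hn)
    with HE \<open>strong_lim (\<lambda>n. H n \<cdot> H n) (E \<cdot> E)\<close>
    have "strong_lim (\<lambda>n. 9 *\<^sub>R H n - 6 *\<^sub>R (H n \<cdot> H n) + H n \<cdot> (H n \<cdot> H n))
      (9 *\<^sub>R E - 6 *\<^sub>R (E \<cdot> E) + E \<cdot> (E \<cdot> E))"
      by (intro strong_lim_add strong_lim_diff strong_lim_scaleR)
    moreover have "(3 *\<^sub>R \<one> - X) \<cdot> (X \<cdot> (3 *\<^sub>R \<one> - X)) = 9 *\<^sub>R X - 6 *\<^sub>R (X \<cdot> X) + X \<cdot> (X \<cdot> X)"
      for X :: "'h \<Rightarrow>\<^sub>L 'h"
      by (rule op_eqI) (simp add: op_simps apply_simps inner_add inner_diff)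
    ultimately show ?thesis by simp
  qed
  moreover have "strong_lim (\<lambda>n. (3 *\<^sub>R \<one> - H n) \<cdot> (H n \<cdot> (3 *\<^sub>R \<one> - H n))) (4 *\<^sub>R E)"
    unfolding HS[symmetric] by (intro strong_lim_scaleR strong_lim_Suc HE)
  ultimately have E4: "4 *\<^sub>R E = (3 *\<^sub>R \<one> - E) \<cdot> (E \<cdot> (3 *\<^sub>R \<one> - E))"
    using strong_lim_unique by blast
  \<comment> \<open>The limit satisfies \<open>E (E - \<one>) (E - 5 \<one>) = 0\<close>. The root 5
    is excluded by \<open>norm E \<le> 1\<close>, in the form that \<open>5 D = D E\<close> forces
    \<open>D = 0\<close>.\<close>
  define D where "D = E - E \<cdot> E"
  have "5 *\<^sub>R D = D \<cdot> E"
  proof (rule op_eqI)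
    fix x y
    have "inner ((4 *\<^sub>R E) x) y = inner (((3 *\<^sub>R \<one> - E) \<cdot> (E \<cdot> (3 *\<^sub>R \<one> - E))) x) y"
      using E4 by simp
    then show "inner ((5 *\<^sub>R D) x) y = inner ((D \<cdot> E) x) y"
      by (simp add: D_def op_simps apply_simps inner_add inner_diff)
  qed
  then have "norm (5 *\<^sub>R D) \<le> norm D * norm E" by (simp add: norm_blinfun_compose)
  moreover have "norm E \<le> 1" unfolding E_def by (intro comp_contraction) (simp_all add: nv)
  then have "norm D * norm E \<le> norm D" by (simp add: mult_left_le)
  ultimately have "norm D \<le> 0" unfolding norm_scaleR by linarith
  then have "E \<cdot> E = E" by (simp add: D_def)
  then have E: "is_proj E" by (simp add: is_proj_def) (simp add: E_def)
  have sym: "a\<^sup>\<star> \<cdot> v = v\<^sup>\<star> \<cdot> a"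
  proof -
    note h = pos_op_radj_comp[of a] pos_op_one_minus_radj_comp[OF a]
    have "a\<^sup>\<star> \<cdot> ?N n = newton_schulz (a\<^sup>\<star>) n \<cdot> a" for n
    proof -
      let ?P = "newton_schulz_factor (a\<^sup>\<star> \<cdot> a) n"
      have b: "bern (a\<^sup>\<star> \<cdot> a) ?P" using bern_newton_schulz_factor by blast
      have "?P\<^sup>\<star> = ?P" by (rule pos_opD(1)[OF bern_pos[OF h b]])
      moreover have "(a\<^sup>\<star> \<cdot> a) \<cdot> ?P = ?P \<cdot> (a\<^sup>\<star> \<cdot> a)" by (rule bern_commute[OF b]) simp
      ultimately show ?thesis
        by (simp add: newton_schulz_radj[symmetric] newton_schulz_eq[OF a] comp_assoc_op)
    qed
    then have "strong_lim (\<lambda>n. newton_schulz (a\<^sup>\<star>) n \<cdot> a) (a\<^sup>\<star> \<cdot> v)"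
      using strong_lim_comp_left[OF v, of "a\<^sup>\<star>"] by simp
    then show ?thesis by (rule strong_lim_unique) (rule strong_lim_comp_right[OF vs])
  qed
  have int: "c \<cdot> v = v \<cdot> b" if "c \<cdot> a = a \<cdot> b" "(a\<^sup>\<star> \<cdot> a) \<cdot> b = b \<cdot> (a\<^sup>\<star> \<cdot> a)" for b c
  proof (rule strong_lim_intertwine[OF v])
    fix n
    have b: "bern (a\<^sup>\<star> \<cdot> a) (newton_schulz_factor (a\<^sup>\<star> \<cdot> a) n)" using bern_newton_schulz_factor by blast
    have "b \<cdot> newton_schulz_factor (a\<^sup>\<star> \<cdot> a) n = newton_schulz_factor (a\<^sup>\<star> \<cdot> a) n \<cdot> b"
      by (rule bern_commute[OF b]) (simp add: that(2))
    then show "c \<cdot> ?N n = ?N n \<cdot> b"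
      by (simp add: newton_schulz_eq[OF a] comp_left_op[OF that(1)] comp_assoc_op)
  qed
  have comm: "b \<cdot> (a\<^sup>\<star> \<cdot> v) = (a\<^sup>\<star> \<cdot> v) \<cdot> b"
    if "b \<cdot> (a\<^sup>\<star> \<cdot> a) = (a\<^sup>\<star> \<cdot> a) \<cdot> b" for b
  proof (rule strong_lim_intertwine[OF strong_lim_comp_left[OF v]])
    fix n
    have "bern (a\<^sup>\<star> \<cdot> a) ((a\<^sup>\<star> \<cdot> a) \<cdot> newton_schulz_factor (a\<^sup>\<star> \<cdot> a) n)"
      using bern_newton_schulz_factor by (blast intro: bern_mult)
    from bern_commute[OF this that] show "b \<cdot> (a\<^sup>\<star> \<cdot> ?N n) = (a\<^sup>\<star> \<cdot> ?N n) \<cdot> b"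
      by (simp add: newton_schulz_eq[OF a] comp_assoc_op)
  qed
  show ?thesis
    by (rule that[of v]) (use E E_def ker[OF a v] ker[OF a' vs] sym comm int in auto)
qed

lemma polar_decomposition:
  fixes a :: "'h::{real_inner,complete_space} \<Rightarrow>\<^sub>L 'h"
  obtains v where "is_proj (v\<^sup>\<star> \<cdot> v)" "\<And>x. v x = 0 \<longleftrightarrow> a x = 0" "\<And>x. v\<^sup>\<star> x = 0 \<longleftrightarrow> a\<^sup>\<star> x = 0"
    "a\<^sup>\<star> \<cdot> v = v\<^sup>\<star> \<cdot> a"
    "\<And>b. b \<cdot> (a\<^sup>\<star> \<cdot> a) = (a\<^sup>\<star> \<cdot> a) \<cdot> b \<Longrightarrow> b \<cdot> (a\<^sup>\<star> \<cdot> v) = (a\<^sup>\<star> \<cdot> v) \<cdot> b"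
    "\<And>b c. c \<cdot> a = a \<cdot> b \<Longrightarrow> (a\<^sup>\<star> \<cdot> a) \<cdot> b = b \<cdot> (a\<^sup>\<star> \<cdot> a) \<Longrightarrow> c \<cdot> v = v \<cdot> b"
proof -
  \<comment> \<open>Scaling to a contraction preserves kernels and commutation relations; the added
    1 covers \<open>a = 0\<close>.\<close>
  define r where "r = inverse (norm a + 1)"
  have r: "r > 0" "norm (r *\<^sub>R a) \<le> 1"
  proof -
    have "norm a + 1 > 0" using norm_ge_zero[of a] by linarith
    then show "r > 0" "norm (r *\<^sub>R a) \<le> 1" by (simp_all add: r_def field_simps)
  qed
  from polar_decomposition_contraction[OF r(2)] obtain v
    where v: "is_proj (v\<^sup>\<star> \<cdot> v)" "\<And>x. v x = 0 \<longleftrightarrow> (r *\<^sub>R a) x = 0"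
      "\<And>x. v\<^sup>\<star> x = 0 \<longleftrightarrow> (r *\<^sub>R a)\<^sup>\<star> x = 0"
    "(r *\<^sub>R a)\<^sup>\<star> \<cdot> v = v\<^sup>\<star> \<cdot> (r *\<^sub>R a)"
    "\<And>b. b \<cdot> ((r *\<^sub>R a)\<^sup>\<star> \<cdot> (r *\<^sub>R a)) = ((r *\<^sub>R a)\<^sup>\<star> \<cdot> (r *\<^sub>R a)) \<cdot> b \<Longrightarrow>
       b \<cdot> ((r *\<^sub>R a)\<^sup>\<star> \<cdot> v) = ((r *\<^sub>R a)\<^sup>\<star> \<cdot> v) \<cdot> b"
    "\<And>b c. c \<cdot> (r *\<^sub>R a) = (r *\<^sub>R a) \<cdot> b \<Longrightarrow>
       ((r *\<^sub>R a)\<^sup>\<star> \<cdot> (r *\<^sub>R a)) \<cdot> b = b \<cdot> ((r *\<^sub>R a)\<^sup>\<star> \<cdot> (r *\<^sub>R a)) \<Longrightarrow> c \<cdot> v = v \<cdot> b"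
    by blast
  show ?thesis
    by (rule that[of v]) (use v r(1) in \<open>simp_all add: op_distribs apply_simps\<close>)
qed

section \<open>Von Neumann algebras\<close>

subsection \<open>Complex-linear operators\<close>

lemma Im_cinner: "Im (cinner x y) = - inner (scaleC \<i> x) (y::'h::complex_hilbert_space)"
  by (simp add: Re_cinner[symmetric] cinner_scaleC_left)

lemma cinner_eqI:
  assumes "inner x y = inner x' y'" "inner (scaleC \<i> x) y = inner (scaleC \<i> x') y'"
  shows "cinner x y = cinner x' (y'::'h::complex_hilbert_space)"
  using assms by (simp add: complex_eq_iff Re_cinner Im_cinner)

lemma inner_scaleC_i: "inner (scaleC \<i> x) (scaleC \<i> y) = inner x (y::'h::complex_hilbert_space)"
proof -
  have "cinner (scaleC \<i> x) (scaleC \<i> y) = \<i> * cnj (\<i> * cinner y x)"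
    using cinner_commute[of x "scaleC \<i> y"] by (simp add: cinner_scaleC_left)
  also have "\<dots> = cinner x y" using cinner_commute[of x y] by simp
  finally show ?thesis by (metis Re_cinner)
qed

lemma scaleC_one: "scaleC 1 x = (x::'h::complex_hilbert_space)"
  using scaleC_of_real[of 1 x] by simp

lemma scaleC_i_i: "scaleC \<i> (scaleC \<i> x) = - (x::'h::complex_hilbert_space)"
  using scaleC_of_real[of "-1" x] by (simp add: scaleC_scaleC)

text \<open>Complex linearity of an operator becomes commutation with \<open>iop\<close>, a
  condition that passes to strong limits and to projections like commutation with any other
  operator.\<close>

definition iop :: "'h::complex_hilbert_space \<Rightarrow>\<^sub>L 'h" where
  "iop = Blinfun (scaleC \<i>)"

lemma iop_apply [simp]: "iop x = scaleC \<i> x"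
proof -
  have "bounded_linear (scaleC \<i> :: 'a \<Rightarrow> 'a)"
  proof (rule bounded_linear_intro[of _ 1])
    fix x y :: 'a and r :: real
    show "scaleC \<i> (x + y) = scaleC \<i> x + scaleC \<i> y" by (rule scaleC_add_right)
    show "scaleC \<i> (r *\<^sub>R x) = r *\<^sub>R scaleC \<i> x"
      by (simp add: scaleC_of_real[symmetric] scaleC_scaleC mult.commute)
    show "norm (scaleC \<i> x) \<le> norm x * 1" by (simp add: norm_le inner_scaleC_i)
  qed
  then show ?thesis by (simp add: iop_def bounded_linear_Blinfun_apply)
qed

lemma iop_iop: "iop \<cdot> iop = - \<one>"
  by (rule blinfun_eqI) (simp add: scaleC_i_i apply_simps)

lemma iop_radj: "iop\<^sup>\<star> = - iop"
proof (rule radj_eqI)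
  fix x y :: 'a
  have "inner (scaleC \<i> x) y = - inner (scaleC \<i> x) (scaleC \<i> (scaleC \<i> y))"
    by (simp add: scaleC_i_i)
  then show "inner (iop x) y = inner x ((- iop) y)" by (simp add: inner_scaleC_i apply_simps)
qed

lemma scaleC_eq: "scaleC c x = Re c *\<^sub>R x + Im c *\<^sub>R scaleC \<i> (x::'h::complex_hilbert_space)"
proof -
  have "scaleC c x = scaleC (complex_of_real (Re c) + complex_of_real (Im c) * \<i>) x"
    by (rule arg_cong[of _ _ "\<lambda>d. scaleC d x"]) (simp add: complex_eq_iff)
  then show ?thesis
    by (simp add: scaleC_add_left scaleC_scaleC[symmetric] scaleC_of_real)
qed

lemma bounded_ops_iff: "T \<in> bounded_ops \<longleftrightarrow> iop \<cdot> T = T \<cdot> iop"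
proof
  assume "T \<in> bounded_ops"
  then show "iop \<cdot> T = T \<cdot> iop" by (intro blinfun_eqI) (simp add: bounded_ops_def)
next
  assume "iop \<cdot> T = T \<cdot> iop"
  then have i: "T (scaleC \<i> x) = scaleC \<i> (T x)" for x using op_commute_apply[of iop T T iop] by simp
  have "T (scaleC c x) = scaleC c (T x)" for c x by (simp add: scaleC_eq[of c] apply_simps i)
  then show "T \<in> bounded_ops" by (simp add: bounded_ops_def)
qed

lemma bounded_ops_radj: "T \<in> bounded_ops \<Longrightarrow> T\<^sup>\<star> \<in> bounded_ops"
proof -
  assume "T \<in> bounded_ops"
  then have "(iop \<cdot> T)\<^sup>\<star> = (T \<cdot> iop)\<^sup>\<star>" by (simp add: bounded_ops_iff)
  then show ?thesis by (simp add: bounded_ops_iff iop_radj op_distribs)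
qed

text \<open>The imaginary part of \<open>cinner x y\<close> is minus the real inner product of
  \<open>scaleC \<i> x\<close> with \<open>y\<close>, so for complex-linear operators the real
  adjoint relation implies the complex one.\<close>

lemma adj_eq_radj: "T \<in> bounded_ops \<Longrightarrow> adj T = T\<^sup>\<star>"
  unfolding adj_def
proof (rule the_equality)
  assume T: "T \<in> bounded_ops"
  then have "T (scaleC \<i> x) = scaleC \<i> (T x)" for x by (simp add: bounded_ops_def)
  then show "\<forall>x y. cinner (T x) y = cinner x (T\<^sup>\<star> y)"
    by (intro allI cinner_eqI) (simp_all add: inner_radj[symmetric])
  fix S assume "\<forall>x y. cinner (T x) y = cinner x (blinfun_apply S y)"
  then have "inner (T x) y = inner x (S y)" for x y by (simp flip: Re_cinner)
  then show "S = T\<^sup>\<star>" by (rule radj_eqI[symmetric])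
qed

lemma projection_iff: "projection p \<longleftrightarrow> p \<in> bounded_ops \<and> is_proj p"
  by (auto simp: projection_def is_proj_def adj_eq_radj)

lemma bounded_ops_simps [simp]:
  "\<one> \<in> bounded_ops" "0 \<in> bounded_ops"
  "a \<in> bounded_ops \<Longrightarrow> b \<in> bounded_ops \<Longrightarrow> a + b \<in> bounded_ops"
  "a \<in> bounded_ops \<Longrightarrow> b \<in> bounded_ops \<Longrightarrow> a - b \<in> bounded_ops"
  "a \<in> bounded_ops \<Longrightarrow> r *\<^sub>R a \<in> bounded_ops"
  "iop \<in> bounded_ops"
  by (simp_all add: bounded_ops_iff op_distribs)

lemma bounded_ops_comp [simp]:
  "a \<in> bounded_ops \<Longrightarrow> b \<in> bounded_ops \<Longrightarrow> a \<cdot> b \<in> bounded_ops"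
  unfolding bounded_ops_iff by (metis comp_assoc_op)

lemma ops_on_iff:
  assumes "is_proj e"
  shows "T \<in> ops_on e \<longleftrightarrow> T \<in> bounded_ops \<and> e \<cdot> T = T \<and> T \<cdot> e = T"
proof -
  have "e \<cdot> T = T \<and> T \<cdot> e = T" if "e \<cdot> T \<cdot> e = T"
    using that is_projD(1)[OF assms] by (metis comp_assoc_op)
  then show ?thesis unfolding ops_on_def by auto
qed

subsection \<open>Closure properties\<close>

locale vna =
  fixes e :: "'h::complex_hilbert_space \<Rightarrow>\<^sub>L 'h" and M :: "('h \<Rightarrow>\<^sub>L 'h) set"
  assumes von_neumann_algebra: "von_neumann_algebra e M"
begin

abbreviation M' where "M' \<equiv> commutant e M"

lemma e_proj: "is_proj e" and e_bounded: "e \<in> bounded_ops"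
  using von_neumann_algebra by (auto simp: von_neumann_algebra_def projection_iff)

lemma memD:
  assumes "a \<in> M"
  shows "a \<in> bounded_ops" "e \<cdot> a = a" "a \<cdot> e = a" "a \<in> ops_on e"
  using assms von_neumann_algebra ops_on_iff[OF e_proj, of a]
  by (auto simp: von_neumann_algebra_def)

lemma adj_mem: "a \<in> M \<Longrightarrow> adj a = a\<^sup>\<star>"
  by (simp add: adj_eq_radj memD)

lemma mem_radj [simp]: "a \<in> M \<Longrightarrow> a\<^sup>\<star> \<in> M"
  using von_neumann_algebra by (auto simp: von_neumann_algebra_def adj_mem[symmetric])

lemma commutant_iff:
  "s \<in> M' \<longleftrightarrow> s \<in> bounded_ops \<and> e \<cdot> s = s \<and> s \<cdot> e = s \<and> (\<forall>a\<in>M. s \<cdot> a = a \<cdot> s)"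
  by (simp add: commutant_def ops_on_iff[OF e_proj])

lemma commutant_radj: "s \<in> M' \<Longrightarrow> s\<^sup>\<star> \<in> M'"
proof -
  assume s: "s \<in> M'"
  have "s\<^sup>\<star> \<cdot> a = a \<cdot> s\<^sup>\<star>" if "a \<in> M" for a
  proof -
    have "s \<cdot> a\<^sup>\<star> = a\<^sup>\<star> \<cdot> s" using s that by (simp add: commutant_iff)
    then have "(s \<cdot> a\<^sup>\<star>)\<^sup>\<star> = (a\<^sup>\<star> \<cdot> s)\<^sup>\<star>" by simp
    then show ?thesis by simp
  qed
  moreover have "(e \<cdot> s)\<^sup>\<star> = s\<^sup>\<star>" "(s \<cdot> e)\<^sup>\<star> = s\<^sup>\<star>" using s by (simp_all add: commutant_iff)
  ultimately show ?thesis
    using s is_projD(2)[OF e_proj] by (simp add: commutant_iff bounded_ops_radj)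
qed

text \<open>The inclusion of the bicommutant in \<open>M\<close>; limits and projections enter
  \<open>M\<close> by this route.\<close>

lemma memI:
  assumes "T \<in> bounded_ops" "e \<cdot> T = T" "T \<cdot> e = T" "\<And>s. s \<in> M' \<Longrightarrow> s \<cdot> T = T \<cdot> s"
  shows "T \<in> M"
proof -
  have "T \<in> commutant e M'"
    using assms by (auto simp: commutant_def[of e "M'"] ops_on_iff[OF e_proj])
  then show ?thesis using von_neumann_algebra by (auto simp: von_neumann_algebra_def)
qed

lemma commutantD: "s \<in> M' \<Longrightarrow> a \<in> M \<Longrightarrow> s \<cdot> a = a \<cdot> s"
  by (simp add: commutant_iff)

lemma centerD:
  assumes "a \<in> center e M"
  shows "a \<in> M" "m \<in> M \<Longrightarrow> a \<cdot> m = m \<cdot> a" "m \<in> M' \<Longrightarrow> a \<cdot> m = m \<cdot> a"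
  using assms commutantD[of a m] commutantD[of m a] by (auto simp: center_def)

lemma mem_simps [simp]:
  "e \<in> M" "0 \<in> M"
  "a \<in> M \<Longrightarrow> b \<in> M \<Longrightarrow> a + b \<in> M"
  "a \<in> M \<Longrightarrow> b \<in> M \<Longrightarrow> a - b \<in> M"
  "a \<in> M \<Longrightarrow> r *\<^sub>R a \<in> M"
proof -
  show "e \<in> M"
    by (rule memI) (simp_all add: e_bounded is_projD[OF e_proj] commutant_iff)
  have "s \<cdot> (a + b) = (a + b) \<cdot> s" "s \<cdot> (a - b) = (a - b) \<cdot> s" if "s \<in> M'" "a \<in> M" "b \<in> M" for s
    using commutantD[OF that(1,2)] commutantD[OF that(1,3)] by (simp_all add: op_distribs)
  then show "a \<in> M \<Longrightarrow> b \<in> M \<Longrightarrow> a + b \<in> M" "a \<in> M \<Longrightarrow> b \<in> M \<Longrightarrow> a - b \<in> M"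
    by (intro memI; simp add: memD op_distribs)+
  have "s \<cdot> (r *\<^sub>R a) = (r *\<^sub>R a) \<cdot> s" if "s \<in> M'" "a \<in> M" for s
    using commutantD[OF that(1,2)] by (simp add: op_distribs)
  then show "a \<in> M \<Longrightarrow> r *\<^sub>R a \<in> M"
    by (intro memI) (simp_all add: memD op_distribs)
  show "0 \<in> M" by (rule memI) simp_all
qed

lemma mem_comp [simp]: assumes "a \<in> M" "b \<in> M" shows "a \<cdot> b \<in> M"
proof (rule memI)
  fix s assume s: "s \<in> M'"
  show "s \<cdot> (a \<cdot> b) = a \<cdot> b \<cdot> s"
    using commutantD[OF s] assms by (metis comp_assoc_op)
qed (use assms in \<open>simp_all add: memD comp_assoc_op comp_left_op[OF memD(2)]\<close>)

lemma mem_iop [simp]: assumes "a \<in> M" shows "iop \<cdot> a \<in> M"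
proof -
  have i: "iop \<cdot> b = b \<cdot> iop" if "b \<in> bounded_ops" for b :: "'h \<Rightarrow>\<^sub>L 'h"
    using that by (simp add: bounded_ops_iff)
  have ie: "iop \<cdot> e \<in> M"
  proof (rule memI)
    fix s assume s: "s \<in> M'"
    then show "s \<cdot> (iop \<cdot> e) = iop \<cdot> e \<cdot> s"
      using i[of s] by (metis commutant_iff comp_assoc_op)
  next
    show "e \<cdot> (iop \<cdot> e) = iop \<cdot> e"
      by (metis i[OF e_bounded] is_projD(1)[OF e_proj] comp_assoc_op)
  qed (simp_all add: comp_assoc_op is_projD(1)[OF e_proj] e_bounded)
  have "iop \<cdot> a = (iop \<cdot> e) \<cdot> a" using assms by (simp add: comp_assoc_op memD)
  then show ?thesis using mem_comp[OF ie assms] by simp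
qed

lemma mem_strong_lim:
  assumes X: "strong_lim X T" and XM: "\<And>n. X n \<in> M"
  shows "T \<in> M"
proof (rule memI)
  show "T \<in> bounded_ops"
    unfolding bounded_ops_iff
    by (rule strong_lim_intertwine[OF X]) (use memD(1)[OF XM] in \<open>simp add: bounded_ops_iff\<close>)
  show "e \<cdot> T = T"
    using strong_lim_intertwine[OF X, of e \<one>] by (simp add: memD[OF XM])
  show "T \<cdot> e = T"
    using strong_lim_intertwine[OF X, of \<one> e] by (simp add: memD[OF XM])
  fix s assume "s \<in> M'"
  then show "s \<cdot> T = T \<cdot> s"
    by (intro strong_lim_intertwine[OF X] commutantD XM)
qed

text \<open>The commutant is closed under adjoints and \<open>iop\<close> is skew-adjoint, so mere
  invariance of the range of \<open>p\<close> yields commutation.\<close>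

lemma mem_projI:
  assumes p: "is_proj p" and ep: "e \<cdot> p = p" and ip: "p \<cdot> iop \<cdot> p = iop \<cdot> p"
    and inv: "\<And>s. s \<in> M' \<Longrightarrow> p \<cdot> s \<cdot> p = s \<cdot> p"
  shows "p \<in> M"
proof (rule memI)
  show "p \<in> bounded_ops"
    unfolding bounded_ops_iff
    by (rule projection_onto_commutes[OF p ip, symmetric]) (simp add: iop_radj op_distribs ip)
  show "e \<cdot> p = p" by (rule ep)
  have "(e \<cdot> p)\<^sup>\<star> = p\<^sup>\<star>" using ep by simp
  then show "p \<cdot> e = p" by (simp add: is_projD[OF p] is_projD[OF e_proj])
  fix s assume "s \<in> M'"
  then show "s \<cdot> p = p \<cdot> s"
    by (intro projection_onto_commutes[OF p, symmetric] inv commutant_radj)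
qed

text \<open>The intertwining property with \<open>c = b = s\<close> makes \<open>v\<close> commute
  with every \<open>s\<close> in the commutant; complex linearity and the relations with
  \<open>e\<close> follow in the same way.\<close>

lemma ex_polar_mem:
  assumes a: "a \<in> M"
  obtains v where "v \<in> M" "is_proj (v\<^sup>\<star> \<cdot> v)" "\<And>x. v x = 0 \<longleftrightarrow> a x = 0" "\<And>x. v\<^sup>\<star> x = 0 \<longleftrightarrow> a\<^sup>\<star> x = 0"
    "a\<^sup>\<star> \<cdot> v = v\<^sup>\<star> \<cdot> a"
    "\<And>b. b \<cdot> (a\<^sup>\<star> \<cdot> a) = (a\<^sup>\<star> \<cdot> a) \<cdot> b \<Longrightarrow> b \<cdot> (a\<^sup>\<star> \<cdot> v) = (a\<^sup>\<star> \<cdot> v) \<cdot> b"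
    "\<And>b c. c \<cdot> a = a \<cdot> b \<Longrightarrow> (a\<^sup>\<star> \<cdot> a) \<cdot> b = b \<cdot> (a\<^sup>\<star> \<cdot> a) \<Longrightarrow> c \<cdot> v = v \<cdot> b"
proof -
  obtain v where v: "is_proj (v\<^sup>\<star> \<cdot> v)" "\<And>x. v x = 0 \<longleftrightarrow> a x = 0" "\<And>x. v\<^sup>\<star> x = 0 \<longleftrightarrow> a\<^sup>\<star> x = 0"
    "a\<^sup>\<star> \<cdot> v = v\<^sup>\<star> \<cdot> a"
    "\<And>b. b \<cdot> (a\<^sup>\<star> \<cdot> a) = (a\<^sup>\<star> \<cdot> a) \<cdot> b \<Longrightarrow> b \<cdot> (a\<^sup>\<star> \<cdot> v) = (a\<^sup>\<star> \<cdot> v) \<cdot> b" and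
    int: "\<And>b c. c \<cdot> a = a \<cdot> b \<Longrightarrow> (a\<^sup>\<star> \<cdot> a) \<cdot> b = b \<cdot> (a\<^sup>\<star> \<cdot> a) \<Longrightarrow> c \<cdot> v = v \<cdot> b"
    using polar_decomposition[of a] by blast
  have aa: "a\<^sup>\<star> \<cdot> a \<in> M" using a by simp
  have "v \<in> M"
  proof (rule memI)
    show "v \<in> bounded_ops"
      unfolding bounded_ops_iff
      by (rule int) (use memD(1)[OF a] memD(1)[OF aa] in \<open>simp_all add: bounded_ops_iff\<close>)
    show "e \<cdot> v = v" using int[of e \<one>] by (simp add: memD[OF a])
    show "v \<cdot> e = v" using int[of \<one> e] memD(2,3)[OF aa] by (simp add: memD[OF a])
    fix s assume s: "s \<in> M'"
    show "s \<cdot> v = v \<cdot> s"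
      by (rule int) (use commutantD[OF s a] commutantD[OF s aa] in simp_all)
  qed
  then show ?thesis using that v int by blast
qed

text \<open>The range of \<open>z\<close> consists of the vectors in the range of \<open>e\<close>
  annihilated by all \<open>q m\<close> with \<open>m \<in> M\<close>. It is invariant under
  \<open>M\<close> and under the commutant, so \<open>z\<close> is central; it contains the range of
  \<open>p\<close>, and the choice \<open>m = e\<close> gives \<open>q z = 0\<close>.\<close>

lemma ex_central_projection:
  assumes p: "p \<in> M" and q: "q \<in> M" and orth: "\<And>m. m \<in> M \<Longrightarrow> q \<cdot> m \<cdot> p = 0"
  obtains z where "is_proj z" "z \<in> center e M" "z \<cdot> p = p" "q \<cdot> z = 0"
proof -
  define S where "S = {x. e x = x \<and> (\<forall>m\<in>M. q (m x) = 0)}"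
  have "S = {x. e x = x} \<inter> (\<Inter>m\<in>M. {x. q (blinfun_apply m x) = 0})" by (auto simp: S_def)
  moreover have "closed {x. e x = x}" "closed {x. q (blinfun_apply m x) = 0}" for m
    by (intro closed_Collect_eq continuous_intros)+
  ultimately have "closed S" by auto
  moreover have "subspace S" by (simp add: subspace_def S_def apply_simps)
  ultimately obtain z where z: "is_proj z" "\<And>x. z x \<in> S" "\<And>x. x \<in> S \<Longrightarrow> z x = x"
    using ex_projection_onto by metis
  have inv: "z \<cdot> s \<cdot> z = s \<cdot> z" if "\<And>x. x \<in> S \<Longrightarrow> blinfun_apply s x \<in> S" for s
    by (rule blinfun_eqI) (simp add: z that)
  have ez: "e \<cdot> z = z" by (rule blinfun_eqI) (use z(2) in \<open>simp add: S_def\<close>)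
  have invM: "z \<cdot> a \<cdot> z = a \<cdot> z" if a: "a \<in> M" for a
  proof (rule inv)
    fix x assume x: "x \<in> S"
    have "q (blinfun_apply m (a x)) = 0" if "m \<in> M" for m
      using x mem_comp[OF that a] unfolding S_def by (force simp: blinfun_apply_blinfun_compose)
    moreover have "e (a x) = a x" using memD(2)[OF a] by (metis blinfun_apply_blinfun_compose)
    ultimately show "a x \<in> S" by (simp add: S_def)
  qed
  have zM: "z \<in> M"
  proof (rule mem_projI[OF z(1) ez])
    show "z \<cdot> iop \<cdot> z = iop \<cdot> z"
    proof (rule inv)
      fix x assume x: "x \<in> S"
      have i: "blinfun_apply a (iop x) = iop (a x)" if "a \<in> bounded_ops" for a
        using that by (simp add: bounded_ops_def)
      have "q (blinfun_apply m (iop x)) = iop (q (m x))" if "m \<in> M" for m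
        using i[OF memD(1)[OF mem_comp[OF q that]]] by simp
      then show "iop x \<in> S"
        using i[OF e_bounded] x by (simp add: S_def blinfun.zero_right del: iop_apply)
    qed
    fix s assume s: "s \<in> M'"
    show "z \<cdot> s \<cdot> z = s \<cdot> z"
    proof (rule inv)
      fix x assume x: "x \<in> S"
      have "q (blinfun_apply m (s x)) = s (q (m x))" if "m \<in> M" for m
        using commutantD[OF s mem_comp[OF q that]] by (metis blinfun_apply_blinfun_compose)
      moreover have "e (s x) = s x" using s by (metis commutant_iff blinfun_apply_blinfun_compose)
      ultimately show "s x \<in> S" using x by (simp add: S_def)
    qed
  qed
  moreover have "z \<in> M'"
    using memD[OF zM] projection_onto_commutes[OF z(1) invM invM[OF mem_radj]]
    by (simp add: commutant_iff)
  moreover have "z \<cdot> p = p"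
  proof (rule blinfun_eqI)
    fix x
    have "p x \<in> S"
      using orth memD(2)[OF p] unfolding S_def
      by (auto simp: comp_assoc_op simp flip: blinfun_apply_blinfun_compose)
    then show "(z \<cdot> p) x = p x" by (simp add: z)
  qed
  moreover have "q \<cdot> z = 0"
  proof (rule blinfun_eqI)
    fix x
    have "q (e (z x)) = 0" using z(2)[of x] mem_simps(1) unfolding S_def by blast
    then show "(q \<cdot> z) x = blinfun_apply 0 x"
      using memD(3)[OF q] by (metis blinfun_apply_blinfun_compose blinfun.zero_left)
  qed
  ultimately show ?thesis using that z(1) by (simp add: center_def)
qed

end

section \<open>Corners cut out by central projections\<close>

lemma corner_von_neumann_algebra:
  assumes M: "von_neumann_algebra \<one> M" and z: "is_proj z" "z \<in> center \<one> M"
  shows "von_neumann_algebra z {a \<in> M. z \<cdot> a = a}"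
proof -
  interpret vna \<one> M by (unfold_locales) (rule M)
  let ?N = "{a \<in> M. z \<cdot> a = a}"
  have zM: "z \<in> M" and zM': "z \<in> M'" using z(2) by (auto simp: center_def)
  have za: "z \<cdot> a = a \<cdot> z" if "a \<in> M" for a using commutantD[OF zM' that] .
  have zs: "z \<cdot> s = s \<cdot> z" if "s \<in> M'" for s using commutantD[OF that zM] by simp
  have N_iff: "T \<in> ops_on z \<longleftrightarrow> T \<in> bounded_ops \<and> z \<cdot> T = T \<and> T \<cdot> z = T" for T
    by (rule ops_on_iff[OF z(1)])
  have N_ops: "?N \<subseteq> ops_on z" using za memD(1) by (auto simp: N_iff)
  have "T \<in> ?N" if T: "T \<in> commutant z (commutant z ?N)" for T
  proof -
    have T1: "T \<in> bounded_ops" "z \<cdot> T = T" "T \<cdot> z = T" using T by (auto simp: commutant_def[of z "commutant z ?N"] N_iff)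
    have "T \<in> M"
    proof (rule memI)
      fix s assume s: "s \<in> M'"
      \<comment> \<open>An element \<open>s\<close> of the commutant is tested through
        \<open>z s\<close>, which commutes with the corner; \<open>T = z T = T z\<close> then
        carries the relation back to \<open>s\<close>.\<close>
      have "z \<cdot> s \<in> commutant z ?N"
        unfolding commutant_def N_iff
      proof (intro CollectI conjI ballI)
        show "z \<cdot> s \<in> bounded_ops" using s memD(1)[OF zM] by (simp add: commutant_iff)
        show "z \<cdot> (z \<cdot> s) = z \<cdot> s" by (simp add: comp_left_op[OF is_projD(1)[OF z(1)]])
        then show "z \<cdot> s \<cdot> z = z \<cdot> s" using zs[OF s] by (metis comp_assoc_op)
        fix a assume "a \<in> ?N"
        then show "z \<cdot> s \<cdot> a = a \<cdot> (z \<cdot> s)"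
          using zs[OF s] za[of a] commutantD[OF s, of a] by (metis (no_types, lifting) comp_assoc_op mem_Collect_eq)
      qed
      then have "T \<cdot> (z \<cdot> s) = z \<cdot> s \<cdot> T" using T by (auto simp: commutant_def[of z "commutant z ?N"])
      then show "s \<cdot> T = T \<cdot> s" using T1 zs[OF s] by (metis comp_assoc_op)
    qed (use T1 in auto)
    then show ?thesis using T1 by simp
  qed
  moreover have "a \<in> commutant z (commutant z ?N)" if "a \<in> ?N" for a
    using that N_ops unfolding commutant_def by auto
  moreover have "adj a \<in> ?N" if "a \<in> ?N" for a
  proof -
    have "(z \<cdot> a)\<^sup>\<star> = a\<^sup>\<star>" using that by simp
    then show ?thesis using that za[of "a\<^sup>\<star>"] by (simp add: adj_mem is_projD[OF z(1)])
  qed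
  ultimately show ?thesis
    using N_ops z(1) memD(1)[OF zM] unfolding von_neumann_algebra_def projection_iff by blast
qed

section \<open>$C^*$-extreme points are partial isometries\<close>

context vna
begin

lemma invertible_iff:
  "invertible_in e M t \<longleftrightarrow> t \<in> M \<and> (\<exists>s\<in>M. s \<cdot> t = e \<and> t \<cdot> s = e)"
  by (simp add: invertible_in_def)

lemma unitary_iff: "unitary_in e M u \<longleftrightarrow> u \<in> M \<and> u\<^sup>\<star> \<cdot> u = e \<and> u \<cdot> u\<^sup>\<star> = e"
  by (auto simp: unitary_in_def adj_mem)

lemma isometry_iff: "isometry_in e M u \<longleftrightarrow> u \<in> M \<and> u\<^sup>\<star> \<cdot> u = e"
  by (auto simp: isometry_in_def adj_mem)

lemma coisometry_iff: "coisometry_in e M u \<longleftrightarrow> u \<in> M \<and> u \<cdot> u\<^sup>\<star> = e"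
  by (auto simp: coisometry_in_def adj_mem)

end

lemma is_proj_unitary_conj:
  assumes "is_proj p" "u\<^sup>\<star> \<cdot> u = \<one>" shows "is_proj (u \<cdot> p \<cdot> u\<^sup>\<star>)"
  unfolding is_proj_def
  by (simp add: comp_assoc_op comp_left_op[OF assms(2)] comp_left_op[OF is_projD(1)[OF assms(1)]]
      is_projD[OF assms(1)])

lemma cstar_extreme_pointD:
  fixes k :: nat
  assumes x: "cstar_extreme_point e A x"
    and "\<And>i. i \<in> {1..k} \<Longrightarrow> y i \<in> closed_unit_ball A"
    and "\<And>i. i \<in> {1..k} \<Longrightarrow> invertible_in e A (t i)"
    and "(\<Sum>i=1..k. adj (t i) \<cdot> t i) = e"
    and "x = (\<Sum>i=1..k. adj (t i) \<cdot> y i \<cdot> t i)"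
  shows "\<exists>u. \<forall>i\<in>{1..k}. unitary_in e A (u i) \<and> y i = adj (u i) \<cdot> x \<cdot> u i"
  using conjunct2[OF x[unfolded cstar_extreme_point_def], THEN spec[of _ k], THEN spec[of _ y],
      THEN spec[of _ t]] assms(2-) by blast

lemma cstar_extreme_midpoint:
  assumes M: "von_neumann_algebra \<one> M" and x: "cstar_extreme_point \<one> M x"
    and y: "y \<in> M" "norm y \<le> 1" and z: "z \<in> M" "norm z \<le> 1" and eq: "x = (1/2) *\<^sub>R (y + z)"
  obtains u where "u \<in> M" "u\<^sup>\<star> \<cdot> u = \<one>" "u \<cdot> u\<^sup>\<star> = \<one>" "y = u\<^sup>\<star> \<cdot> x \<cdot> u"
proof -
  interpret vna \<one> M by (unfold_locales) (rule M)
  \<comment> \<open>Two equal coefficients \<open>1 / sqrt 2\<close> are invertible with squares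
    summing to the identity, so a midpoint is a C*-convex combination.\<close>
  define r :: real where "r = 1 / sqrt 2"
  have rr: "r * r = 1/2" by (simp add: r_def real_sqrt_mult[symmetric])
  define t where "t = (\<lambda>i::nat. r *\<^sub>R (\<one> :: 'a \<Rightarrow>\<^sub>L 'a))"
  define Y where "Y = (\<lambda>i::nat. if i = 1 then y else z)"
  have I: "{1..2::nat} = {1, 2}" by auto
  have tM: "t i \<in> M" for i by (simp add: t_def)
  have adj_t: "adj (t i) = t i" for i by (simp add: adj_mem[OF tM]) (simp add: t_def)
  have "invertible_in \<one> M (t i)" for i
    unfolding invertible_iff
  proof (intro conjI bexI[of _ "(1/r) *\<^sub>R \<one>"])
    have "r \<noteq> 0" by (simp add: r_def)
    then show "(1/r) *\<^sub>R \<one> \<cdot> t i = \<one>" "t i \<cdot> (1/r) *\<^sub>R \<one> = \<one>"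
      by (simp_all add: t_def op_distribs)
  qed (simp_all add: tM)
  moreover have "Y i \<in> closed_unit_ball M" for i
    using y z by (simp add: Y_def closed_unit_ball_def)
  moreover have "(\<Sum>i=1..2. adj (t i) \<cdot> t i) = \<one>"
    unfolding I adj_t by (simp add: t_def op_distribs rr flip: scaleR_left_distrib)
  moreover have "x = (\<Sum>i=1..2. adj (t i) \<cdot> Y i \<cdot> t i)"
    unfolding I adj_t by (simp add: t_def op_distribs rr eq Y_def scaleR_add_right)
  ultimately obtain u where "\<forall>i\<in>{1..2}. unitary_in \<one> M (u i) \<and> Y i = adj (u i) \<cdot> x \<cdot> u i"
    using cstar_extreme_pointD[OF x, of 2 Y t] by blast
  then have u: "unitary_in \<one> M (u 1)" "Y 1 = adj (u 1) \<cdot> x \<cdot> u 1" by (simp_all add: I)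
  have "y = adj (u 1) \<cdot> x \<cdot> u 1" using u(2) by (simp add: Y_def)
  then show ?thesis using that[of "u 1"] u(1) unfolding unitary_iff by (simp only: adj_mem)
qed

lemma unitary_conj_radj_comp:
  assumes u: "u \<cdot> u\<^sup>\<star> = \<one>" and y: "y = u\<^sup>\<star> \<cdot> x \<cdot> u"
  shows "x\<^sup>\<star> \<cdot> x = u \<cdot> (y\<^sup>\<star> \<cdot> y) \<cdot> u\<^sup>\<star>"
  unfolding y by (simp add: comp_assoc_op comp_left_op[OF u] u)

text \<open>The symmetry of \<open>x\<^sup>\<star> w\<close> makes the cross terms
  \<open>\<i> x\<^sup>\<star> w\<close> and \<open>- \<i> w\<^sup>\<star> x\<close> cancel.\<close>

lemma radj_comp_add_iop:
  assumes x: "x \<in> bounded_ops" and w: "w \<in> bounded_ops" and xw: "x\<^sup>\<star> \<cdot> w = w\<^sup>\<star> \<cdot> x"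
  shows "(x + iop \<cdot> w)\<^sup>\<star> \<cdot> (x + iop \<cdot> w) = x\<^sup>\<star> \<cdot> x + w\<^sup>\<star> \<cdot> w"
proof -
  have c: "x\<^sup>\<star> \<cdot> iop = iop \<cdot> x\<^sup>\<star>" "w\<^sup>\<star> \<cdot> iop = iop \<cdot> w\<^sup>\<star>"
    using bounded_ops_radj[OF x] bounded_ops_radj[OF w] by (simp_all add: bounded_ops_iff)
  show ?thesis
    by (simp add: op_simps iop_radj comp_left_op[OF c(1)] comp_left_op[OF c(2)] c xw
        comp_left_op[OF iop_iop])
qed

text \<open>With the polar decomposition \<open>x = v \<bar>x\<bar>\<close>, the operators \<open>x \<plusminus> i v (\<one> - x\<^sup>\<star> x)\<^sup>1\<^sup>/\<^sup>2\<close> are partial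
  isometries with midpoint \<open>x\<close>.\<close>

lemma cstar_extreme_partial_isometry:
  assumes M: "von_neumann_algebra \<one> M" and x: "cstar_extreme_point \<one> M x"
  shows "is_proj (x\<^sup>\<star> \<cdot> x)"
proof -
  interpret vna \<one> M by (unfold_locales) (rule M)
  have xM: "x \<in> M" and nx: "norm x \<le> 1"
    using x by (auto simp: cstar_extreme_point_def closed_unit_ball_def)
  define h where "h = x\<^sup>\<star> \<cdot> x"
  have hM: "h \<in> M" using xM by (simp add: h_def)
  have h: "pos_op h" "pos_op (\<one> - h)"
    unfolding h_def by (rule pos_op_radj_comp, rule pos_op_one_minus_radj_comp[OF nx])
  obtain s where s: "pos_op s" "s \<cdot> s = \<one> - h" and sc: "\<And>b. b \<cdot> h = h \<cdot> b \<Longrightarrow> b \<cdot> s = s \<cdot> b"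
    using ex_sqrt_compl[OF h] by blast
  have ss: "s\<^sup>\<star> = s" by (rule pos_opD(1)[OF s(1)])
  have sM: "s \<in> M"
  proof (rule memI)
    show "s \<in> bounded_ops"
      unfolding bounded_ops_iff by (rule sc) (use memD(1)[OF hM] in \<open>simp add: bounded_ops_iff\<close>)
    fix a assume "a \<in> M'"
    then show "a \<cdot> s = s \<cdot> a" by (intro sc commutantD hM)
  qed simp_all
  obtain v where vM: "v \<in> M" and E: "is_proj (v\<^sup>\<star> \<cdot> v)" and ker: "\<And>\<xi>. v \<xi> = 0 \<longleftrightarrow> x \<xi> = 0"
    and sym: "x\<^sup>\<star> \<cdot> v = v\<^sup>\<star> \<cdot> x"
    and comm: "\<And>b. b \<cdot> h = h \<cdot> b \<Longrightarrow> b \<cdot> (x\<^sup>\<star> \<cdot> v) = (x\<^sup>\<star> \<cdot> v) \<cdot> b"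
    unfolding h_def using ex_polar_mem[OF xM] by metis
  define E where "E = v\<^sup>\<star> \<cdot> v"
  have EP: "is_proj E" using E by (simp add: E_def)
  have v_zero: "v \<cdot> (\<one> - E) = 0" using partial_isometry_cancel(1)[OF E] by (simp add: E_def op_simps)
  have x_zero: "x \<cdot> (\<one> - E) = 0"
  proof (rule blinfun_eqI)
    fix \<xi>
    have "v ((\<one> - E) \<xi>) = 0" using v_zero by (metis blinfun.zero_left blinfun_apply_blinfun_compose)
    then show "(x \<cdot> (\<one> - E)) \<xi> = blinfun_apply 0 \<xi>" using ker by simp
  qed
  then have hE: "h \<cdot> E = h" by (simp add: h_def op_simps)
  have "(h \<cdot> E)\<^sup>\<star> = h\<^sup>\<star>" using hE by simp
  then have Eh: "E \<cdot> h = h" using h EP by (simp add: pos_opD is_projD)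
  have hs: "h \<cdot> s = s \<cdot> h" by (rule sc) simp
  \<comment> \<open>Commuting with \<open>h\<close>, the root \<open>s\<close> preserves the kernel
    of \<open>h\<close>, which is the kernel of \<open>v\<close> and the range of
    \<open>\<one> - E\<close>. By self-adjointness \<open>s\<close> then commutes with
    \<open>E\<close>.\<close>
  have "E \<cdot> s \<cdot> (\<one> - E) = 0"
  proof (rule blinfun_eqI)
    fix \<xi>
    have "(x\<^sup>\<star> \<cdot> x \<cdot> s \<cdot> (\<one> - E)) = s \<cdot> (x\<^sup>\<star> \<cdot> (x \<cdot> (\<one> - E)))"
      using hs unfolding h_def by (metis comp_assoc_op)
    then have "x\<^sup>\<star> \<cdot> x \<cdot> s \<cdot> (\<one> - E) = 0" by (simp add: x_zero)
    then have "(x\<^sup>\<star> \<cdot> x) (s ((\<one> - E) \<xi>)) = 0"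
      by (metis blinfun.zero_left blinfun_apply_blinfun_compose)
    then have "v (s ((\<one> - E) \<xi>)) = 0" by (simp only: partial_isometry_kernel ker)
    then show "(E \<cdot> s \<cdot> (\<one> - E)) \<xi> = blinfun_apply 0 \<xi>" by (simp add: E_def)
  qed
  then have EsE: "E \<cdot> s = E \<cdot> s \<cdot> E" by (simp only: op_distribs id_comp_op right_minus_eq)
  have "s \<cdot> E = (E \<cdot> s)\<^sup>\<star>" using EP ss by (simp add: is_projD)
  also have "\<dots> = (E \<cdot> s \<cdot> E)\<^sup>\<star>" by (rule arg_cong[OF EsE])
  also have "\<dots> = E \<cdot> s \<cdot> E" using EP ss by (simp add: is_projD comp_assoc_op)
  finally have sE: "s \<cdot> E = E \<cdot> s" by (simp only: EsE[symmetric])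
  define w where "w = v \<cdot> s"
  have wM: "w \<in> M" using vM sM by (simp add: w_def)
  have "s \<cdot> (x\<^sup>\<star> \<cdot> v) = (x\<^sup>\<star> \<cdot> v) \<cdot> s" by (rule comm) (simp add: hs)
  then have xw: "x\<^sup>\<star> \<cdot> w = w\<^sup>\<star> \<cdot> x" by (simp add: w_def ss comp_assoc_op sym comp_left_op[OF sym])
  have "w\<^sup>\<star> \<cdot> w = s \<cdot> E \<cdot> s" by (simp add: w_def ss E_def comp_assoc_op)
  also have "\<dots> = E - h" by (simp add: sE comp_assoc_op s op_distribs Eh)
  \<comment> \<open>Exactly the missing part:
    \<open>x\<^sup>\<star> x + w\<^sup>\<star> w = h + (E - h) = E\<close> is a projection.\<close>
  finally have ww: "w\<^sup>\<star> \<cdot> w = E - h" .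
  have yy: "(x + iop \<cdot> w)\<^sup>\<star> \<cdot> (x + iop \<cdot> w) = E"
    using radj_comp_add_iop[OF memD(1)[OF xM] memD(1)[OF wM] xw] by (simp add: ww h_def)
  have zz: "(x - iop \<cdot> w)\<^sup>\<star> \<cdot> (x - iop \<cdot> w) = E"
  proof -
    have "- w \<in> bounded_ops" using memD(1)[OF wM] by (simp add: bounded_ops_iff op_distribs)
    from radj_comp_add_iop[OF memD(1)[OF xM] this] xw show ?thesis by (simp add: op_distribs ww h_def)
  qed
  obtain u where u: "u \<in> M" "u\<^sup>\<star> \<cdot> u = \<one>" "u \<cdot> u\<^sup>\<star> = \<one>" "x + iop \<cdot> w = u\<^sup>\<star> \<cdot> x \<cdot> u"
  proof (rule cstar_extreme_midpoint[OF M x])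
    show "x + iop \<cdot> w \<in> M" "x - iop \<cdot> w \<in> M" using xM wM by simp_all
    show "norm (x + iop \<cdot> w) \<le> 1" "norm (x - iop \<cdot> w) \<le> 1"
      by (rule norm_le_one_if_radj_comp_proj, simp only: yy zz EP)+
    show "x = (1/2) *\<^sub>R ((x + iop \<cdot> w) + (x - iop \<cdot> w))" by (simp add: scaleR_2[symmetric])
  qed
  show ?thesis
    unfolding unitary_conj_radj_comp[OF u(3,4)] yy by (rule is_proj_unitary_conj[OF EP u(2)])
qed

text \<open>Otherwise a nonzero \<open>c\<close> of the form \<open>(\<one> - x x\<^sup>\<star>) m (\<one> - x\<^sup>\<star> x)\<close> gives \<open>x\<close> as the midpoint of
  \<open>x \<plusminus> c\<close>; these are partial isometries, so \<open>c\<^sup>\<star> c\<close> is a projection, for \<open>c\<close> and for \<open>c/2\<close>.\<close>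

lemma cstar_extreme_defect:
  assumes M: "von_neumann_algebra \<one> M" and x: "cstar_extreme_point \<one> M x" and m: "m \<in> M"
  shows "(\<one> - x \<cdot> x\<^sup>\<star>) \<cdot> m \<cdot> (\<one> - x\<^sup>\<star> \<cdot> x) = 0"
proof -
  interpret vna \<one> M by (unfold_locales) (rule M)
  have xM: "x \<in> M" and nx: "norm x \<le> 1"
    using x by (auto simp: cstar_extreme_point_def closed_unit_ball_def)
  have E: "is_proj (x\<^sup>\<star> \<cdot> x)" by (rule cstar_extreme_partial_isometry[OF M x])
  note pc = partial_isometry_cancel[OF E]
  define P where "P = \<one> - x\<^sup>\<star> \<cdot> x"
  have PP: "is_proj P" unfolding P_def by (rule is_proj_compl[OF E])
  have xP: "x \<cdot> P = 0" using pc(1) by (simp add: P_def op_simps)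
  \<comment> \<open>For such \<open>c\<close> both \<open>x + c\<close> and \<open>x - c\<close> are
    contractions, so \<open>x\<^sup>\<star> x + c\<^sup>\<star> c\<close> is unitarily conjugate to
    the projection \<open>x\<^sup>\<star> x\<close>. The two summands annihilate each other and the
    first is idempotent, hence so is the second.\<close>
  have idem: "c\<^sup>\<star> \<cdot> c \<cdot> (c\<^sup>\<star> \<cdot> c) = c\<^sup>\<star> \<cdot> c"
    if cM: "c \<in> M" and nc: "norm c \<le> 1" and xc: "x\<^sup>\<star> \<cdot> c = 0" and cP: "c \<cdot> P = c" for c
  proof -
    have "(x\<^sup>\<star> \<cdot> c)\<^sup>\<star> = 0" using xc by simp
    then have cx: "c\<^sup>\<star> \<cdot> x = 0" by simp
    have sq: "(x + c)\<^sup>\<star> \<cdot> (x + c) = x\<^sup>\<star> \<cdot> x + c\<^sup>\<star> \<cdot> c" "(x - c)\<^sup>\<star> \<cdot> (x - c) = x\<^sup>\<star> \<cdot> x + c\<^sup>\<star> \<cdot> c"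
      by (simp_all add: op_distribs xc cx)
    have bd: "norm d \<le> 1" if d: "d\<^sup>\<star> \<cdot> d = x\<^sup>\<star> \<cdot> x + c\<^sup>\<star> \<cdot> c" for d
    proof (rule norm_blinfun_bound)
      fix \<xi>
      have "(norm (c \<xi>))\<^sup>2 \<le> (norm (P \<xi>))\<^sup>2"
      proof -
        have "c \<xi> = c (P \<xi>)" using cP by (metis blinfun_apply_blinfun_compose)
        then have "norm (c \<xi>) \<le> norm c * norm (P \<xi>)" by (simp add: norm_blinfun)
        also have "\<dots> \<le> 1 * norm (P \<xi>)" by (intro mult_right_mono nc) simp
        finally show ?thesis by simp
      qed
      moreover have "(norm (P \<xi>))\<^sup>2 = inner \<xi> \<xi> - (norm (x \<xi>))\<^sup>2"
        unfolding norm_apply_sq by (simp only: is_projD[OF PP]) (simp add: P_def apply_simps inner_diff)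
      moreover have "(norm (d \<xi>))\<^sup>2 = (norm (x \<xi>))\<^sup>2 + (norm (c \<xi>))\<^sup>2"
        unfolding norm_apply_sq d by (simp add: apply_simps inner_add)
      ultimately have "(norm (d \<xi>))\<^sup>2 \<le> inner \<xi> \<xi>" by linarith
      then show "norm (d \<xi>) \<le> 1 * norm \<xi>" by (simp add: norm_le power2_norm_eq_inner)
    qed simp
    obtain u where u: "u \<in> M" "u\<^sup>\<star> \<cdot> u = \<one>" "u \<cdot> u\<^sup>\<star> = \<one>" "x + c = u\<^sup>\<star> \<cdot> x \<cdot> u"
      by (rule cstar_extreme_midpoint[OF M x, of "x + c" "x - c"])
        (use xM cM bd sq in \<open>simp_all add: scaleR_2[symmetric]\<close>)
    have "(x + c)\<^sup>\<star> \<cdot> (x + c) = u\<^sup>\<star> \<cdot> (x\<^sup>\<star> \<cdot> x) \<cdot> u"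
      unfolding u(4) by (simp add: comp_assoc_op comp_left_op[OF u(3)])
    moreover have "is_proj (u\<^sup>\<star> \<cdot> (x\<^sup>\<star> \<cdot> x) \<cdot> u)"
      using is_proj_unitary_conj[OF E, of "u\<^sup>\<star>"] u(3) by simp
    ultimately have pr: "is_proj (x\<^sup>\<star> \<cdot> x + c\<^sup>\<star> \<cdot> c)" by (simp only: sq)
    have "c \<cdot> (x\<^sup>\<star> \<cdot> x) = 0" using cP by (simp add: P_def op_distribs)
    then have cE: "c \<cdot> x\<^sup>\<star> \<cdot> x = 0" by (simp add: comp_assoc_op)
    have "(c \<cdot> (x\<^sup>\<star> \<cdot> x))\<^sup>\<star> = 0" using cE by (simp add: comp_assoc_op)
    then have Ec: "x\<^sup>\<star> \<cdot> x \<cdot> c\<^sup>\<star> = 0" by simp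
    have "c\<^sup>\<star> \<cdot> c \<cdot> (x\<^sup>\<star> \<cdot> x) = 0" using cE by (simp add: comp_assoc_op)
    moreover have "x\<^sup>\<star> \<cdot> x \<cdot> (c\<^sup>\<star> \<cdot> c) = 0"
      using Ec by (simp add: comp_assoc_op[symmetric])
    ultimately show ?thesis using is_projD(1)[OF pr] is_projD(1)[OF E] by (simp add: op_distribs)
  qed
  define b where "b = (\<one> - x \<cdot> x\<^sup>\<star>) \<cdot> m \<cdot> (\<one> - x\<^sup>\<star> \<cdot> x)"
  define r where "r = 1 / (norm b + 1)"
  define c where "c = r *\<^sub>R b"
  have pos: "norm b + 1 > 0" using norm_ge_zero[of b] by linarith
  have bM: "b \<in> M" using xM m mem_simps(1) by (simp add: b_def del: mem_simps(1))
  have c: "c \<in> M" "norm c \<le> 1"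
    using bM pos by (auto simp: c_def r_def field_simps)
  have "x\<^sup>\<star> \<cdot> (\<one> - x \<cdot> x\<^sup>\<star>) = 0" using pc(3) by (simp add: op_simps)
  then have "x\<^sup>\<star> \<cdot> b = 0" by (simp add: b_def comp_assoc_op[symmetric])
  then have xc: "x\<^sup>\<star> \<cdot> c = 0" by (simp add: c_def op_distribs)
  have "b \<cdot> P = b" by (simp add: b_def P_def[symmetric] comp_assoc_op is_projD[OF PP])
  then have cP: "c \<cdot> P = c" by (simp add: c_def op_distribs)
  have 1: "c\<^sup>\<star> \<cdot> c \<cdot> (c\<^sup>\<star> \<cdot> c) = c\<^sup>\<star> \<cdot> c" by (rule idem[OF c xc cP])
  have "((1/2) *\<^sub>R c)\<^sup>\<star> \<cdot> ((1/2) *\<^sub>R c) \<cdot> (((1/2) *\<^sub>R c)\<^sup>\<star> \<cdot> ((1/2) *\<^sub>R c))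
      = ((1/2) *\<^sub>R c)\<^sup>\<star> \<cdot> ((1/2) *\<^sub>R c)"
    by (rule idem) (use c xc cP in \<open>simp_all add: op_distribs\<close>)
  \<comment> \<open>Halving \<open>c\<close> multiplies \<open>c\<^sup>\<star> c\<close> by 1/4 but
    its square by 1/16, so both can be idempotent only if it vanishes.\<close>
  then have "(1/16) *\<^sub>R (c\<^sup>\<star> \<cdot> c \<cdot> (c\<^sup>\<star> \<cdot> c)) = (1/4) *\<^sub>R (c\<^sup>\<star> \<cdot> c)" by (simp add: op_distribs)
  then have "(1/16) *\<^sub>R (c\<^sup>\<star> \<cdot> c) = (1/4) *\<^sub>R (c\<^sup>\<star> \<cdot> c)" unfolding 1 .
  then have "c\<^sup>\<star> \<cdot> c = 0" by (simp add: scaleR_cancel_right)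
  then have "c = 0" by (simp only: radj_comp_self_eq_0_iff)
  then show ?thesis using pos by (simp add: c_def r_def flip: b_def)
qed

section \<open>Finite algebras and factors\<close>

text \<open>The projection \<open>v v\<^sup>\<star>\<close> is equivalent to \<open>f\<close> and
  lies below it.\<close>

lemma finite_vna_isometry:
  assumes fin: "finite_vna f N" and v: "v \<in> N" "v\<^sup>\<star> \<cdot> v = f"
  shows "v \<cdot> v\<^sup>\<star> = f"
proof -
  interpret vna f N using fin by (unfold_locales) (simp add: finite_vna_def)
  have "is_proj (v \<cdot> v\<^sup>\<star>)" by (rule partial_isometry_cancel) (simp add: v e_proj)
  then have "projection (v \<cdot> v\<^sup>\<star>)" using v memD(1)[of "v \<cdot> v\<^sup>\<star>"] by (simp add: projection_iff)
  moreover have "mvn_equiv N f (v \<cdot> v\<^sup>\<star>)" unfolding mvn_equiv_def using v by (auto simp: adj_mem)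
  moreover have "f \<cdot> (v \<cdot> v\<^sup>\<star>) = v \<cdot> v\<^sup>\<star>" by (rule memD(2)) (use v in simp)
  ultimately show ?thesis using fin v by (simp add: finite_vna_def finite_projection_def)
qed

text \<open>A central \<open>z\<close> carries the defect \<open>f - x\<^sup>\<star> x\<close> and
  is annihilated by the other one, so \<open>x\<close> is a coisometry under \<open>z\<close>.
  Extended by the identity and replaced by its adjoint, it becomes an isometry \<open>w\<close>,
  which finiteness makes unitary; the defect then vanishes under \<open>z\<close>, hence
  altogether.\<close>

lemma finite_vna_defect:
  assumes fin: "finite_vna f N" and x: "x \<in> N"
    and orth: "\<And>m. m \<in> N \<Longrightarrow> (f - x \<cdot> x\<^sup>\<star>) \<cdot> m \<cdot> (f - x\<^sup>\<star> \<cdot> x) = 0"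
  shows "x\<^sup>\<star> \<cdot> x = f"
proof -
  interpret vna f N using fin by (unfold_locales) (simp add: finite_vna_def)
  obtain z where z: "is_proj z" "z \<in> center f N" "z \<cdot> (f - x\<^sup>\<star> \<cdot> x) = f - x\<^sup>\<star> \<cdot> x"
    "(f - x \<cdot> x\<^sup>\<star>) \<cdot> z = 0"
    by (rule ex_central_projection[OF _ _ orth]) (use x in simp_all)
  have zN: "z \<in> N" and zc: "\<And>a. a \<in> N \<Longrightarrow> a \<cdot> z = z \<cdot> a"
    using z(2) commutantD by (auto simp: center_def)
  define w where "w = (x \<cdot> z + (f - z))\<^sup>\<star>"
  have [simp]: "f\<^sup>\<star> = f" "z\<^sup>\<star> = z" "f \<cdot> f = f" "z \<cdot> z = z"
    using z(1) e_proj by (simp_all add: is_projD)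
  note xs = memD[OF x] memD[OF mem_radj[OF x]] memD[OF zN]
  note xl = xs(2,3,6,7,10,11)[THEN comp_left_op]
  note xc = zc[OF x] zc[OF mem_radj[OF x]]
  have [simp]: "z \<cdot> (z \<cdot> a) = z \<cdot> a" "f \<cdot> (f \<cdot> a) = f \<cdot> a" for a by (simp_all flip: comp_assoc_op)
  have "x \<cdot> x\<^sup>\<star> \<cdot> z = z" using z(4) by (simp add: op_distribs xs)
  then have xxz: "z \<cdot> (x \<cdot> x\<^sup>\<star>) = z" using zc[of "x \<cdot> x\<^sup>\<star>"] x by simp
  have "w\<^sup>\<star> \<cdot> w = f"
    by (simp add: w_def op_simps xs xc xxz comp_left_op[OF xc(1)] comp_left_op[OF xc(2)] xl)
  moreover have "w \<in> N" using x zN by (simp add: w_def)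
  ultimately have "w \<cdot> w\<^sup>\<star> = f" using finite_vna_isometry[OF fin] by blast
  moreover have "w \<cdot> w\<^sup>\<star> = z \<cdot> (x\<^sup>\<star> \<cdot> x) + (f - z)"
    by (simp add: w_def op_simps xs xc comp_left_op[OF xc(1)] comp_left_op[OF xc(2)] xl)
  ultimately have "z \<cdot> (x\<^sup>\<star> \<cdot> x) = z" by simp
  then show ?thesis using z(3) by (simp add: op_distribs xs)
qed

text \<open>The separating central projection is a scalar multiple of \<open>g\<close>: scalar
  \<open>0\<close> kills \<open>p\<close>, a nonzero scalar kills \<open>q\<close>.\<close>

lemma factor_prime:
  assumes fac: "factor g L" and pq: "p \<in> L" "q \<in> L"
    and orth: "\<And>m. m \<in> L \<Longrightarrow> q \<cdot> m \<cdot> p = 0"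
  shows "p = 0 \<or> q = 0"
proof -
  interpret vna g L using fac by (unfold_locales) (simp add: factor_def)
  obtain z where z: "is_proj z" "z \<in> center g L" "z \<cdot> p = p" "q \<cdot> z = 0"
    using ex_central_projection[OF pq orth] by blast
  then obtain c where c: "\<And>x. z x = scaleC c (g x)" using fac by (auto simp: factor_def)
  show ?thesis
  proof (cases "c = 0")
    case True
    have "scaleC 0 y = 0" for y :: 'a using scaleC_of_real[of 0 y] by simp
    then have "z = 0" using c True by (intro blinfun_eqI) simp
    then show ?thesis using z(3) by simp
  next
    case False
    have "q x = 0" for x
    proof -
      have "q (g x) = q x" using memD(3)[OF pq(2)] by (metis blinfun_apply_blinfun_compose)
      moreover have "q (z x) = 0" using z(4) by (metis blinfun.zero_left blinfun_apply_blinfun_compose)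
      ultimately have "scaleC c (q x) = 0"
        using memD(1)[OF pq(2)] by (simp add: c bounded_ops_def)
      then have "scaleC (inverse c) (scaleC c (q x)) = 0"
        using scaleC_eq[of "inverse c" "0::'a"] scaleC_eq[of "\<i>" "0::'a"]
        by (metis add.right_neutral iop_apply blinfun.zero_right scaleR_zero_right)
      then show ?thesis using False by (simp add: scaleC_scaleC scaleC_one)
    qed
    then show ?thesis by (intro disjI2 blinfun_eqI) simp
  qed
qed

text \<open>Products across the two summands vanish, so the defect identity splits into one for each
  summand.\<close>

lemma cstar_extreme_direct_sum:
  assumes M: "von_neumann_algebra \<one> M" and x: "cstar_extreme_point \<one> M x"
    and sum: "is_direct_sum \<one> M f N g L" and fin: "finite_vna f N" and fac: "factor g L"
  shows "isometry_in \<one> M x \<or> coisometry_in \<one> M x"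
proof -
  interpret vna \<one> M by (unfold_locales) (rule M)
  interpret N: vna f N using fin by (unfold_locales) (simp add: finite_vna_def)
  interpret L: vna g L using fac by (unfold_locales) (simp add: factor_def)
  have xM: "x \<in> M" using x by (simp add: cstar_extreme_point_def closed_unit_ball_def)
  have fg: "f \<cdot> g = 0" and one: "\<one> = f + g" and M_eq: "M = {a + b | a b. a \<in> N \<and> b \<in> L}"
    using sum by (auto simp: is_direct_sum_def)
  have "(f \<cdot> g)\<^sup>\<star> = 0" using fg by simp
  then have gf: "g \<cdot> f = 0" using N.e_proj L.e_proj by (simp add: is_projD)
  have NL: "a \<cdot> b = 0" if "a \<in> N" "b \<in> L" for a b
  proof -
    have "a \<cdot> b = a \<cdot> (f \<cdot> g) \<cdot> b"
      using N.memD(3)[OF that(1)] L.memD(2)[OF that(2)] by (metis comp_assoc_op)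
    then show ?thesis by (simp add: fg)
  qed
  have LN: "b \<cdot> a = 0" if "a \<in> N" "b \<in> L" for a b
  proof -
    have "b \<cdot> a = b \<cdot> (g \<cdot> f) \<cdot> a"
      using N.memD(2)[OF that(1)] L.memD(3)[OF that(2)] by (metis comp_assoc_op)
    then show ?thesis by (simp add: gf)
  qed
  obtain a b where ab: "x = a + b" "a \<in> N" "b \<in> L" using xM M_eq by auto
  define p1 q1 p2 q2 where defs: "p1 = f - a\<^sup>\<star> \<cdot> a" "q1 = f - a \<cdot> a\<^sup>\<star>" "p2 = g - b\<^sup>\<star> \<cdot> b" "q2 = g - b \<cdot> b\<^sup>\<star>"
  have mem: "p1 \<in> N" "q1 \<in> N" "p2 \<in> L" "q2 \<in> L" using ab by (simp_all add: defs)
  have p: "\<one> - x\<^sup>\<star> \<cdot> x = p1 + p2" and q: "\<one> - x \<cdot> x\<^sup>\<star> = q1 + q2"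
    using ab NL LN by (simp_all add: op_distribs defs one)
  have "q1 \<cdot> m \<cdot> p1 = 0" if m: "m \<in> N" for m
  proof -
    have "m + 0 \<in> M" unfolding M_eq using m L.mem_simps(2) by blast
    then have "(q1 + q2) \<cdot> m \<cdot> (p1 + p2) = 0"
      using cstar_extreme_defect[OF M x] p q by simp
    moreover have "m \<cdot> p2 = 0" "q2 \<cdot> m = 0" using NL LN m mem by auto
    ultimately show ?thesis by (simp add: op_simps)
  qed
  then have aa: "a\<^sup>\<star> \<cdot> a = f" unfolding defs by (rule finite_vna_defect[OF fin ab(2)])
  then have aa': "a \<cdot> a\<^sup>\<star> = f" by (rule finite_vna_isometry[OF fin ab(2)])
  have "q2 \<cdot> m \<cdot> p2 = 0" if m: "m \<in> L" for m
  proof -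
    have "0 + m \<in> M" unfolding M_eq using m N.mem_simps(2) by blast
    then have "(q1 + q2) \<cdot> m \<cdot> (p1 + p2) = 0"
      using cstar_extreme_defect[OF M x] p q by simp
    moreover have "m \<cdot> p1 = 0" "q1 \<cdot> m = 0" using NL LN m mem by auto
    ultimately show ?thesis by (simp add: op_simps)
  qed
  then have "p2 = 0 \<or> q2 = 0" by (rule factor_prime[OF fac mem(3,4)])
  then have "\<one> - x\<^sup>\<star> \<cdot> x = 0 \<or> \<one> - x \<cdot> x\<^sup>\<star> = 0"
    unfolding p q by (auto simp: defs aa aa')
  then show ?thesis using xM by (auto simp: isometry_iff coisometry_iff)
qed

lemma cstar_extreme_factor:
  assumes M: "von_neumann_algebra \<one> M" and x: "cstar_extreme_point \<one> M x" and fac: "factor \<one> M"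
  shows "isometry_in \<one> M x \<or> coisometry_in \<one> M x"
proof -
  interpret vna \<one> M by (unfold_locales) (rule M)
  have xM: "x \<in> M" using x by (simp add: cstar_extreme_point_def closed_unit_ball_def)
  have "\<one> - x\<^sup>\<star> \<cdot> x = 0 \<or> \<one> - x \<cdot> x\<^sup>\<star> = 0"
    by (rule factor_prime[OF fac _ _ cstar_extreme_defect[OF M x]]) (use xM in simp_all)
  then show ?thesis using xM by (auto simp: isometry_iff coisometry_iff)
qed

lemma cstar_extreme_finite:
  assumes M: "von_neumann_algebra \<one> M" and x: "cstar_extreme_point \<one> M x" and fin: "finite_vna \<one> M"
  shows "isometry_in \<one> M x"
proof -
  interpret vna \<one> M by (unfold_locales) (rule M)
  have xM: "x \<in> M" using x by (simp add: cstar_extreme_point_def closed_unit_ball_def)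
  then show ?thesis
    unfolding isometry_iff using finite_vna_defect[OF fin xM cstar_extreme_defect[OF M x]] by blast
qed

section \<open>Isometries are $C^*$-extreme points\<close>

subsection \<open>Wold decomposition\<close>

text \<open>The sum of \<open>y^k v (x\<^sup>\<star>)^k\<close> over \<open>k < n\<close>, where
  \<open>v\<close> maps the wandering subspace of \<open>x\<close> onto that of \<open>y\<close>;
  the \<open>k\<close>-th term maps the \<open>k\<close>-th shifted copy of the one to that of the
  other.\<close>

primrec wold :: "('h::{real_inner,complete_space} \<Rightarrow>\<^sub>L 'h) \<Rightarrow> ('h \<Rightarrow>\<^sub>L 'h) \<Rightarrow> ('h \<Rightarrow>\<^sub>L 'h) \<Rightarrow> nat \<Rightarrow> ('h \<Rightarrow>\<^sub>L 'h)" where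
  "wold v x y 0 = 0"
| "wold v x y (Suc n) = v + y \<cdot> wold v x y n \<cdot> x\<^sup>\<star>"

text \<open>For an isometry \<open>x\<close> this is \<open>x^n (x\<^sup>\<star>)^n\<close>, the
  projection onto the range of \<open>x^n\<close>.\<close>

primrec range_proj :: "('h::{real_inner,complete_space} \<Rightarrow>\<^sub>L 'h) \<Rightarrow> nat \<Rightarrow> ('h \<Rightarrow>\<^sub>L 'h)" where
  "range_proj x 0 = \<one>"
| "range_proj x (Suc n) = x \<cdot> range_proj x n \<cdot> x\<^sup>\<star>"

lemma wold_radj: "(wold v x y n)\<^sup>\<star> = wold (v\<^sup>\<star>) y x n"
  by (induction n) (simp_all add: comp_assoc_op)

lemma is_proj_range_proj: "x\<^sup>\<star> \<cdot> x = \<one> \<Longrightarrow> is_proj (range_proj x n)"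
proof (induction n)
  case (Suc n)
  then show ?case using is_proj_unitary_conj[of "range_proj x n" x] by simp
qed simp

text \<open>The initial space of \<open>v\<close> is the complement of the range of
  \<open>x\<close>.\<close>

lemma wold_cross:
  assumes x: "x\<^sup>\<star> \<cdot> x = \<one>" and vv: "v\<^sup>\<star> \<cdot> v = \<one> - x \<cdot> x\<^sup>\<star>"
  shows "v \<cdot> x = 0"
proof -
  have "(v \<cdot> x)\<^sup>\<star> \<cdot> (v \<cdot> x) = x\<^sup>\<star> \<cdot> (v\<^sup>\<star> \<cdot> v) \<cdot> x" by (simp add: comp_assoc_op)
  also have "\<dots> = 0" by (simp add: vv op_simps x comp_left_op[OF x])
  finally show ?thesis by (simp only: radj_comp_self_eq_0_iff)
qed

text \<open>The terms have mutually orthogonal initial and final spaces, and the initial spaces fill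
  the complement of the range of \<open>x^n\<close>.\<close>

lemma wold_gram:
  assumes x: "x\<^sup>\<star> \<cdot> x = \<one>" and y: "y\<^sup>\<star> \<cdot> y = \<one>"
    and v: "v\<^sup>\<star> \<cdot> v = \<one> - x \<cdot> x\<^sup>\<star>" "v \<cdot> v\<^sup>\<star> = \<one> - y \<cdot> y\<^sup>\<star>"
  shows "(wold v x y n)\<^sup>\<star> \<cdot> wold v x y n = \<one> - range_proj x n"
proof (induction n)
  case (Suc n)
  let ?W = "wold v x y n"
  have vy: "v\<^sup>\<star> \<cdot> y = 0" by (rule wold_cross[OF y]) (simp add: v)
  have "(v\<^sup>\<star> \<cdot> y)\<^sup>\<star> = 0" using vy by simp
  then have yv: "y\<^sup>\<star> \<cdot> v = 0" by simp
  have "(wold v x y (Suc n))\<^sup>\<star> \<cdot> wold v x y (Suc n) = v\<^sup>\<star> \<cdot> v + x \<cdot> (?W\<^sup>\<star> \<cdot> ?W) \<cdot> x\<^sup>\<star>"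
    by (simp add: op_simps yv vy comp_left_op[OF vy] comp_left_op[OF yv] comp_left_op[OF y])
  then show ?case unfolding Suc v by (simp add: op_simps)
qed simp

text \<open>The difference is \<open>y^n W (x\<^sup>\<star>)^n\<close> with \<open>W\<close> the
  partial sum of length \<open>k\<close>; an induction step adds one factor on each side.\<close>

lemma wold_diff_gram:
  assumes x: "x\<^sup>\<star> \<cdot> x = \<one>" and y: "y\<^sup>\<star> \<cdot> y = \<one>"
    and v: "v\<^sup>\<star> \<cdot> v = \<one> - x \<cdot> x\<^sup>\<star>" "v \<cdot> v\<^sup>\<star> = \<one> - y \<cdot> y\<^sup>\<star>"
  shows "(wold v x y (n + k) - wold v x y n)\<^sup>\<star> \<cdot> (wold v x y (n + k) - wold v x y n)
    = range_proj x n - range_proj x (n + k)"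
proof (induction n)
  case 0
  then show ?case using wold_gram[OF assms, of k] by simp
next
  case (Suc n)
  let ?D = "wold v x y (n + k) - wold v x y n"
  have "wold v x y (Suc n + k) - wold v x y (Suc n) = y \<cdot> ?D \<cdot> x\<^sup>\<star>"
    by (simp add: op_distribs)
  then have "(wold v x y (Suc n + k) - wold v x y (Suc n))\<^sup>\<star> \<cdot> (wold v x y (Suc n + k) - wold v x y (Suc n))
      = x \<cdot> (?D\<^sup>\<star> \<cdot> ?D) \<cdot> x\<^sup>\<star>"
    by (simp only: radj_comp radj_radj comp_assoc_op comp_left_op[OF y] id_comp_op)
  then show ?case unfolding Suc by (simp add: op_simps)
qed

lemma wold_limit:
  assumes x: "x\<^sup>\<star> \<cdot> x = \<one>" and y: "y\<^sup>\<star> \<cdot> y = \<one>"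
    and v: "v\<^sup>\<star> \<cdot> v = \<one> - x \<cdot> x\<^sup>\<star>" "v \<cdot> v\<^sup>\<star> = \<one> - y \<cdot> y\<^sup>\<star>"
  shows "norm (wold v x y n) \<le> 1" "\<exists>W. strong_lim (wold v x y) W"
proof -
  have nW: "norm (wold v x y n) \<le> 1" for n
    by (rule norm_le_one_if_radj_comp_proj)
      (simp only: wold_gram[OF assms] is_proj_compl is_proj_range_proj[OF x])
  then show "norm (wold v x y n) \<le> 1" .
  have "convergent (\<lambda>n. wold v x y n \<xi>)" for \<xi>
  proof (rule increment_Cauchy)
    fix m n :: nat assume "m \<le> n"
    then obtain k where n: "n = m + k" using le_Suc_ex by blast
    have "(dist (wold v x y n \<xi>) (wold v x y m \<xi>))\<^sup>2 = (norm ((wold v x y n - wold v x y m) \<xi>))\<^sup>2"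
      by (simp add: dist_norm apply_simps)
    also have "\<dots> = (norm (wold v x y n \<xi>))\<^sup>2 - (norm (wold v x y m \<xi>))\<^sup>2"
      unfolding norm_apply_sq n wold_diff_gram[OF assms] wold_gram[OF assms]
      by (simp add: apply_simps inner_diff)
    finally show "(dist (wold v x y n \<xi>) (wold v x y m \<xi>))\<^sup>2
        \<le> (norm (wold v x y n \<xi>))\<^sup>2 - (norm (wold v x y m \<xi>))\<^sup>2" by simp
  next
    fix n
    have "norm (wold v x y n \<xi>) \<le> norm \<xi>"
      using norm_blinfun[of "wold v x y n" \<xi>] mult_right_mono[OF nW norm_ge_zero, of n \<xi>] by simp
    then show "(norm (wold v x y n \<xi>))\<^sup>2 \<le> (norm \<xi>)\<^sup>2" by simp
  qed
  from strong_limI[OF this nW] show "\<exists>W. strong_lim (wold v x y) W" by blast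
qed

text \<open>\<open>R\<close> projects onto the intersection of the ranges of all \<open>y^n\<close>.
  Iterating \<open>t Q = y (t Q x\<^sup>\<star>)\<close> shows that \<open>t\<close> maps the range
  of \<open>Q\<close> into it.\<close>

lemma range_proj_limit_intertwine:
  assumes y: "y\<^sup>\<star> \<cdot> y = \<one>" and yt: "y \<cdot> t = t \<cdot> x" and Q: "x \<cdot> Q \<cdot> x\<^sup>\<star> = Q"
    and R: "strong_lim (range_proj y) R"
  shows "R \<cdot> (t \<cdot> Q) = t \<cdot> Q"
proof -
  have tQ: "t \<cdot> Q = y \<cdot> (t \<cdot> Q \<cdot> x\<^sup>\<star>)"
    using Q yt by (metis comp_assoc_op)
  have "range_proj y n \<cdot> (t \<cdot> Q) = t \<cdot> Q" for n
  proof (induction n)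
    case (Suc n)
    have "y\<^sup>\<star> \<cdot> (t \<cdot> Q) = t \<cdot> Q \<cdot> x\<^sup>\<star>" by (subst tQ) (simp add: comp_left_op[OF y])
    then have "range_proj y (Suc n) \<cdot> (t \<cdot> Q) = y \<cdot> (range_proj y n \<cdot> (t \<cdot> Q) \<cdot> x\<^sup>\<star>)"
      by (simp add: comp_assoc_op)
    also have "\<dots> = t \<cdot> Q" unfolding Suc by (rule tQ[symmetric])
    finally show ?case .
  qed simp
  then have "strong_lim (\<lambda>n. t \<cdot> Q) (R \<cdot> (t \<cdot> Q))" using strong_lim_comp_right[OF R, of "t \<cdot> Q"] by simp
  then show ?thesis by (rule strong_lim_unique) (rule strong_lim_const)
qed

lemma kernel_proj_isometry: "x\<^sup>\<star> \<cdot> x = \<one> \<Longrightarrow> is_proj (\<one> - x \<cdot> x\<^sup>\<star>)"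
  by (intro is_proj_compl partial_isometry_cancel(2)) simp

text \<open>The pure parts are matched by the Wold series of a partial isometry between the wandering
  subspaces, the unitary parts by the partial isometry in the polar decomposition of \<open>t Q\<close>.\<close>

lemma similar_isometries:
  assumes M: "von_neumann_algebra \<one> M"
    and mem: "x \<in> M" "y \<in> M" "t \<in> M" "s \<in> M"
    and x: "x\<^sup>\<star> \<cdot> x = \<one>" and y: "y\<^sup>\<star> \<cdot> y = \<one>"
    and ts: "t \<cdot> s = \<one>" and st: "s \<cdot> t = \<one>" and yt: "y \<cdot> t = t \<cdot> x"
  obtains u where "u \<in> M" "u\<^sup>\<star> \<cdot> u = \<one>" "u \<cdot> u\<^sup>\<star> = \<one>" "y = u\<^sup>\<star> \<cdot> x \<cdot> u"
proof -
  interpret vna \<one> M by (unfold_locales) (rule M)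
  have "s \<cdot> (y \<cdot> t) \<cdot> s = s \<cdot> (t \<cdot> x) \<cdot> s" using yt by simp
  then have "s \<cdot> y \<cdot> (t \<cdot> s) = s \<cdot> t \<cdot> (x \<cdot> s)" by (simp add: comp_assoc_op)
  then have sy: "x \<cdot> s = s \<cdot> y" by (simp add: ts st)
  have ts': "s\<^sup>\<star> \<cdot> t\<^sup>\<star> = \<one>" "t\<^sup>\<star> \<cdot> s\<^sup>\<star> = \<one>" using ts st by (simp_all flip: radj_comp)
  define K where "K = \<one> - x \<cdot> x\<^sup>\<star>"
  define L where "L = \<one> - y \<cdot> y\<^sup>\<star>"
  have K: "is_proj K" and L: "is_proj L"
    unfolding K_def L_def using x y by (simp_all add: kernel_proj_isometry)
  have KLM: "K \<in> M" "L \<in> M" using mem mem_simps(1) by (simp_all add: K_def L_def del: mem_simps(1))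
  have xK: "x\<^sup>\<star> \<cdot> K = 0" by (simp add: K_def op_distribs comp_left_op[OF x] flip: comp_assoc_op) (simp add: x)
  have Kx: "K \<cdot> x = 0" by (simp add: K_def op_simps x)
  have Ly: "L \<cdot> y = 0" by (simp add: L_def op_simps y)
  \<comment> \<open>From \<open>y\<^sup>\<star> s\<^sup>\<star> = s\<^sup>\<star>
    x\<^sup>\<star>\<close> one sees that \<open>s\<^sup>\<star>\<close> maps the kernel of
    \<open>x\<^sup>\<star>\<close> onto that of \<open>y\<^sup>\<star>\<close>, while
    \<open>t\<close> itself need not. The polar part of \<open>s\<^sup>\<star> K\<close> makes this
    map isometric.\<close>
  obtain v where vM: "v \<in> M" and v: "is_proj (v\<^sup>\<star> \<cdot> v)" and kv: "\<And>\<xi>. v \<xi> = 0 \<longleftrightarrow> (s\<^sup>\<star> \<cdot> K) \<xi> = 0"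
    and kv': "\<And>\<xi>. v\<^sup>\<star> \<xi> = 0 \<longleftrightarrow> (s\<^sup>\<star> \<cdot> K)\<^sup>\<star> \<xi> = 0"
    using ex_polar_mem[of "s\<^sup>\<star> \<cdot> K"] mem KLM by (metis mem_comp mem_radj)
  have vv: "v\<^sup>\<star> \<cdot> v = K"
  proof (rule is_proj_kernel_unique[OF v K])
    fix \<xi>
    have "t\<^sup>\<star> (s\<^sup>\<star> (K \<xi>)) = K \<xi>" using ts'(2) by (metis blinfun_apply_blinfun_compose id_blinfun.rep_eq)
    then show "(v\<^sup>\<star> \<cdot> v) \<xi> = 0 \<longleftrightarrow> K \<xi> = 0"
      unfolding partial_isometry_kernel kv by (metis blinfun.zero_right blinfun_apply_blinfun_compose)
  qed
  have vv': "v \<cdot> v\<^sup>\<star> = L"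
  proof (rule is_proj_kernel_unique[OF partial_isometry_cancel(2)[OF v] L])
    fix \<xi>
    \<comment> \<open>\<open>s\<close> maps the range of \<open>y\<close> onto that of
      \<open>x\<close>, and \<open>t\<close> maps it back.\<close>
    have "K (s \<xi>) = 0 \<longleftrightarrow> L \<xi> = 0"
    proof
      assume "K (s \<xi>) = 0"
      then have "s \<xi> = x (x\<^sup>\<star> (s \<xi>))" by (simp add: K_def apply_simps)
      then have "t (s \<xi>) = y (t (x\<^sup>\<star> (s \<xi>)))" using op_commute_apply[OF yt] by metis
      then have "\<xi> = y (t (x\<^sup>\<star> (s \<xi>)))" using ts by (metis blinfun_apply_blinfun_compose id_blinfun.rep_eq)
      then show "L \<xi> = 0" using Ly by (metis blinfun.zero_left blinfun_apply_blinfun_compose)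
    next
      assume "L \<xi> = 0"
      then have "\<xi> = y (y\<^sup>\<star> \<xi>)" by (simp add: L_def apply_simps)
      then have "s \<xi> = x (s (y\<^sup>\<star> \<xi>))" using op_commute_apply[OF sy] by metis
      then show "K (s \<xi>) = 0" using Kx by (metis blinfun.zero_left blinfun_apply_blinfun_compose)
    qed
    then show "(v \<cdot> v\<^sup>\<star>) \<xi> = 0 \<longleftrightarrow> L \<xi> = 0"
      using partial_isometry_kernel[of "v\<^sup>\<star>" \<xi>] kv'[of \<xi>] by (simp add: is_projD[OF K])
  qed
  note v1 = vv[unfolded K_def] and v2 = vv'[unfolded L_def]
  have v1': "(v\<^sup>\<star>)\<^sup>\<star> \<cdot> v\<^sup>\<star> = \<one> - y \<cdot> y\<^sup>\<star>" "v\<^sup>\<star> \<cdot> (v\<^sup>\<star>)\<^sup>\<star> = \<one> - x \<cdot> x\<^sup>\<star>" using v1 v2 by simp_all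
  obtain W where W: "strong_lim (wold v x y) W" using wold_limit(2)[OF x y v1 v2] by blast
  obtain W' where W': "strong_lim (wold (v\<^sup>\<star>) y x) W'" using wold_limit(2)[OF y x v1'] by blast
  have "W\<^sup>\<star> = W'" by (rule strong_lim_radj[OF W]) (simp add: wold_radj W')
  with W' have Ws: "strong_lim (wold (v\<^sup>\<star>) y x) (W\<^sup>\<star>)" by simp
  have "wold v x y n \<in> M" for n using vM mem by (induction n) simp_all
  then have WM: "W \<in> M" by (rule mem_strong_lim[OF W])
  \<comment> \<open>\<open>Q\<close> and \<open>R\<close> turn out to be the limits of the range
    projections, so they project onto the unitary parts of \<open>x\<close> and
    \<open>y\<close>.\<close>
  define Q where "Q = \<one> - W\<^sup>\<star> \<cdot> W"
  define R where "R = \<one> - W \<cdot> W\<^sup>\<star>"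
  have "strong_lim (\<lambda>n. \<one> - wold (v\<^sup>\<star>) y x n \<cdot> wold v x y n) Q"
    unfolding Q_def by (intro strong_lim_diff strong_lim_const strong_lim_comp W Ws wold_limit(1)[OF y x v1'])
  then have Ql: "strong_lim (range_proj x) Q"
    using wold_gram[OF x y v1 v2] by (simp add: wold_radj)
  have "strong_lim (\<lambda>n. \<one> - wold v x y n \<cdot> wold (v\<^sup>\<star>) y x n) R"
    unfolding R_def by (intro strong_lim_diff strong_lim_const strong_lim_comp W Ws wold_limit(1)[OF x y v1 v2])
  then have Rl: "strong_lim (range_proj y) R"
    using wold_gram[OF y x v1'] by (simp add: wold_radj)
  have Q: "is_proj Q" by (rule strong_lim_is_proj[OF Ql]) (rule is_proj_range_proj[OF x])
  have R: "is_proj R" by (rule strong_lim_is_proj[OF Rl]) (rule is_proj_range_proj[OF y])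
  have QM: "Q \<in> M" using WM mem_simps(1) by (simp add: Q_def del: mem_simps(1))
  have xQx: "z \<cdot> P \<cdot> z\<^sup>\<star> = P" if P: "strong_lim (range_proj z) P" for z P :: "'a \<Rightarrow>\<^sub>L 'a"
  proof -
    have "strong_lim (\<lambda>n. z \<cdot> range_proj z n \<cdot> z\<^sup>\<star>) P" using strong_lim_Suc[OF P] by simp
    then show ?thesis using strong_lim_unique strong_lim_comp_right[OF strong_lim_comp_left[OF P]] by blast
  qed
  note xQ = xQx[OF Ql] and yR = xQx[OF Rl]
  have xQc: "x \<cdot> Q = Q \<cdot> x"
  proof -
    have "Q \<cdot> x = x \<cdot> Q \<cdot> x\<^sup>\<star> \<cdot> x" by (simp add: xQ)
    then show ?thesis by (simp add: comp_assoc_op x)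
  qed
  have Wx: "W \<cdot> x = y \<cdot> W"
  proof (rule strong_lim_unique)
    show "strong_lim (\<lambda>n. wold v x y (Suc n) \<cdot> x) (W \<cdot> x)"
      by (rule strong_lim_comp_right[OF strong_lim_Suc[OF W]])
    have "wold v x y (Suc n) \<cdot> x = y \<cdot> wold v x y n" for n
      using wold_cross[OF x v1] by (simp add: op_simps x)
    then show "strong_lim (\<lambda>n. wold v x y (Suc n) \<cdot> x) (y \<cdot> W)"
      using strong_lim_comp_left[OF W, of y] by simp
  qed
  \<comment> \<open>\<open>t\<close> restricts to a bijection between the unitary parts; its polar
    part is a partial isometry in \<open>M\<close> from the one onto the other.\<close>
  obtain r where rM: "r \<in> M" and r: "is_proj (r\<^sup>\<star> \<cdot> r)" and kr: "\<And>\<xi>. r \<xi> = 0 \<longleftrightarrow> (t \<cdot> Q) \<xi> = 0"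
    and kr': "\<And>\<xi>. r\<^sup>\<star> \<xi> = 0 \<longleftrightarrow> (t \<cdot> Q)\<^sup>\<star> \<xi> = 0"
    and ir: "\<And>b c. c \<cdot> (t \<cdot> Q) = (t \<cdot> Q) \<cdot> b \<Longrightarrow>
       ((t \<cdot> Q)\<^sup>\<star> \<cdot> (t \<cdot> Q)) \<cdot> b = b \<cdot> ((t \<cdot> Q)\<^sup>\<star> \<cdot> (t \<cdot> Q)) \<Longrightarrow> c \<cdot> r = r \<cdot> b"
    using ex_polar_mem[OF mem_comp[OF mem(3) QM]] by metis
  have rr: "r\<^sup>\<star> \<cdot> r = Q"
  proof (rule is_proj_kernel_unique[OF r Q])
    fix \<xi>
    have "s (t (Q \<xi>)) = Q \<xi>" using st by (metis blinfun_apply_blinfun_compose id_blinfun.rep_eq)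
    then show "(r\<^sup>\<star> \<cdot> r) \<xi> = 0 \<longleftrightarrow> Q \<xi> = 0"
      unfolding partial_isometry_kernel kr by (metis blinfun.zero_right blinfun_apply_blinfun_compose)
  qed
  have RtQ: "R \<cdot> (t \<cdot> Q) = t \<cdot> Q" by (rule range_proj_limit_intertwine[OF y yt xQ Rl])
  have QsR: "Q \<cdot> (s \<cdot> R) = s \<cdot> R" by (rule range_proj_limit_intertwine[OF x sy yR Ql])
  have rr': "r \<cdot> r\<^sup>\<star> = R"
  proof (rule is_proj_kernel_unique[OF partial_isometry_cancel(2)[OF r] R])
    fix \<xi>
    have "(t \<cdot> Q \<cdot> (s \<cdot> R))\<^sup>\<star> = R\<^sup>\<star>"
      by (simp only: comp_assoc_op QsR) (simp only: comp_assoc_op[symmetric] ts id_comp_op)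
    then have 1: "R = R \<cdot> s\<^sup>\<star> \<cdot> (t \<cdot> Q)\<^sup>\<star>" by (simp add: comp_assoc_op is_projD[OF R] is_projD[OF Q])
    have "(R \<cdot> (t \<cdot> Q))\<^sup>\<star> = (t \<cdot> Q)\<^sup>\<star>" by (simp only: RtQ)
    then have 2: "(t \<cdot> Q)\<^sup>\<star> = (t \<cdot> Q)\<^sup>\<star> \<cdot> R" by (simp add: comp_assoc_op is_projD[OF R])
    have "(t \<cdot> Q)\<^sup>\<star> \<xi> = 0 \<longleftrightarrow> R \<xi> = 0"
      by (metis 1 2 blinfun.zero_right blinfun_apply_blinfun_compose)
    then show "(r \<cdot> r\<^sup>\<star>) \<xi> = 0 \<longleftrightarrow> R \<xi> = 0"
      using partial_isometry_kernel[of "r\<^sup>\<star>" \<xi>] kr'[of \<xi>] by simp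
  qed
  have rQ: "r \<cdot> Q = r" using partial_isometry_cancel(1)[OF r] by (simp only: rr)
  have yr: "y \<cdot> r = r \<cdot> x"
  proof -
    define h where "h = t\<^sup>\<star> \<cdot> t"
    \<comment> \<open>As \<open>y\<close> is an isometry, \<open>h = x\<^sup>\<star> h x\<close>.
      Since \<open>x\<close> acts unitarily on the range of \<open>Q\<close>, the compression
      \<open>Q h Q\<close> therefore commutes with \<open>x\<close>, which lets the polar part
      inherit the intertwining relation.\<close>
    have "(y \<cdot> t)\<^sup>\<star> \<cdot> (y \<cdot> t) = (t \<cdot> x)\<^sup>\<star> \<cdot> (t \<cdot> x)" using yt by simp
    then have "t\<^sup>\<star> \<cdot> t = x\<^sup>\<star> \<cdot> (t\<^sup>\<star> \<cdot> (t \<cdot> x))"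
      by (simp only: radj_comp comp_assoc_op comp_left_op[OF y] id_comp_op)
    then have h: "h = x\<^sup>\<star> \<cdot> (h \<cdot> x)" unfolding h_def comp_assoc_op .
    have Qh: "(t \<cdot> Q)\<^sup>\<star> \<cdot> (t \<cdot> Q) = Q \<cdot> h \<cdot> Q" by (simp add: h_def is_projD[OF Q] comp_assoc_op)
    have Qxx: "x \<cdot> x\<^sup>\<star> \<cdot> Q = Q"
    proof -
      have "x \<cdot> x\<^sup>\<star> \<cdot> (x \<cdot> Q \<cdot> x\<^sup>\<star>) = x \<cdot> Q \<cdot> x\<^sup>\<star>" by (simp add: comp_assoc_op comp_left_op[OF x])
      then show ?thesis by (simp only: xQ)
    qed
    have "(x \<cdot> Q)\<^sup>\<star> = (Q \<cdot> x)\<^sup>\<star>" by (simp only: xQc)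
    then have xsQ: "Q \<cdot> x\<^sup>\<star> = x\<^sup>\<star> \<cdot> Q" by (simp add: is_projD[OF Q])
    have "x \<cdot> (Q \<cdot> h \<cdot> Q) = x \<cdot> (Q \<cdot> (x\<^sup>\<star> \<cdot> (h \<cdot> x)) \<cdot> Q)" using h by simp
    also have "\<dots> = x \<cdot> (Q \<cdot> x\<^sup>\<star>) \<cdot> h \<cdot> (x \<cdot> Q)" by (simp add: comp_assoc_op)
    also have "\<dots> = (x \<cdot> x\<^sup>\<star> \<cdot> Q) \<cdot> h \<cdot> (Q \<cdot> x)" by (simp only: xsQ xQc comp_assoc_op)
    finally have xQh: "x \<cdot> (Q \<cdot> h \<cdot> Q) = Q \<cdot> h \<cdot> Q \<cdot> x" by (simp add: comp_left_op[OF Qxx, unfolded comp_assoc_op] comp_assoc_op)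
    have QQ: "Q \<cdot> (Q \<cdot> a) = Q \<cdot> a" for a by (simp add: comp_left_op[OF is_projD(1)[OF Q]])
    have "y \<cdot> r = r \<cdot> (Q \<cdot> x)"
    proof (rule ir)
      show "y \<cdot> (t \<cdot> Q) = t \<cdot> Q \<cdot> (Q \<cdot> x)"
        by (simp add: comp_assoc_op QQ comp_left_op[OF yt] xQc)
      show "(t \<cdot> Q)\<^sup>\<star> \<cdot> (t \<cdot> Q) \<cdot> (Q \<cdot> x) = Q \<cdot> x \<cdot> ((t \<cdot> Q)\<^sup>\<star> \<cdot> (t \<cdot> Q))"
      proof -
        have "Q \<cdot> x \<cdot> (Q \<cdot> h \<cdot> Q) = Q \<cdot> (Q \<cdot> h \<cdot> Q \<cdot> x)"
          by (simp only: comp_assoc_op[of Q x] xQh)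
        then show ?thesis unfolding Qh by (simp add: comp_assoc_op QQ)
      qed
    qed
    then show ?thesis using rQ by (simp add: comp_assoc_op[symmetric])
  qed
  have "is_proj (W\<^sup>\<star> \<cdot> W)" using is_proj_compl[OF Q] by (simp add: Q_def)
  note Wc = partial_isometry_cancel[OF this]
  have "W\<^sup>\<star> \<cdot> R = 0" using Wc(3) by (simp add: R_def op_simps)
  moreover have "R \<cdot> r = r" unfolding rr'[symmetric] using partial_isometry_cancel(1)[OF r] by (simp add: comp_assoc_op)
  ultimately have Wr: "W\<^sup>\<star> \<cdot> r = 0" by (metis comp_assoc_op blinfun_compose.zero_left)
  have "W \<cdot> Q = 0" using Wc(1) by (simp add: Q_def op_simps)
  moreover have "Q \<cdot> r\<^sup>\<star> = r\<^sup>\<star>" unfolding rr[symmetric] by (rule partial_isometry_cancel(3)[OF r])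
  ultimately have Wr': "W \<cdot> r\<^sup>\<star> = 0" by (metis comp_assoc_op blinfun_compose.zero_left)
  have "(W\<^sup>\<star> \<cdot> r)\<^sup>\<star> = 0" "(W \<cdot> r\<^sup>\<star>)\<^sup>\<star> = 0" using Wr Wr' by simp_all
  then have rW: "r\<^sup>\<star> \<cdot> W = 0" "r \<cdot> W\<^sup>\<star> = 0" by simp_all
  \<comment> \<open>Initial projections \<open>\<one> - Q\<close> and \<open>Q\<close> as well as
    final projections \<open>\<one> - R\<close> and \<open>R\<close> are complementary, so
    \<open>W + r\<close> is unitary; the adjoint fits the form
    \<open>y = u\<^sup>\<star> x u\<close>.\<close>
  define u where "u = (W + r)\<^sup>\<star>"
  have u1: "u \<cdot> u\<^sup>\<star> = \<one>" by (simp add: u_def op_distribs Wr rW rr Q_def)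
  have u2: "u\<^sup>\<star> \<cdot> u = \<one>" by (simp add: u_def op_distribs Wr' rW rr' R_def)
  have "u\<^sup>\<star> \<cdot> x = y \<cdot> u\<^sup>\<star>" by (simp add: u_def op_distribs Wx yr)
  then have "u\<^sup>\<star> \<cdot> x \<cdot> u = y" by (simp add: comp_assoc_op u2)
  moreover have "u \<in> M" using WM rM unfolding u_def by simp
  ultimately show ?thesis using that u1 u2 by blast
qed

subsection \<open>$C^*$-convex combinations equal to an isometry\<close>

text \<open>To the squared norm of \<open>y i (t i \<xi>) - t i (x \<xi>)\<close> add the deficit of
  \<open>norm (y i (t i \<xi>))\<^sup>2\<close> below \<open>norm (t i \<xi>)\<^sup>2\<close>. Both
  are nonnegative, and their sum over \<open>i\<close> is the difference of the squared norms of
  \<open>\<xi>\<close> and \<open>x \<xi>\<close>, which is zero. Surjectivity of \<open>t i\<close>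
  then makes \<open>y i\<close> isometric everywhere.\<close>

lemma cstar_combination_isometry:
  fixes t y :: "'i \<Rightarrow> ('h::{real_inner,complete_space} \<Rightarrow>\<^sub>L 'h)"
  assumes I: "finite I" and x: "x\<^sup>\<star> \<cdot> x = \<one>"
    and ny: "\<And>i. i \<in> I \<Longrightarrow> norm (y i) \<le> 1" and ts: "\<And>i. i \<in> I \<Longrightarrow> t i \<cdot> s i = \<one>"
    and tt: "(\<Sum>i\<in>I. (t i)\<^sup>\<star> \<cdot> t i) = \<one>" and xt: "x = (\<Sum>i\<in>I. (t i)\<^sup>\<star> \<cdot> y i \<cdot> t i)"
    and i: "i \<in> I"
  shows "y i \<cdot> t i = t i \<cdot> x" "(y i)\<^sup>\<star> \<cdot> y i = \<one>"
proof -
  have sum_t: "(\<Sum>i\<in>I. inner (t i \<xi>) (t i \<eta>)) = inner \<xi> \<eta>" for \<xi> \<eta>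
  proof -
    have "inner ((\<Sum>i\<in>I. (t i)\<^sup>\<star> \<cdot> t i) \<xi>) \<eta> = inner \<xi> \<eta>" by (simp add: tt)
    then show ?thesis by (simp add: blinfun.sum_left inner_sum_left inner_radj)
  qed
  have sum_x: "(\<Sum>i\<in>I. inner (y i (t i \<xi>)) (t i \<eta>)) = inner (x \<xi>) \<eta>" for \<xi> \<eta>
    by (subst xt) (simp add: blinfun.sum_left inner_sum_left inner_radj)
  have nx: "inner (x \<xi>) (x \<xi>) = inner \<xi> \<xi>" for \<xi>
    using op_commute_apply[of "x\<^sup>\<star>" x \<one> \<one>] x by (simp add: inner_radj)
  have ny': "inner (y i \<xi>) (y i \<xi>) \<le> inner \<xi> \<xi>" if "i \<in> I" for i \<xi>
  proof -
    have "norm (y i \<xi>) \<le> norm \<xi>"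
      using norm_blinfun[of "y i" \<xi>] mult_right_mono[OF ny[OF that] norm_ge_zero[of \<xi>]] by simp
    then show ?thesis by (simp add: norm_le)
  qed
  have key: "y i (t i \<xi>) = t i (x \<xi>) \<and> inner (y i (t i \<xi>)) (y i (t i \<xi>)) = inner (t i \<xi>) (t i \<xi>)" for \<xi>
  proof -
    let ?d = "\<lambda>i. y i (t i \<xi>) - t i (x \<xi>)"
    let ?e = "\<lambda>i. inner (t i \<xi>) (t i \<xi>) - inner (y i (t i \<xi>)) (y i (t i \<xi>))"
    have "(\<Sum>i\<in>I. inner (?d i) (?d i) + ?e i) = (\<Sum>i\<in>I. inner (t i \<xi>) (t i \<xi>)
        - 2 * inner (y i (t i \<xi>)) (t i (x \<xi>)) + inner (t i (x \<xi>)) (t i (x \<xi>)))"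
      by (rule sum.cong) (simp_all add: inner_diff inner_commute)
    also have "\<dots> = inner \<xi> \<xi> - 2 * inner (x \<xi>) (x \<xi>) + inner (x \<xi>) (x \<xi>)"
      by (simp add: sum.distrib sum_subtractf sum_t sum_x flip: sum_distrib_left)
    also have "\<dots> = 0" by (simp add: nx)
    finally have "(\<Sum>i\<in>I. inner (?d i) (?d i) + ?e i) = 0" .
    moreover have nonneg: "0 \<le> ?e i" if "i \<in> I" for i using ny'[OF that] by simp
    ultimately have "inner (?d i) (?d i) + ?e i = 0"
      using sum_nonneg_eq_0_iff[OF I, of "\<lambda>i. inner (?d i) (?d i) + ?e i"] i by force
    then show ?thesis using nonneg[OF i] inner_ge_zero[of "?d i"]
      by (smt (verit) eq_iff_diff_eq_0 inner_eq_zero_iff)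
  qed
  show "y i \<cdot> t i = t i \<cdot> x" by (rule blinfun_eqI) (simp add: key)
  have iso: "inner (y i \<eta>) (y i \<eta>) = inner \<eta> \<eta>" for \<eta>
  proof -
    have ts': "t i (s i \<eta>) = \<eta>" using ts[OF i] by (metis blinfun_apply_blinfun_compose id_blinfun.rep_eq)
    show ?thesis using key[of "s i \<eta>"] unfolding ts' by blast
  qed
  show "(y i)\<^sup>\<star> \<cdot> y i = \<one>"
  proof (rule op_eqI)
    fix \<xi> \<eta>
    have "inner (y i \<xi>) (y i \<eta>) = inner \<xi> \<eta>"
      using iso[of "\<xi> + \<eta>"] iso[of \<xi>] iso[of \<eta>] by (simp add: apply_simps inner_add inner_commute)
    then show "inner (((y i)\<^sup>\<star> \<cdot> y i) \<xi>) \<eta> = inner (\<one> \<xi>) \<eta>" by (simp add: inner_radj)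
  qed
qed

lemma isometry_unitary_orbit:
  fixes M :: "('h::complex_hilbert_space \<Rightarrow>\<^sub>L 'h) set"
  assumes M: "von_neumann_algebra \<one> M" and I: "finite I" and x: "x \<in> M" "x\<^sup>\<star> \<cdot> x = \<one>"
    and y: "\<And>i. i \<in> I \<Longrightarrow> y i \<in> M \<and> norm (y i) \<le> 1" and t: "\<And>i. i \<in> I \<Longrightarrow> invertible_in \<one> M (t i)"
    and tt: "(\<Sum>i\<in>I. (t i)\<^sup>\<star> \<cdot> t i) = \<one>" and xt: "x = (\<Sum>i\<in>I. (t i)\<^sup>\<star> \<cdot> y i \<cdot> t i)"
  shows "\<exists>u. \<forall>i\<in>I. u i \<in> M \<and> (u i)\<^sup>\<star> \<cdot> u i = \<one> \<and> u i \<cdot> (u i)\<^sup>\<star> = \<one> \<and> y i = (u i)\<^sup>\<star> \<cdot> x \<cdot> u i"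
proof -
  have "\<forall>i\<in>I. \<exists>s. s \<in> M \<and> s \<cdot> t i = \<one> \<and> t i \<cdot> s = \<one>" using t by (auto simp: invertible_in_def)
  then obtain s where s: "\<And>i. i \<in> I \<Longrightarrow> s i \<in> M \<and> s i \<cdot> t i = \<one> \<and> t i \<cdot> s i = \<one>" by metis
  have "\<exists>u. u \<in> M \<and> u\<^sup>\<star> \<cdot> u = \<one> \<and> u \<cdot> u\<^sup>\<star> = \<one> \<and> y i = u\<^sup>\<star> \<cdot> x \<cdot> u" if i: "i \<in> I" for i
  proof -
    have "y i \<cdot> t i = t i \<cdot> x" "(y i)\<^sup>\<star> \<cdot> y i = \<one>"
      using cstar_combination_isometry[OF I x(2) _ _ tt xt i, of s] y s by blast+
    moreover have "t i \<in> M" using t[OF i] by (simp add: invertible_in_def)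
    ultimately show ?thesis
      using similar_isometries[OF M x(1), of "y i" "t i" "s i"] y[OF i] s[OF i] x(2) by metis
  qed
  then show ?thesis by metis
qed

text \<open>Padding \<open>y\<close> by the identity off \<open>c\<close> keeps it a contraction:
  the complement of the Gram operator is \<open>c (\<one> - y\<^sup>\<star> y) c\<close>.\<close>

lemma norm_central_mix:
  assumes c: "is_proj c" and y: "norm y \<le> 1" and cy: "c \<cdot> y = y \<cdot> c"
  shows "norm (c \<cdot> y + (\<one> - c)) \<le> 1"
proof -
  note cc = is_proj_simps[OF c]
  have "(c \<cdot> y)\<^sup>\<star> = (y \<cdot> c)\<^sup>\<star>" by (simp only: cy)
  then have ys: "y\<^sup>\<star> \<cdot> c = c \<cdot> y\<^sup>\<star>" by (simp add: cc)
  let ?Y = "c \<cdot> y + (\<one> - c)"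
  have "\<one> - ?Y\<^sup>\<star> \<cdot> ?Y = c\<^sup>\<star> \<cdot> (\<one> - y\<^sup>\<star> \<cdot> y) \<cdot> c"
    by (simp add: op_simps cc ys comp_left_op[OF ys] cy[symmetric] comp_left_op[OF cy[symmetric]])
  then have pos: "pos_op (\<one> - ?Y\<^sup>\<star> \<cdot> ?Y)"
    using pos_op_conj[OF pos_op_one_minus_radj_comp[OF y], of c] by simp
  show ?thesis
  proof (rule norm_blinfun_bound)
    fix \<xi>
    have "(norm (?Y \<xi>))\<^sup>2 \<le> inner \<xi> \<xi>"
      unfolding norm_apply_sq using pos_opD(2)[OF pos, of \<xi>]
      by (simp only: blinfun.diff_left inner_diff_left blinfun_apply_id_blinfun)
    then show "norm (?Y \<xi>) \<le> 1 * norm \<xi>" by (simp add: norm_le power2_norm_eq_inner)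
  qed simp
qed

text \<open>On each central summand the data are padded by the identity to a combination on the
  whole space with the same coefficients \<open>t i\<close>. Under \<open>c\<close> it represents an
  isometry directly, under \<open>\<one> - c\<close> after taking adjoints; the two families of
  unitaries are then glued.\<close>

lemma isometry_coisometry_cstar_extreme:
  fixes M :: "('h::complex_hilbert_space \<Rightarrow>\<^sub>L 'h) set"
  assumes M: "von_neumann_algebra \<one> M" and c: "is_proj c" "c \<in> center \<one> M"
    and x: "x \<in> M" "norm x \<le> 1" and xc: "x\<^sup>\<star> \<cdot> x \<cdot> c = c" and xc': "x \<cdot> x\<^sup>\<star> \<cdot> (\<one> - c) = \<one> - c"
  shows "cstar_extreme_point \<one> M x"
  unfolding cstar_extreme_point_def
proof (intro conjI allI impI)
  interpret vna \<one> M by (unfold_locales) (rule M)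
  show "x \<in> closed_unit_ball M" using x by (simp add: closed_unit_ball_def)
  fix k :: nat and y t
  assume "(\<forall>i\<in>{1..k}. y i \<in> closed_unit_ball M \<and> invertible_in \<one> M (t i)) \<and>
    (\<Sum>i=1..k. adj (t i) \<cdot> t i) = \<one> \<and> x = (\<Sum>i=1..k. adj (t i) \<cdot> y i \<cdot> t i)"
  then have yt: "\<forall>i\<in>{1..k}. y i \<in> closed_unit_ball M \<and> invertible_in \<one> M (t i)"
    and tt: "(\<Sum>i=1..k. adj (t i) \<cdot> t i) = \<one>" and xt: "x = (\<Sum>i=1..k. adj (t i) \<cdot> y i \<cdot> t i)"
    by blast+
  from yt have y: "y i \<in> M" "norm (y i) \<le> 1" and t: "invertible_in \<one> M (t i)" if "i \<in> {1..k}" for i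
    using that by (auto simp: closed_unit_ball_def)
  have tM: "t i \<in> M" if "i \<in> {1..k}" for i using t[OF that] by (simp add: invertible_in_def)
  have tt: "(\<Sum>i=1..k. (t i)\<^sup>\<star> \<cdot> t i) = \<one>" using tt by (simp add: adj_mem tM)
  have xt: "x = (\<Sum>i=1..k. (t i)\<^sup>\<star> \<cdot> y i \<cdot> t i)" using xt by (simp add: adj_mem tM)
  have cM: "c \<in> M" and comm: "\<And>a. a \<in> M \<Longrightarrow> a \<cdot> c = c \<cdot> a"
    using c(2) commutantD by (auto simp: center_def)
  note cc = is_proj_simps[OF c(1)]
  define d where "d = \<one> - c"
  have d: "is_proj d" unfolding d_def by (rule is_proj_compl[OF c(1)])
  have cd: "c = \<one> - d" by (simp add: d_def)
  have dM: "d \<in> M" unfolding d_def by (rule mem_simps(4)[OF mem_simps(1) cM])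
  have commd: "a \<cdot> d = d \<cdot> a" if "a \<in> M" for a by (simp add: d_def op_distribs comm that)
  note dd = is_proj_simps[OF d]
  have cd0: "c \<cdot> d = 0" "d \<cdot> c = 0" "c \<cdot> (d \<cdot> a) = 0" "d \<cdot> (c \<cdot> a) = 0" for a :: "'h \<Rightarrow>\<^sub>L 'h"
    by (simp_all add: d_def op_simps cc)
  \<comment> \<open>A central \<open>p\<close> passes through the coefficients, and the padding
    \<open>\<one> - p\<close> reproduces itself by \<open>tt\<close>.\<close>
  have mix: "(\<Sum>i=1..k. (t i)\<^sup>\<star> \<cdot> (p \<cdot> Y i + (\<one> - p)) \<cdot> t i) = p \<cdot> (\<Sum>i=1..k. (t i)\<^sup>\<star> \<cdot> Y i \<cdot> t i) + (\<one> - p)"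
    if p: "p \<in> M" "\<And>a. a \<in> M \<Longrightarrow> a \<cdot> p = p \<cdot> a" for p Y
  proof -
    have "(t i)\<^sup>\<star> \<cdot> (p \<cdot> Y i + (\<one> - p)) \<cdot> t i
        = p \<cdot> ((t i)\<^sup>\<star> \<cdot> Y i \<cdot> t i) + (\<one> - p) \<cdot> ((t i)\<^sup>\<star> \<cdot> t i)" if i: "i \<in> {1..k}" for i
    proof -
      have ps: "(t i)\<^sup>\<star> \<cdot> p = p \<cdot> (t i)\<^sup>\<star>" by (rule p(2)) (simp add: tM[OF i])
      show ?thesis by (simp add: op_simps ps comp_left_op[OF ps])
    qed
    then have "(\<Sum>i=1..k. (t i)\<^sup>\<star> \<cdot> (p \<cdot> Y i + (\<one> - p)) \<cdot> t i)
       = (\<Sum>i=1..k. p \<cdot> ((t i)\<^sup>\<star> \<cdot> Y i \<cdot> t i) + (\<one> - p) \<cdot> ((t i)\<^sup>\<star> \<cdot> t i))"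
      by (intro sum.cong) auto
    also have "\<dots> = p \<cdot> (\<Sum>i=1..k. (t i)\<^sup>\<star> \<cdot> Y i \<cdot> t i) + (\<one> - p) \<cdot> (\<Sum>i=1..k. (t i)\<^sup>\<star> \<cdot> t i)"
      by (simp add: sum.distrib blinfun_compose.sum_right)
    finally show ?thesis unfolding tt by simp
  qed
  have adj_sum: "(\<Sum>i\<in>A. f i)\<^sup>\<star> = (\<Sum>i\<in>A. (f i)\<^sup>\<star>)" for f :: "nat \<Rightarrow> 'h \<Rightarrow>\<^sub>L 'h" and A
    by (induction A rule: infinite_finite_induct) simp_all
  have xs: "x\<^sup>\<star> = (\<Sum>i=1..k. (t i)\<^sup>\<star> \<cdot> (y i)\<^sup>\<star> \<cdot> t i)"
    by (subst xt) (simp add: adj_sum comp_assoc_op)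
  \<comment> \<open>Used for \<open>p = c\<close> with \<open>z = x\<close>, and for
    \<open>p = d\<close> with \<open>z = x\<^sup>\<star>\<close>, where the coisometry condition on
    \<open>x\<close> is the isometry condition on \<open>z\<close>.\<close>
  have orbit: "\<exists>u. \<forall>i\<in>{1..k}. u i \<in> M \<and> (u i)\<^sup>\<star> \<cdot> u i = \<one> \<and> u i \<cdot> (u i)\<^sup>\<star> = \<one> \<and>
      p \<cdot> Y i = (u i)\<^sup>\<star> \<cdot> (p \<cdot> z) \<cdot> u i"
    if p: "is_proj p" "p \<in> M" "\<And>a. a \<in> M \<Longrightarrow> a \<cdot> p = p \<cdot> a" and z: "z \<in> M" "z\<^sup>\<star> \<cdot> z \<cdot> p = p"
      and Y: "\<And>i. i \<in> {1..k} \<Longrightarrow> Y i \<in> M \<and> norm (Y i) \<le> 1" and zY: "z = (\<Sum>i=1..k. (t i)\<^sup>\<star> \<cdot> Y i \<cdot> t i)"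
    for p z Y
  proof -
    define x' where "x' = p \<cdot> z + (\<one> - p)"
    note pp = is_proj_simps[OF p(1)]
    have zp: "z \<cdot> p = p \<cdot> z" "z\<^sup>\<star> \<cdot> p = p \<cdot> z\<^sup>\<star>" using p(3) z(1) by simp_all
    have zz: "p \<cdot> (z\<^sup>\<star> \<cdot> z) = p" using z(2) p(3)[of "z\<^sup>\<star> \<cdot> z"] z(1) by simp
    have 1: "x'\<^sup>\<star> \<cdot> x' = \<one>"
      by (simp add: x'_def op_simps pp zp comp_left_op[OF zp(1)] comp_left_op[OF zp(2)] zz)
    have 2: "x' \<in> M" unfolding x'_def
      by (intro mem_simps(3) mem_simps(4) mem_simps(1) mem_comp p z)
    have 3: "x' = (\<Sum>i=1..k. (t i)\<^sup>\<star> \<cdot> (p \<cdot> Y i + (\<one> - p)) \<cdot> t i)"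
      using mix[OF p(2,3), of Y] by (simp only: x'_def zY)
    have 4: "p \<cdot> Y i + (\<one> - p) \<in> M \<and> norm (p \<cdot> Y i + (\<one> - p)) \<le> 1" if "i \<in> {1..k}" for i
      using Y[OF that] p norm_central_mix[OF p(1), of "Y i"]
      by (auto intro!: mem_simps(3) mem_simps(4) mem_comp)
    have "\<exists>u. \<forall>i\<in>{1..k}. u i \<in> M \<and> (u i)\<^sup>\<star> \<cdot> u i = \<one> \<and> u i \<cdot> (u i)\<^sup>\<star> = \<one> \<and>
        p \<cdot> Y i + (\<one> - p) = (u i)\<^sup>\<star> \<cdot> x' \<cdot> u i"
      by (rule isometry_unitary_orbit[OF M _ 2 1 4 t tt 3]) simp_all
    then obtain u where u: "\<And>i. i \<in> {1..k} \<Longrightarrow> u i \<in> M \<and> (u i)\<^sup>\<star> \<cdot> u i = \<one> \<and> u i \<cdot> (u i)\<^sup>\<star> = \<one> \<and>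
        p \<cdot> Y i + (\<one> - p) = (u i)\<^sup>\<star> \<cdot> x' \<cdot> u i" by blast
    have "p \<cdot> Y i = (u i)\<^sup>\<star> \<cdot> (p \<cdot> z) \<cdot> u i" if i: "i \<in> {1..k}" for i
    proof -
      have up: "(u i)\<^sup>\<star> \<cdot> p = p \<cdot> (u i)\<^sup>\<star>" using p(3) u[OF i] by simp
      have "p \<cdot> (p \<cdot> Y i + (\<one> - p)) = p \<cdot> ((u i)\<^sup>\<star> \<cdot> x' \<cdot> u i)" using u[OF i] by simp
      then show ?thesis by (simp add: x'_def op_simps pp up comp_left_op[OF up])
    qed
    then show ?thesis using u by blast
  qed
  from orbit[OF c(1) cM comm x(1) xc _ xt] y
  obtain u1 where u1: "\<And>i. i \<in> {1..k} \<Longrightarrow> u1 i \<in> M \<and> (u1 i)\<^sup>\<star> \<cdot> u1 i = \<one> \<and> u1 i \<cdot> (u1 i)\<^sup>\<star> = \<one> \<and>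
      c \<cdot> y i = (u1 i)\<^sup>\<star> \<cdot> (c \<cdot> x) \<cdot> u1 i" by blast
  have "\<exists>u. \<forall>i\<in>{1..k}. u i \<in> M \<and> (u i)\<^sup>\<star> \<cdot> u i = \<one> \<and> u i \<cdot> (u i)\<^sup>\<star> = \<one> \<and>
      d \<cdot> (y i)\<^sup>\<star> = (u i)\<^sup>\<star> \<cdot> (d \<cdot> x\<^sup>\<star>) \<cdot> u i"
    by (rule orbit[OF d dM commd _ _ _ xs]) (use x xc' y in \<open>simp_all flip: d_def\<close>)
  then obtain u2 where u2: "\<And>i. i \<in> {1..k} \<Longrightarrow> u2 i \<in> M \<and> (u2 i)\<^sup>\<star> \<cdot> u2 i = \<one> \<and> u2 i \<cdot> (u2 i)\<^sup>\<star> = \<one> \<and>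
      d \<cdot> (y i)\<^sup>\<star> = (u2 i)\<^sup>\<star> \<cdot> (d \<cdot> x\<^sup>\<star>) \<cdot> u2 i" by blast
  define u where "u i = c \<cdot> u1 i + d \<cdot> u2 i" for i
  have "unitary_in \<one> M (u i) \<and> y i = adj (u i) \<cdot> x \<cdot> u i" if i: "i \<in> {1..k}" for i
  proof -
    note u1 = u1[OF i] and u2 = u2[OF i]
    have uM: "u i \<in> M" using u1 u2 cM dM by (simp add: u_def)
    have k: "u1 i \<cdot> c = c \<cdot> u1 i" "(u1 i)\<^sup>\<star> \<cdot> c = c \<cdot> (u1 i)\<^sup>\<star>" "u2 i \<cdot> c = c \<cdot> u2 i"
      "(u2 i)\<^sup>\<star> \<cdot> c = c \<cdot> (u2 i)\<^sup>\<star>" "x \<cdot> c = c \<cdot> x"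
      "u1 i \<cdot> d = d \<cdot> u1 i" "(u1 i)\<^sup>\<star> \<cdot> d = d \<cdot> (u1 i)\<^sup>\<star>" "u2 i \<cdot> d = d \<cdot> u2 i"
      "(u2 i)\<^sup>\<star> \<cdot> d = d \<cdot> (u2 i)\<^sup>\<star>" "x \<cdot> d = d \<cdot> x" "(y i) \<cdot> d = d \<cdot> y i"
      using u1 u2 x y[OF i] by (simp_all add: comm commd)
    have "(d \<cdot> (y i)\<^sup>\<star>)\<^sup>\<star> = ((u2 i)\<^sup>\<star> \<cdot> (d \<cdot> x\<^sup>\<star>) \<cdot> u2 i)\<^sup>\<star>" using u2 by simp
    then have dy: "d \<cdot> y i = (u2 i)\<^sup>\<star> \<cdot> (d \<cdot> x) \<cdot> u2 i" by (simp add: dd k comp_assoc_op)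
    have cy: "c \<cdot> y i = (u1 i)\<^sup>\<star> \<cdot> (c \<cdot> x) \<cdot> u1 i" using u1 by simp
    have y_eq: "y i = c \<cdot> y i + d \<cdot> y i" by (simp add: d_def op_distribs)
    have "(u i)\<^sup>\<star> \<cdot> u i = \<one>" "u i \<cdot> (u i)\<^sup>\<star> = \<one>"
      using u1 u2 by (simp_all add: u_def op_simps k k[THEN comp_left_op] cc dd cd0) (simp_all add: d_def)
    moreover have "(u i)\<^sup>\<star> \<cdot> x \<cdot> u i = c \<cdot> y i + d \<cdot> y i"
      unfolding cy dy by (simp add: u_def op_simps k k[THEN comp_left_op] cc dd cd0)
    ultimately show ?thesis using uM y_eq by (simp add: unitary_iff adj_mem)
  qed
  then show "\<exists>u. \<forall>i\<in>{1..k}. unitary_in \<one> M (u i) \<and> y i = adj (u i) \<cdot> x \<cdot> u i" by blast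
qed

section \<open>Type decomposition\<close>

lemma corner_center:
  assumes M: "von_neumann_algebra \<one> M" and z: "is_proj z" "z \<in> center \<one> M"
  shows "center z {a \<in> M. z \<cdot> a = a} = {a \<in> center \<one> M. z \<cdot> a = a}"
proof -
  interpret vna \<one> M by (unfold_locales) (rule M)
  interpret N: vna z "{a \<in> M. z \<cdot> a = a}"
    by (unfold_locales) (rule corner_von_neumann_algebra[OF M z])
  have zM: "z \<in> M" and za: "\<And>a. a \<in> M \<Longrightarrow> z \<cdot> a = a \<cdot> z"
    using z(2) commutantD by (auto simp: center_def)
  have into: "a \<in> M'" if a: "a \<in> M" "z \<cdot> a = a" "\<And>b. b \<in> M \<Longrightarrow> z \<cdot> b = b \<Longrightarrow> a \<cdot> b = b \<cdot> a" for a
    unfolding commutant_iff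
  proof (intro conjI ballI)
    fix b assume b: "b \<in> M"
    have "z \<cdot> (z \<cdot> b) = z \<cdot> b" by (simp add: is_proj_simps[OF z(1)])
    then have "a \<cdot> (z \<cdot> b) = z \<cdot> b \<cdot> a" using a(3)[of "z \<cdot> b"] zM b by simp
    then show "a \<cdot> b = b \<cdot> a"
      using za[OF a(1)] za[OF b] a(2) by (metis comp_assoc_op)
  qed (use a memD in simp_all)
  have out: "a \<in> commutant z {a \<in> M. z \<cdot> a = a}"
    if "a \<in> M" "z \<cdot> a = a" "a \<in> M'" for a
    unfolding N.commutant_iff
    using memD(1)[OF that(1)] za[OF that(1)] that(2) commutantD[OF that(3)] by simp
  show ?thesis
  proof (intro set_eqI iffI)
    fix a assume "a \<in> center z {a \<in> M. z \<cdot> a = a}"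
    then have a: "a \<in> M" "z \<cdot> a = a" and "a \<in> commutant z {a \<in> M. z \<cdot> a = a}"
      by (simp_all add: center_def)
    then have "a \<in> M'" by (intro into) (simp_all add: N.commutant_iff)
    with a show "a \<in> {a \<in> center \<one> M. z \<cdot> a = a}" by (simp add: center_def)
  next
    fix a assume "a \<in> {a \<in> center \<one> M. z \<cdot> a = a}"
    then have a: "a \<in> M" "z \<cdot> a = a" "a \<in> M'" by (simp_all add: center_def)
    with out[OF a] show "a \<in> center z {a \<in> M. z \<cdot> a = a}" by (simp add: center_def)
  qed
qed

text \<open>A \<open>v\<close> with initial projection \<open>p\<close> satisfies
  \<open>v = v p = v z p = z v\<close>, so it lies in the corner automatically.\<close>

lemma corner_finite_projection:
  assumes M: "von_neumann_algebra \<one> M" and z: "is_proj z" "z \<in> center \<one> M"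
    and p: "z \<cdot> p = p"
  shows "finite_projection {a \<in> M. z \<cdot> a = a} p \<longleftrightarrow> finite_projection M p"
proof -
  interpret vna \<one> M by (unfold_locales) (rule M)
  have za: "\<And>a. a \<in> M \<Longrightarrow> z \<cdot> a = a \<cdot> z" using z(2) commutantD by (auto simp: center_def)
  have "z \<cdot> v = v" if v: "v \<in> M" "adj v \<cdot> v = p" "projection p" for v
  proof -
    have vp: "v\<^sup>\<star> \<cdot> v = p" using v by (simp add: adj_mem)
    have "v = v \<cdot> p" using partial_isometry_cancel(1)[of v] v(3) by (simp add: vp projection_iff)
    then have "v = v \<cdot> z \<cdot> p" using p by (simp add: comp_assoc_op)
    then show ?thesis using za[OF v(1)] \<open>v = v \<cdot> p\<close> by (metis comp_assoc_op)
  qed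
  moreover have "z \<cdot> q = q" if "p \<cdot> q = q" for q using p that by (metis comp_assoc_op)
  ultimately show ?thesis
    unfolding finite_projection_def mvn_equiv_def using p by blast
qed

text \<open>The supremum of the finite central projections is the complement of the projection
  \<open>c\<close> onto their common kernel. If \<open>z\<close> is equivalent to a subprojection
  \<open>q\<close>, cutting down by a finite central \<open>y\<close> gives \<open>y q = y\<close>;
  so \<open>\<one> - q\<close> maps into the common kernel, and \<open>q = z\<close>.\<close>

lemma ex_largest_finite_central_projection:
  assumes M: "von_neumann_algebra \<one> M"
  obtains z where "is_proj z" "z \<in> center \<one> M" "finite_projection M z"
    "\<And>y. is_proj y \<Longrightarrow> y \<in> center \<one> M \<Longrightarrow> finite_projection M y \<Longrightarrow> z \<cdot> y = y"
proof -
  interpret vna \<one> M by (unfold_locales) (rule M)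
  define F where "F = {y. is_proj y \<and> y \<in> center \<one> M \<and> finite_projection M y}"
  have F: "y \<in> M" "is_proj y" and Fcomm: "\<And>a. a \<in> M \<Longrightarrow> y \<cdot> a = a \<cdot> y" "\<And>a. a \<in> M' \<Longrightarrow> y \<cdot> a = a \<cdot> y"
    if "y \<in> F" for y using that centerD[of y] by (auto simp: F_def)
  define S where "S = (\<Inter>y\<in>F. {x. blinfun_apply y x = 0})"
  have "closed S" unfolding S_def
    by (intro closed_INT ballI closed_Collect_eq continuous_intros)
  moreover have "subspace S" by (simp add: subspace_def S_def apply_simps)
  ultimately obtain c where c: "is_proj c" "\<And>x. c x \<in> S" "\<And>x. x \<in> S \<Longrightarrow> c x = x"
    using ex_projection_onto by metis
  have inv: "c \<cdot> a \<cdot> c = a \<cdot> c" if a: "\<And>y. y \<in> F \<Longrightarrow> y \<cdot> a = a \<cdot> y" for a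
  proof (rule blinfun_eqI)
    fix x
    have "y (a (c x)) = 0" if "y \<in> F" for y
    proof -
      have "y (a (c x)) = a (y (c x))" by (rule op_commute_apply[OF a[OF that]])
      then show ?thesis using c(2)[of x] that by (simp add: S_def)
    qed
    then have "a (c x) \<in> S" by (simp add: S_def)
    then show "(c \<cdot> a \<cdot> c) x = (a \<cdot> c) x" by (simp add: c(3))
  qed
  have cM: "c \<in> M"
  proof (rule mem_projI[OF c(1)])
    show "c \<cdot> iop \<cdot> c = iop \<cdot> c"
      by (rule inv) (use F(1) memD(1) in \<open>auto simp: bounded_ops_iff\<close>)
  qed (use inv Fcomm(2) in auto)
  have cc: "c \<cdot> a = a \<cdot> c" if "a \<in> M" for a
    by (rule projection_onto_commutes[OF c(1) inv[OF Fcomm(1)] inv[OF Fcomm(1)]]) (simp_all add: that)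
  define z where "z = \<one> - c"
  have z: "is_proj z" unfolding z_def by (rule is_proj_compl[OF c(1)])
  have zM: "z \<in> M" unfolding z_def by (rule mem_simps(4)[OF mem_simps(1) cM])
  have zcen: "z \<in> center \<one> M"
    using memD[OF zM] cc zM by (auto simp: center_def commutant_iff z_def op_distribs)
  have yc: "y \<cdot> c = 0" if "y \<in> F" for y
    by (rule blinfun_eqI) (use c(2) that in \<open>simp add: S_def\<close>)
  have yz: "y \<cdot> z = y" "z \<cdot> y = y" if "y \<in> F" for y
  proof -
    show "y \<cdot> z = y" using yc[OF that] by (simp add: z_def op_distribs)
    then show "z \<cdot> y = y" using Fcomm(1)[OF that zM] by simp
  qed
  have "finite_projection M z"
    unfolding finite_projection_def
  proof (intro conjI ballI impI)
    show "projection z" "z \<in> M" using z zM memD(1)[OF zM] by (simp_all add: projection_iff)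
    fix q assume qM: "q \<in> M" and "projection q \<and> z \<cdot> q = q \<and> mvn_equiv M z q"
    then obtain v where q: "is_proj q" "z \<cdot> q = q" and v: "v \<in> M" "v\<^sup>\<star> \<cdot> v = z" "v \<cdot> v\<^sup>\<star> = q"
      by (auto simp: projection_iff mvn_equiv_def adj_mem)
    have yq: "y \<cdot> q = y" if y: "y \<in> F" for y
    proof -
      note yp = is_proj_simps[OF F(2)[OF y]]
      have yv: "v \<cdot> y = y \<cdot> v" "v\<^sup>\<star> \<cdot> y = y \<cdot> v\<^sup>\<star>" using Fcomm(1)[OF y] v(1) by simp_all
      have 1: "(y \<cdot> v)\<^sup>\<star> \<cdot> (y \<cdot> v) = y"
        by (simp add: yp yv comp_assoc_op comp_left_op[OF yv(2)] v(2) yz[OF y])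
      have 2: "(y \<cdot> v) \<cdot> (y \<cdot> v)\<^sup>\<star> = y \<cdot> q"
        by (simp add: yp yv comp_assoc_op comp_left_op[OF yv(1)] flip: v(3))
      have yqM: "y \<cdot> q \<in> M" "y \<cdot> v \<in> M" using F(1)[OF y] qM v(1) by simp_all
      have "is_proj (y \<cdot> q)"
        using partial_isometry_cancel(2)[of "y \<cdot> v"] F(2)[OF y] unfolding 1 2 .
      then have "projection (y \<cdot> q)" using memD(1)[OF yqM(1)] by (simp add: projection_iff)
      moreover have "mvn_equiv M y (y \<cdot> q)"
        unfolding mvn_equiv_def using yqM(2) 1 2 by (intro bexI[of _ "y \<cdot> v"]) (simp_all add: adj_mem del: radj_comp)
      moreover have "y \<cdot> (y \<cdot> q) = y \<cdot> q" by (simp add: yp)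
      ultimately show ?thesis
        using y yqM(1) unfolding F_def finite_projection_def by blast
    qed
    have "c \<cdot> (\<one> - q) = \<one> - q"
    proof (rule blinfun_eqI)
      fix x
      have "y ((\<one> - q) x) = 0" if "y \<in> F" for y
      proof -
        have "y \<cdot> (\<one> - q) = 0" using yq[OF that] by (simp add: op_distribs)
        then show ?thesis by (metis blinfun.zero_left blinfun_apply_blinfun_compose)
      qed
      then have "(\<one> - q) x \<in> S" by (simp add: S_def)
      then show "(c \<cdot> (\<one> - q)) x = (\<one> - q) x" by (simp add: c(3))
    qed
    moreover have "c \<cdot> q = 0" using q(2) by (simp add: z_def op_distribs)
    ultimately have "c = \<one> - q" by (simp add: op_distribs)
    then show "q = z" by (simp add: z_def)
  qed
  then show ?thesis using that[OF z zcen] yz(2) by (simp add: F_def)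
qed

section \<open>Corners with trivial central projections\<close>

text \<open>After scaling to \<open>0 \<le> b \<le> \<one>\<close>, apply
  \<open>b\<^sup>2 \<le> b\<close>.\<close>

lemma pos_op_vector_zero:
  assumes b: "pos_op b" and "inner (b \<eta>) \<eta> = 0"
  shows "b \<eta> = 0"
proof -
  define r where "r = inverse (norm b + 1)"
  have pos: "norm b + 1 > 0" using norm_ge_zero[of b] by linarith
  then have r: "r > 0" "norm (r *\<^sub>R b) \<le> 1" by (simp_all add: r_def field_simps)
  have rb: "pos_op (r *\<^sub>R b)" using r b by (simp add: pos_op_scaleR)
  have "inner ((r *\<^sub>R b) x) x \<le> inner x x" for x
  proof -
    have "inner ((r *\<^sub>R b) x) x \<le> norm ((r *\<^sub>R b) x) * norm x" by (rule norm_cauchy_schwarz)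
    also have "\<dots> \<le> norm (r *\<^sub>R b) * norm x * norm x" by (intro mult_right_mono norm_blinfun) simp
    also have "\<dots> \<le> 1 * norm x * norm x" by (intro mult_right_mono r) simp_all
    finally show ?thesis by (simp add: power2_norm_eq_inner[symmetric] power2_eq_square)
  qed
  then have "pos_op (\<one> - r *\<^sub>R b)"
    using pos_opD(1)[OF rb] by (simp add: pos_op_def blinfun.diff_left inner_diff_left)
  from pos_op_contraction_sq[OF rb this, of \<eta>] have "(norm ((r *\<^sub>R b) \<eta>))\<^sup>2 \<le> 0"
    using assms(2) by (simp add: apply_simps)
  then show ?thesis using r by (simp add: apply_simps)
qed

text \<open>The goal is that minimality of \<open>c\<close> among central projections makes the
  center of its corner scalar. Order arguments take the place of spectral projections.\<close>

context
  fixes M :: "('h::complex_hilbert_space \<Rightarrow>\<^sub>L 'h) set" and c :: "'h \<Rightarrow>\<^sub>L 'h"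
  assumes M: "von_neumann_algebra \<one> M" and c: "is_proj c" "c \<in> center \<one> M"
    and minimal: "\<And>d. is_proj d \<Longrightarrow> d \<in> center \<one> M \<Longrightarrow> c \<cdot> d = d \<Longrightarrow> d = 0 \<or> d = c"
begin

text \<open>Since \<open>b\<close> is central, \<open>b k = 0\<close> gives \<open>b m k = 0\<close>
  for all \<open>m\<close>. The separating central projection \<open>z\<close> has
  \<open>c z = 0\<close> or \<open>c z = c\<close>, which kills \<open>k\<close> or
  \<open>b\<close>.\<close>

lemma central_no_zero_divisors:
  assumes b: "b \<in> center \<one> M" "c \<cdot> b = b" and k: "k \<in> M" "c \<cdot> k = k" and bk: "b \<cdot> k = 0"
  shows "b = 0 \<or> k = 0"
proof -
  interpret vna \<one> M by (unfold_locales) (rule M)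
  have bM: "b \<in> M" and bc: "\<And>m. m \<in> M \<Longrightarrow> b \<cdot> m = m \<cdot> b" using b commutantD by (auto simp: center_def)
  have cM: "c \<in> M" and cc: "\<And>m. m \<in> M \<Longrightarrow> c \<cdot> m = m \<cdot> c" "\<And>m. m \<in> M' \<Longrightarrow> c \<cdot> m = m \<cdot> c"
    using centerD[OF c(2)] by auto
  have "b \<cdot> m \<cdot> k = 0" if "m \<in> M" for m using bc[OF that] bk by (simp add: comp_assoc_op)
  then obtain z where z: "is_proj z" "z \<in> center \<one> M" "z \<cdot> k = k" "b \<cdot> z = 0"
    using ex_central_projection[OF k(1) bM] by blast
  have zM: "z \<in> M" and zc: "\<And>m. m \<in> M \<Longrightarrow> z \<cdot> m = m \<cdot> z" "\<And>m. m \<in> M' \<Longrightarrow> z \<cdot> m = m \<cdot> z"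
    using centerD[OF z(2)] by auto
  have "is_proj (c \<cdot> z)"
    unfolding is_proj_def
    by (simp add: is_proj_simps[OF c(1)] is_proj_simps[OF z(1)] zc(1)[OF cM]
        comp_left_op[OF zc(1)[OF cM]] comp_assoc_op)
  moreover have "c \<cdot> z \<in> center \<one> M"
  proof -
    have "c \<cdot> z \<cdot> a = a \<cdot> (c \<cdot> z)" if "a \<in> M" for a
      using cc(1)[OF that] zc(1)[OF that] by (metis comp_assoc_op)
    then show ?thesis using cM zM memD(1)[OF mem_comp[OF cM zM]] by (simp add: center_def commutant_iff)
  qed
  moreover have "c \<cdot> (c \<cdot> z) = c \<cdot> z" by (simp add: is_proj_simps[OF c(1)])
  ultimately have "c \<cdot> z = 0 \<or> c \<cdot> z = c" by (rule minimal)
  then show ?thesis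
  proof
    assume "c \<cdot> z = 0"
    then have "c \<cdot> z \<cdot> k = 0" by simp
    then show ?thesis using z(3) k(2) by (simp add: comp_assoc_op)
  next
    assume "c \<cdot> z = c"
    then have "b \<cdot> (c \<cdot> z) = b \<cdot> c" by simp
    moreover have "b \<cdot> (c \<cdot> z) = c \<cdot> (b \<cdot> z)" using cc(1)[OF bM] by (metis comp_assoc_op)
    moreover have "b \<cdot> c = b" using cc(1)[OF bM] b(2) by simp
    ultimately show ?thesis using z(4) by simp
  qed
qed

text \<open>The projection \<open>k\<close> onto the part of the kernel of \<open>b\<close> inside
  the range of \<open>c\<close> lies in \<open>M\<close>, is annihilated by \<open>b\<close> and
  fixes \<open>\<eta>\<close>.\<close>

lemma central_injective:
  assumes b: "b \<in> center \<one> M" "c \<cdot> b = b" and \<eta>: "c \<eta> = \<eta>" "\<eta> \<noteq> 0" "b \<eta> = 0"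
  shows "b = 0"
proof -
  interpret vna \<one> M by (unfold_locales) (rule M)
  have bM: "b \<in> M" and cM: "c \<in> M" using b c by (auto simp: center_def)
  obtain v where vM: "v \<in> M" and v: "is_proj (v\<^sup>\<star> \<cdot> v)" and ker: "\<And>x. v x = 0 \<longleftrightarrow> b x = 0"
    using ex_polar_mem[OF bM] by metis
  define k where "k = (\<one> - v\<^sup>\<star> \<cdot> v) \<cdot> c"
  have "k \<eta> = \<eta>" using \<eta> ker[of \<eta>] by (simp add: k_def apply_simps)
  then have "k \<noteq> 0" using \<eta>(2) by auto
  have "\<one> - v\<^sup>\<star> \<cdot> v \<in> M" using vM by (intro mem_simps(4) mem_simps(1)) simp
  then have kM: "k \<in> M" and ck: "c \<cdot> (\<one> - v\<^sup>\<star> \<cdot> v) = (\<one> - v\<^sup>\<star> \<cdot> v) \<cdot> c"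
    using cM c(2) commutantD by (auto simp: k_def center_def)
  have "c \<cdot> k = k" using ck by (metis k_def comp_assoc_op is_projD(1)[OF c(1)])
  moreover have "b \<cdot> k = 0"
  proof (rule blinfun_eqI)
    fix x
    have "v \<cdot> (\<one> - v\<^sup>\<star> \<cdot> v) = 0" using partial_isometry_cancel(1)[OF v] by (simp add: op_distribs)
    then have "v (k x) = 0" unfolding k_def by (metis blinfun.zero_left blinfun_apply_blinfun_compose)
    then show "(b \<cdot> k) x = blinfun_apply 0 x" using ker by simp
  qed
  ultimately show ?thesis using central_no_zero_divisors[OF b kM] \<open>k \<noteq> 0\<close> by blast
qed

text \<open>For \<open>g = \<bar>b\<bar>\<close> the product \<open>(g - b) (g + b)\<close> vanishes.\<close>

lemma central_definite:
  assumes b: "b \<in> center \<one> M" "c \<cdot> b = b" "b\<^sup>\<star> = b"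
  shows "pos_op b \<or> pos_op (- b)"
proof -
  interpret vna \<one> M by (unfold_locales) (rule M)
  define r where "r = inverse (norm b + 1)"
  define a where "a = r *\<^sub>R b"
  have pos: "norm b + 1 > 0" using norm_ge_zero[of b] by linarith
  then have r: "r > 0" and na: "norm a \<le> 1" by (simp_all add: a_def r_def field_simps)
  have bM: "b \<in> M" and bc: "\<And>m. m \<in> M \<Longrightarrow> b \<cdot> m = m \<cdot> b" "\<And>m. m \<in> M' \<Longrightarrow> b \<cdot> m = m \<cdot> b"
    using centerD[OF b(1)] by auto
  have aM: "a \<in> M" and ac: "\<And>m. m \<in> M \<Longrightarrow> a \<cdot> m = m \<cdot> a" "\<And>m. m \<in> M' \<Longrightarrow> a \<cdot> m = m \<cdot> a"
    and ca: "c \<cdot> a = a" and as: "a\<^sup>\<star> = a"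
    using bM bc b by (simp_all add: a_def op_distribs)
  have aa: "pos_op (a \<cdot> a)" "pos_op (\<one> - a \<cdot> a)"
    using pos_op_radj_comp[of a] pos_op_one_minus_radj_comp[OF na] by (simp_all add: as)
  \<comment> \<open>\<open>ex_sqrt_compl\<close> takes roots of \<open>\<one> - h\<close>; with
    \<open>h = \<one> - a a\<close> it returns the modulus \<open>g\<close> of
    \<open>a\<close>.\<close>
  then have "pos_op (\<one> - (\<one> - a \<cdot> a))" by simp
  from ex_sqrt_compl[OF aa(2) this] obtain g where g: "pos_op g" "g \<cdot> g = a \<cdot> a"
    and gc: "\<And>m. m \<cdot> (\<one> - a \<cdot> a) = (\<one> - a \<cdot> a) \<cdot> m \<Longrightarrow> m \<cdot> g = g \<cdot> m"
    by (metis (no_types, lifting) diff_diff_eq2 add_diff_cancel_left')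
  have comm: "m \<cdot> g = g \<cdot> m" if "a \<cdot> m = m \<cdot> a" for m
  proof (rule gc)
    have "a \<cdot> a \<cdot> m = m \<cdot> (a \<cdot> a)" using that by (metis comp_assoc_op)
    then show "m \<cdot> (\<one> - a \<cdot> a) = (\<one> - a \<cdot> a) \<cdot> m" by (simp add: op_distribs)
  qed
  have gM: "g \<in> M"
  proof (rule memI)
    show "g \<in> bounded_ops" unfolding bounded_ops_iff
      by (rule comm) (use memD(1)[OF aM] in \<open>simp add: bounded_ops_iff\<close>)
  qed (use comm ac(2) in simp_all)
  have cM: "c \<in> M" using c by (simp add: center_def)
  have gs: "g\<^sup>\<star> = g" by (rule pos_opD(1)[OF g(1)])
  \<comment> \<open>The modulus vanishes off \<open>c\<close>, so \<open>g - a\<close> and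
    \<open>g + a\<close> belong to the corner.\<close>
  have "(g \<cdot> (\<one> - c))\<^sup>\<star> \<cdot> (g \<cdot> (\<one> - c)) = (\<one> - c) \<cdot> (g \<cdot> g) \<cdot> (\<one> - c)"
    by (simp add: gs is_projD[OF c(1)] comp_assoc_op)
  also have "\<dots> = 0" unfolding g(2) by (simp add: op_distribs ca comp_assoc_op[symmetric])
  finally have "g \<cdot> (\<one> - c) = 0" by (simp only: radj_comp_self_eq_0_iff)
  then have "g \<cdot> c = g" by (simp add: op_distribs)
  then have cg: "c \<cdot> g = g" using comm[OF ac(1)[OF cM]] by simp
  have "(g - a) \<in> center \<one> M"
  proof -
    have "(g - a) \<cdot> m = m \<cdot> (g - a)" if "m \<in> M" for m
      using comm[OF ac(1)[OF that]] ac(1)[OF that] by (simp add: op_distribs)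
    then show ?thesis using gM aM memD(1)[OF mem_simps(4)[OF gM aM]] by (simp add: center_def commutant_iff)
  qed
  moreover have "c \<cdot> (g - a) = g - a" "c \<cdot> (g + a) = g + a" by (simp_all add: op_distribs cg ca)
  moreover have "(g - a) \<cdot> (g + a) = 0"
    using comm[of a] by (simp add: op_distribs g(2))
  ultimately have "g - a = 0 \<or> g + a = 0"
    using central_no_zero_divisors[of "g - a" "g + a"] gM aM by simp
  then have "pos_op a \<or> pos_op (- a)"
    using g(1) by (metis add.commute eq_neg_iff_add_eq_0 eq_iff_diff_eq_0)
  then have "pos_op ((norm b + 1) *\<^sub>R a) \<or> pos_op ((norm b + 1) *\<^sub>R (- a))"
    using pos_op_scaleR pos by (meson less_imp_le)
  then show ?thesis using pos by (simp add: a_def r_def)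
qed

text \<open>Subtract from \<open>b\<close> the multiple of \<open>c\<close> by its mean value at a
  vector \<open>\<eta>\<close> in the range of \<open>c\<close>. The difference is definite with
  vanishing form at \<open>\<eta>\<close>, so it annihilates \<open>\<eta>\<close>, and injectivity
  makes it zero.\<close>

lemma central_self_adjoint_scalar:
  assumes b: "b \<in> center \<one> M" "c \<cdot> b = b" "b\<^sup>\<star> = b"
  shows "\<exists>r. b = r *\<^sub>R c"
proof (cases "c = 0")
  case True
  then show ?thesis using b(2) by simp
next
  case False
  interpret vna \<one> M by (unfold_locales) (rule M)
  obtain x where "c x \<noteq> 0" using False by (metis blinfun_eqI blinfun.zero_left)
  define \<eta> where "\<eta> = c x"
  have \<eta>: "c \<eta> = \<eta>" "\<eta> \<noteq> 0" using \<open>c x \<noteq> 0\<close> by (simp_all add: \<eta>_def is_projD(3)[OF c(1)])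
  define r where "r = inner (b \<eta>) \<eta> / inner \<eta> \<eta>"
  define a where "a = b - r *\<^sub>R c"
  have bM: "b \<in> M" and bc: "\<And>m. m \<in> M \<Longrightarrow> b \<cdot> m = m \<cdot> b"
    using b commutantD by (auto simp: center_def)
  have cM: "c \<in> M" and cc: "\<And>m. m \<in> M \<Longrightarrow> c \<cdot> m = m \<cdot> c" using c commutantD by (auto simp: center_def)
  have aM: "a \<in> M" using bM cM by (simp add: a_def)
  have "a \<cdot> m = m \<cdot> a" if "m \<in> M" for m
    using bc[OF that] cc[OF that] by (simp add: a_def op_distribs)
  then have a: "a \<in> center \<one> M" using aM memD(1)[OF aM] by (simp add: center_def commutant_iff)
  have ca: "c \<cdot> a = a" and as: "a\<^sup>\<star> = a"
    by (simp_all add: a_def op_distribs b is_projD[OF c(1)])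
  have a\<eta>: "inner (a \<eta>) \<eta> = 0" using \<eta> by (simp add: a_def r_def apply_simps inner_diff)
  from central_definite[OF a ca as] have "a \<eta> = 0"
  proof
    assume "pos_op a"
    then show ?thesis by (rule pos_op_vector_zero[OF _ a\<eta>])
  next
    assume "pos_op (- a)"
    then have "(- a) \<eta> = 0" by (rule pos_op_vector_zero) (use a\<eta> in \<open>simp add: apply_simps\<close>)
    then show ?thesis by (simp add: apply_simps)
  qed
  then have "a = 0" using central_injective[OF a ca \<eta>] by blast
  then show ?thesis unfolding a_def by (intro exI[of _ r]) simp
qed

lemma corner_factor: "factor c {a \<in> M. c \<cdot> a = a}"
  unfolding factor_def corner_center[OF M c]
proof (intro conjI set_eqI iffI)
  interpret vna \<one> M by (unfold_locales) (rule M)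
  have cM: "c \<in> M" and cc: "\<And>m. m \<in> M \<Longrightarrow> c \<cdot> m = m \<cdot> c" using c commutantD by (auto simp: center_def)
  show "von_neumann_algebra c {a \<in> M. c \<cdot> a = a}" by (rule corner_von_neumann_algebra[OF M c])
  fix T
  {
    assume T: "T \<in> {a \<in> center \<one> M. c \<cdot> a = a}"
    have TM: "T \<in> M" and Tc: "\<And>m. m \<in> M \<Longrightarrow> T \<cdot> m = m \<cdot> T"
      using T commutantD by (auto simp: center_def)
    have Ts: "T\<^sup>\<star> \<cdot> m = m \<cdot> T\<^sup>\<star>" if "m \<in> M" for m
    proof -
      have "(T \<cdot> m\<^sup>\<star>)\<^sup>\<star> = (m\<^sup>\<star> \<cdot> T)\<^sup>\<star>" using Tc[of "m\<^sup>\<star>"] that by simp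
      then show ?thesis by simp
    qed
    have cT: "c \<cdot> T = T" using T by simp
    have cTs: "c \<cdot> T\<^sup>\<star> = T\<^sup>\<star>" using arg_cong[OF cT, of radj] cc[of "T\<^sup>\<star>"] TM by (simp add: is_projD[OF c(1)])
    have i: "iop \<cdot> m = m \<cdot> iop" if "m \<in> M" for m using memD(1)[OF that] by (simp add: bounded_ops_iff)
    \<comment> \<open>Twice the real and imaginary parts of \<open>T\<close>, to which the
      self-adjoint case applies.\<close>
    define A B where "A = T + T\<^sup>\<star>" and "B = iop \<cdot> (T\<^sup>\<star> - T)"
    have AM: "A \<in> M" "B \<in> M" using TM by (simp_all add: A_def B_def)
    have "A \<cdot> m = m \<cdot> A" if "m \<in> M" for m using Tc[OF that] Ts[OF that] by (simp add: A_def op_distribs)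
    then have A: "A \<in> center \<one> M" using AM memD(1)[OF AM(1)] by (simp add: center_def commutant_iff)
    have "B \<cdot> m = m \<cdot> B" if "m \<in> M" for m
    proof -
      have "(T\<^sup>\<star> - T) \<cdot> m = m \<cdot> (T\<^sup>\<star> - T)" using Tc[OF that] Ts[OF that] by (simp add: op_distribs)
      then show ?thesis unfolding B_def using i[OF that] by (metis comp_assoc_op)
    qed
    then have B: "B \<in> center \<one> M" using AM memD(1)[OF AM(2)] by (simp add: center_def commutant_iff)
    obtain r where r: "A = r *\<^sub>R c"
      using central_self_adjoint_scalar[OF A] cT cTs by (auto simp: A_def op_distribs add.commute)
    have "B\<^sup>\<star> = B" using i[OF TM] i[of "T\<^sup>\<star>"] TM by (simp add: B_def iop_radj op_distribs)
    moreover have "c \<cdot> B = B"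
    proof -
      have "c \<cdot> (T\<^sup>\<star> - T) = T\<^sup>\<star> - T" by (simp add: op_distribs cT cTs)
      then show ?thesis unfolding B_def using i[OF cM] by (metis comp_assoc_op)
    qed
    ultimately obtain q where q: "B = q *\<^sub>R c" using central_self_adjoint_scalar[OF B] by blast
    have "2 *\<^sub>R T = A + iop \<cdot> B"
      by (simp add: A_def B_def comp_assoc_op[symmetric] iop_iop op_distribs scaleR_2)
    then have "T = (1/2) *\<^sub>R (A + iop \<cdot> B)" by (metis scaleR_half_double scaleR_2 scaleR_add_right)
    then have "T x = scaleC (Complex (r/2) (q/2)) (c x)" for x
      by (simp add: r q scaleC_eq[of "Complex (r/2) (q/2)"] apply_simps op_distribs scaleR_add_right)
    then show "T \<in> {T. \<exists>k. \<forall>x. blinfun_apply T x = scaleC k (c x)}" by blast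
  next
    assume "T \<in> {T. \<exists>k. \<forall>x. blinfun_apply T x = scaleC k (c x)}"
    then obtain k where k: "\<And>x. T x = scaleC k (c x)" by blast
    have T: "T = Re k *\<^sub>R c + Im k *\<^sub>R (iop \<cdot> c)"
      by (rule blinfun_eqI) (simp add: k scaleC_eq[of k] apply_simps)
    have TM: "T \<in> M" using cM by (simp add: T)
    have "T \<cdot> m = m \<cdot> T" if m: "m \<in> M" for m
    proof -
      have "iop \<cdot> c \<cdot> m = m \<cdot> (iop \<cdot> c)"
        using cc[OF m] memD(1)[OF m] by (metis bounded_ops_iff comp_assoc_op)
      then show ?thesis unfolding T using cc[OF m] by (simp add: op_distribs)
    qed
    then have "T \<in> center \<one> M" using TM memD(1)[OF TM] by (simp add: center_def commutant_iff)
    moreover have "c \<cdot> T = T"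
    proof -
      have "c \<cdot> (iop \<cdot> c) = iop \<cdot> c"
        using memD(1)[OF cM] is_projD(1)[OF c(1)] by (metis bounded_ops_iff comp_assoc_op)
      then show ?thesis by (simp add: T op_distribs is_projD[OF c(1)])
    qed
    ultimately show "T \<in> {a \<in> center \<one> M. c \<cdot> a = a}" by simp
  }
qed

end

section \<open>The characterization\<close>

lemma infinite_projection_witness:
  assumes M: "von_neumann_algebra \<one> M" and d: "is_proj d" "d \<in> M" and inf: "\<not> finite_projection M d"
  obtains v where "v \<in> M" "v\<^sup>\<star> \<cdot> v = d" "d \<cdot> (v \<cdot> v\<^sup>\<star>) = v \<cdot> v\<^sup>\<star>" "v \<cdot> v\<^sup>\<star> \<noteq> d"
    "d \<cdot> v = v" "v \<cdot> d = v"
proof -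
  interpret vna \<one> M by (unfold_locales) (rule M)
  obtain q where "q \<in> M" "projection q" "d \<cdot> q = q" "mvn_equiv M d q" "q \<noteq> d"
    using inf d memD(1)[OF d(2)] by (auto simp: finite_projection_def projection_iff)
  then obtain v where v: "v \<in> M" "v\<^sup>\<star> \<cdot> v = d" "v \<cdot> v\<^sup>\<star> = q" "d \<cdot> q = q" "q \<noteq> d"
    by (auto simp: mvn_equiv_def adj_mem)
  have vd: "v \<cdot> d = v" using partial_isometry_cancel(1)[of v] d(1) by (simp add: v)
  have "v = q \<cdot> v" using vd unfolding v(2,3)[symmetric] by (simp add: comp_assoc_op)
  then have "d \<cdot> v = v" using v(4) by (metis comp_assoc_op)
  then show ?thesis using that[of v] v vd by simp
qed

lemma no_orthogonal_infinite_projections: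
  assumes M: "von_neumann_algebra \<one> M"
    and ext: "\<And>x. cstar_extreme_point \<one> M x \<Longrightarrow> isometry_in \<one> M x \<or> coisometry_in \<one> M x"
    and d: "is_proj d" "d \<in> center \<one> M" and d': "is_proj d'" "d' \<in> M" and dd': "d \<cdot> d' = 0"
    and inf: "\<not> finite_projection M d" "\<not> finite_projection M d'"
  shows False
proof -
  interpret vna \<one> M by (unfold_locales) (rule M)
  have dM: "d \<in> M" and dc: "\<And>a. a \<in> M \<Longrightarrow> a \<cdot> d = d \<cdot> a" using d commutantD by (auto simp: center_def)
  have d'd: "d' \<cdot> d = 0" using dc[OF d'(2)] dd' by simp
  obtain v where v: "v \<in> M" "v\<^sup>\<star> \<cdot> v = d" "d \<cdot> (v \<cdot> v\<^sup>\<star>) = v \<cdot> v\<^sup>\<star>" "v \<cdot> v\<^sup>\<star> \<noteq> d" "d \<cdot> v = v" "v \<cdot> d = v"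
    using infinite_projection_witness[OF M d(1) dM inf(1)] by blast
  obtain w where w: "w \<in> M" "w\<^sup>\<star> \<cdot> w = d'" "d' \<cdot> (w \<cdot> w\<^sup>\<star>) = w \<cdot> w\<^sup>\<star>" "w \<cdot> w\<^sup>\<star> \<noteq> d'" "d' \<cdot> w = w" "w \<cdot> d' = w"
    using infinite_projection_witness[OF M d' inf(2)] by blast
  \<comment> \<open>The identity on what \<open>d\<close> and \<open>d'\<close> leave over. It
    enters both \<open>x\<^sup>\<star> x\<close> and \<open>x x\<^sup>\<star>\<close>, so only
    \<open>w\<close> and \<open>v\<close> produce defects.\<close>
  define z where "z = \<one> - d - d'"
  define x where "x = v + w\<^sup>\<star> + z"
  note dp = is_proj_simps[OF d(1)] and d'p = is_proj_simps[OF d'(1)]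
  have vs: "v\<^sup>\<star> \<cdot> d = v\<^sup>\<star>" "d \<cdot> v\<^sup>\<star> = v\<^sup>\<star>" "w\<^sup>\<star> \<cdot> d' = w\<^sup>\<star>" "d' \<cdot> w\<^sup>\<star> = w\<^sup>\<star>"
    using arg_cong[OF v(5), of radj] arg_cong[OF v(6), of radj]
      arg_cong[OF w(5), of radj] arg_cong[OF w(6), of radj] by (simp_all add: dp d'p)
  have cross: "v \<cdot> d' = 0" "d' \<cdot> v = 0" "v\<^sup>\<star> \<cdot> d' = 0" "d' \<cdot> v\<^sup>\<star> = 0"
    "w \<cdot> d = 0" "d \<cdot> w = 0" "w\<^sup>\<star> \<cdot> d = 0" "d \<cdot> w\<^sup>\<star> = 0"
    using v(5,6) w(5,6) vs dd' d'd by (metis comp_assoc_op blinfun_compose_zero)+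
  have vw: "v \<cdot> w = 0" "w \<cdot> v = 0" "v \<cdot> w\<^sup>\<star> = 0" "w\<^sup>\<star> \<cdot> v = 0" "v\<^sup>\<star> \<cdot> w\<^sup>\<star> = 0" "w\<^sup>\<star> \<cdot> v\<^sup>\<star> = 0" "w \<cdot> v\<^sup>\<star> = 0" "v\<^sup>\<star> \<cdot> w = 0"
    using v(5,6) w(5,6) vs cross by (metis comp_assoc_op blinfun_compose_zero)+
  have z: "z\<^sup>\<star> = z" "z \<cdot> z = z" "z \<cdot> v = 0" "v \<cdot> z = 0" "z \<cdot> w = 0" "w \<cdot> z = 0"
     "z \<cdot> v\<^sup>\<star> = 0" "v\<^sup>\<star> \<cdot> z = 0" "z \<cdot> w\<^sup>\<star> = 0" "w\<^sup>\<star> \<cdot> z = 0"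
    by (simp_all add: z_def op_simps dp d'p dd' d'd v w vs cross)
  have xx: "x\<^sup>\<star> \<cdot> x = d + w \<cdot> w\<^sup>\<star> + z" and xx': "x \<cdot> x\<^sup>\<star> = v \<cdot> v\<^sup>\<star> + d' + z"
    by (simp_all add: x_def op_distribs z vw v(2) w(2))
  have zM: "z \<in> M" unfolding z_def by (intro mem_simps(4) mem_simps(1) dM d')
  have xM: "x \<in> M" using v w zM by (simp add: x_def)
  have wd: "w \<cdot> w\<^sup>\<star> \<cdot> d = 0" and vd: "v \<cdot> v\<^sup>\<star> \<cdot> d = v \<cdot> v\<^sup>\<star>" and zd: "z \<cdot> d = 0"
    using cross vs by (simp_all add: comp_assoc_op z_def op_distribs dp d'd)
  have "is_proj (x\<^sup>\<star> \<cdot> x)"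
  proof -
    have "is_proj (w \<cdot> w\<^sup>\<star>)" by (rule partial_isometry_cancel) (simp add: w(2) d')
    note wp = is_projD(1)[OF this]
    have "z \<cdot> (w \<cdot> w\<^sup>\<star>) = 0" "w \<cdot> w\<^sup>\<star> \<cdot> z = 0" "d \<cdot> (w \<cdot> w\<^sup>\<star>) = 0" "d \<cdot> z = 0"
      using z cross zd dc[OF zM] by (simp_all add: comp_assoc_op comp_left_op[OF z(5)] comp_left_op[OF cross(6)])
    then show ?thesis unfolding is_proj_def xx
      by (simp add: op_distribs z wp wd zd dp)
  qed
  then have nx: "norm x \<le> 1" by (rule norm_le_one_if_radj_comp_proj)
  have "cstar_extreme_point \<one> M x"
    by (rule isometry_coisometry_cstar_extreme[OF M d xM nx])
      (simp_all add: xx xx' op_distribs wd vd zd dp d'd z_def)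
  from ext[OF this] show False
  proof
    assume "isometry_in \<one> M x"
    then have "d + w \<cdot> w\<^sup>\<star> + z = \<one>" using xx by (simp add: isometry_iff)
    then show False using w(4) by (simp add: z_def)
  next
    assume "coisometry_in \<one> M x"
    then have "v \<cdot> v\<^sup>\<star> + d' + z = \<one>" using xx' by (simp add: coisometry_iff)
    then show False using v(4) by (simp add: z_def)
  qed
qed

text \<open>No nonzero finite central projection lies below the complement \<open>c\<close> of the
  largest one. A central splitting of \<open>c\<close> would give two orthogonal infinite
  projections, so \<open>c\<close> is minimal. When \<open>z = 0\<close> the finite summand is the
  zero algebra, which covers the properly infinite factors.\<close>

lemma finite_or_direct_sum:
  fixes M :: "('h::complex_hilbert_space \<Rightarrow>\<^sub>L 'h) set"
  assumes M: "von_neumann_algebra \<one> M"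
    and ext: "\<And>x. cstar_extreme_point \<one> M x \<Longrightarrow> isometry_in \<one> M x \<or> coisometry_in \<one> M x"
  shows "finite_vna \<one> M \<or> (\<exists>f N g L. is_direct_sum \<one> M f N g L \<and>
          finite_vna f N \<and> properly_infinite_vna g L \<and> factor g L)"
proof -
  interpret vna \<one> M by (unfold_locales) (rule M)
  obtain z where z: "is_proj z" "z \<in> center \<one> M" and fin: "finite_projection M z"
    and max: "\<And>y. is_proj y \<Longrightarrow> y \<in> center \<one> M \<Longrightarrow> finite_projection M y \<Longrightarrow> z \<cdot> y = y"
    using ex_largest_finite_central_projection[OF M] by blast
  have zM: "z \<in> M" and zc: "\<And>a. a \<in> M \<Longrightarrow> z \<cdot> a = a \<cdot> z"
    using z(2) commutantD by (auto simp: center_def)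
  define c where "c = \<one> - z"
  have c: "is_proj c" unfolding c_def by (rule is_proj_compl[OF z(1)])
  have cM: "c \<in> M" unfolding c_def by (rule mem_simps(4)[OF mem_simps(1) zM])
  have ccom: "c \<cdot> a = a \<cdot> c" if "a \<in> M" for a using zc[OF that] by (simp add: c_def op_distribs)
  then have ccen: "c \<in> center \<one> M" using cM memD(1)[OF cM] by (simp add: center_def commutant_iff)
  have zc0: "z \<cdot> c = 0" "c \<cdot> z = 0" by (simp_all add: c_def op_distribs is_projD[OF z(1)])
  have infinite: "\<not> finite_projection M d" if "is_proj d" "d \<in> center \<one> M" "c \<cdot> d = d" "d \<noteq> 0" for d
  proof
    assume "finite_projection M d"
    then have "z \<cdot> d = d" using max that by blast
    then have "c \<cdot> d = 0" by (simp add: c_def op_distribs)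
    then show False using that by simp
  qed
  have minimal: "d = 0 \<or> d = c" if d: "is_proj d" "d \<in> center \<one> M" "c \<cdot> d = d" for d
  proof (rule ccontr)
    assume nt: "\<not> ?thesis"
    have dM: "d \<in> M" and dc: "\<And>a. a \<in> M \<Longrightarrow> a \<cdot> d = d \<cdot> a" using d(2) commutantD by (auto simp: center_def)
    have dc': "d \<cdot> c = d" using dc[OF cM] d(3) by simp
    have e: "is_proj (c - d)"
      by (simp add: is_proj_def op_distribs is_proj_simps[OF c] is_proj_simps[OF d(1)] d(3) dc')
    have eM: "c - d \<in> M" using cM dM by simp
    have "(c - d) \<cdot> a = a \<cdot> (c - d)" if "a \<in> M" for a
      using ccom[OF that] dc[OF that] by (simp add: op_distribs)
    then have "c - d \<in> center \<one> M" using eM memD(1)[OF eM] by (simp add: center_def commutant_iff)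
    moreover have "c \<cdot> (c - d) = c - d" by (simp add: op_distribs is_projD[OF c] d(3))
    moreover have "c - d \<noteq> 0" using nt by auto
    ultimately have "\<not> finite_projection M (c - d)" by (rule infinite[OF e])
    moreover have "d \<cdot> (c - d) = 0" by (simp add: op_distribs is_projD[OF d(1)] dc')
    ultimately show False
      using no_orthogonal_infinite_projections[OF M ext d(1,2) e eM] infinite[OF d] nt by blast
  qed
  show ?thesis
  proof (cases "c = 0")
    case True
    then have "z = \<one>" by (simp add: c_def)
    then show ?thesis using fin M by (simp add: finite_vna_def)
  next
    case False
    let ?N = "{a \<in> M. z \<cdot> a = a}" and ?L = "{a \<in> M. c \<cdot> a = a}"
    have "is_direct_sum \<one> M z ?N c ?L"
      unfolding is_direct_sum_def
    proof (intro conjI set_eqI iffI)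
      show "z \<cdot> c = 0" by (rule zc0)
      show "\<one> = z + c" by (simp add: c_def)
      fix a
      {
        assume a: "a \<in> M"
        have "a = z \<cdot> a + c \<cdot> a" by (simp add: c_def op_distribs)
        moreover have "z \<cdot> a \<in> ?N" "c \<cdot> a \<in> ?L"
          using a zM cM by (simp_all add: is_proj_simps[OF z(1)] is_proj_simps[OF c])
        ultimately show "a \<in> {a + b |a b. a \<in> ?N \<and> b \<in> ?L}" by blast
      next
        assume "a \<in> {a + b |a b. a \<in> ?N \<and> b \<in> ?L}"
        then show "a \<in> M" by auto
      }
    qed
    moreover have "finite_vna z ?N"
      unfolding finite_vna_def
      using corner_von_neumann_algebra[OF M z] corner_finite_projection[OF M z, of z] fin
      by (simp add: is_projD[OF z(1)])
    moreover have "factor c ?L" by (rule corner_factor[OF M c ccen minimal])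
    moreover have "properly_infinite_vna c ?L"
      unfolding properly_infinite_vna_def corner_center[OF M c ccen]
    proof (intro conjI ballI impI)
      show "von_neumann_algebra c ?L" by (rule corner_von_neumann_algebra[OF M c ccen])
      show "\<not> finite_projection ?L c"
        using infinite[OF c ccen _ False] corner_finite_projection[OF M c ccen, of c]
        by (simp add: is_projD[OF c])
      fix d assume "d \<in> {a \<in> center \<one> M. c \<cdot> a = a}" "projection d \<and> d \<noteq> 0"
      then show "\<not> finite_projection ?L d"
        using infinite[of d] corner_finite_projection[OF M c ccen, of d] by (simp add: projection_iff)
    qed
    ultimately show ?thesis by blast
  qed
qed

theorem theorem4p9:
  fixes M :: "('h::complex_hilbert_space \<Rightarrow>\<^sub>L 'h) set"
  assumes "von_neumann_algebra id_blinfun M"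
  shows "(\<forall>x. cstar_extreme_point id_blinfun M x \<longrightarrow>
            isometry_in id_blinfun M x \<or> coisometry_in id_blinfun M x)
     \<longleftrightarrow>
       finite_vna id_blinfun M \<or>
       (properly_infinite_vna id_blinfun M \<and> factor id_blinfun M) \<or>
       (\<exists>f N g L. is_direct_sum id_blinfun M f N g L \<and>
          finite_vna f N \<and> properly_infinite_vna g L \<and> factor g L)"
  using finite_or_direct_sum[OF assms] cstar_extreme_finite[OF assms] cstar_extreme_factor[OF assms]
    cstar_extreme_direct_sum[OF assms] by blast

end
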